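(* Let $k$ be a field with $\mathrm{char}\,k\neq3$, let $M\supset k$ be an infinite field, and let $a,b\in M$ with $a\neq b$, $a(4a+27)\ne0$ and $b(4b+27)\neq0$. Put $$H(a,b;X)=a(X^2+9X-3a)^3-b(X^3-2aX^2-9aX-2a^2-27a)^2\in M[X].$$ Let $L_a=\mathrm{Spl}_M(X^3+aX+a)$, $L_b=\mathrm{Spl}_M(X^3+bX+b)$, $G_a=\mathrm{Gal}(L_a/M)$, $G_b=\mathrm{Gal}(L_b/M)$. (A) Suppose that $X^3+aX+a$ is irreducible over $M$ and $\#G_a\ge\#G_b$. Then the list of degrees of the irreducible factors of $H(a,b;X)$ over $M$ is as follows. Case $G_a\cong\mathfrak S_3$: - $G_b\cong\mathfrak S_3$: $(6)$ if $L_a\cap L_b=M$; $(3)(3)$ if $[L_a\cap L_b:M]=2$; $(1)(2)(3)$ if $L_a=L_b$; - $G_b\cong C_3$ (then $L_a\cap L_b=M$): $(6)$; - $G_b\cong C_2$: $(6)$ if $L_a\not\supset L_b$; $(3)(3)$ if $L_a\supset L_b$; - $G_b=\{1\}$: $(6)$. Case $G_a\cong C_3$: - $G_b\cong C_3$: $(3)(3)$ if $L_a\neq L_b$; $(1)(1)(1)(3)$ if $L_a=L_b$; - $G_b\cong C_2$ (then $L_a\cap L_b=M$): $(6)$; - $G_b=\{1\}$: $(3)(3)$. (B) In particular, $L_a=L_b$ if and only if there exists $u\in M$ (with nonvanishing denominator below) such that $$b=\frac{a(u^2+9u-3a)^3}{(u^3-2au^2-9au-2a^2-27a)^2}.$$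
   Context: $\mathrm{Spl}_M f$ denotes the splitting field of $f$ over $M$ in a fixed algebraic closure of $M$. The notation $(d_1)(d_2)\cdots$ means that the irreducible factors over $M$ have degrees $d_1,d_2,\ldots$. The discriminant of $X^3+aX+a$ is $-a^2(4a+27)$. *)

theory Defs
  imports
    "HOL-Algebra.Algebraic_Closure_Type"
    "HOL-Algebra.Generated_Fields"
    "HOL-Algebra.Embedded_Algebras"
    "HOL-Algebra.Elementary_Groups"
    "HOL-Algebra.Sym_Groups"
    "HOL-Algebra.Bij"
begin

text \<open>
  The field $M$ is a type \<open>'m :: field\<close>, and \<open>'m alg_closure\<close> is the fixed algebraic closure
  of $M$. Intermediate fields are subsets of \<open>'m alg_closure\<close>.
\<close>

abbreviation base :: "'m::field alg_closure set" where
  "base \<equiv> range to_ac"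

definition spl :: "'m::field poly \<Rightarrow> 'm alg_closure set" where
  "spl f = generate_field ring_of_type_algebra
             (base \<union> {x. poly (map_poly to_ac f) x = 0})"

text \<open>
  Automorphisms of $L$ over $M$; following \<^const>\<open>BijGroup\<close>, they are total functions that are
  \<open>undefined\<close> outside of $L$, so that distinct functions are distinct automorphisms.
\<close>

definition gal :: "'m::field alg_closure set \<Rightarrow> ('m alg_closure \<Rightarrow> 'm alg_closure) monoid" where
  "gal L = (BijGroup L)
     \<lparr>carrier := {\<sigma> \<in> Bij L.
        \<sigma> \<in> ring_hom (ring_of_type_algebra\<lparr>carrier := L\<rparr>) (ring_of_type_algebra\<lparr>carrier := L\<rparr>) \<and>
        (\<forall>m. \<sigma> (to_ac m) = to_ac m)}\<rparr>"

definition cubic :: "'m::field \<Rightarrow> 'm poly" where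
  "cubic a = [:a, a, 0, 1:]"

definition H :: "'m::field \<Rightarrow> 'm \<Rightarrow> 'm poly" where
  "H a b = smult a ([:- 3 * a, 9, 1:] ^ 3)
         - smult b ([:- 2 * a ^ 2 - 27 * a, - 9 * a, - 2 * a, 1:] ^ 2)"

text \<open>
  Factors are counted with multiplicity, and they need not be monic: the leading coefficient of
  $f$ is absorbed into one of them.
\<close>

definition factor_degrees :: "'m::field poly \<Rightarrow> nat multiset \<Rightarrow> bool" where
  "factor_degrees f D \<longleftrightarrow>
     (\<exists>P. (\<forall>p \<in># P. Factorial_Ring.irreducible p) \<and> prod_mset P = f \<and>
          image_mset Polynomial.degree P = D)"

end

theory Submission
  imports Defs "HOL-Library.Numeral_Type"
begin

text \<open>
  The trace-zero elements of \<open>M[X]/(X\<^sup>3 + aX + a)\<close> form a plane. For roots \<open>x\<^sub>i\<close> of the first cubic,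
  the numbers \<open>u x\<^sub>i + 3 x\<^sub>i\<^sup>2 + 2a\<close> are the roots of \<open>Y\<^sup>3 + A Y + B\<close> with \<open>A = a(u\<^sup>2 + 9u - 3a)\<close> and
  \<open>B = a(u\<^sup>3 - 2au\<^sup>2 - 9au - 2a\<^sup>2 - 27a)\<close>, which scales to \<open>Z\<^sup>3 + bZ + b\<close> exactly when
  \<open>b = A\<^sup>3/B\<^sup>2\<close>, that is, when \<open>H(a,b;u) = 0\<close>. By interpolation the six roots of \<open>H\<close> correspond
  to the six bijections from the roots of the first cubic to those of the second, and this
  correspondence is equivariant under the automorphisms of the algebraic closure over \<open>M\<close>. So the
  degrees of the factors of \<open>H\<close> are the sizes of the orbits on bijections, and \<open>H\<close> has a root in
  \<open>M\<close> iff there is an equivariant bijection.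
\<close>

section \<open>Extending homomorphisms into the algebraic closure\<close>

text \<open>Interpolation needs only two roots, since the trace-zero elements and the target roots
  all sum to zero; its determinant is up to sign the product of the root differences, nonzero with
  the discriminant. The coefficient of \<open>3X\<^sup>2 + 2a\<close> cannot vanish, because a
  multiple of X carries X^3 + aX + a to X^3 + bX + b only if a = b. Scaling by A/B makes the linear
  and constant coefficients equal, so the scale is forced and u is the only parameter.

  The obstacle is that two splitting fields must be compared inside one action. Hence automorphisms
  of the whole closure are used: a single \<sigma> acts on both triples of roots, through a pair of
  affine maps of Z/3. Given a 3-cycle on the first roots, the case list depends on two questions
  about the group of these pairs: does it contain a 3-cycle on the first roots that is trivial on
  the second, and do the two signs always agree? The answer to the first is no exactly when the
  fields coincide; the bijections then form S_3 under conjugation by the Galois group, whence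
  (1)(2)(3) and (1)(1)(1)(3).\<close>

definition intermediate :: "'m::field alg_closure set \<Rightarrow> bool" where
  "intermediate K \<longleftrightarrow> base \<subseteq> K \<and> (\<forall>x\<in>K. \<forall>y\<in>K. x - y \<in> K \<and> x * y \<in> K)"

definition polys :: "'a::zero set \<Rightarrow> 'a poly set" where
  "polys K = {p. \<forall>i. Polynomial.coeff p i \<in> K}"

text \<open>
  A partial homomorphism over the base field is represented by its graph, a subset of
  \<open>\<Omega> \<times> \<Omega>\<close>, so that the union of a chain of extensions is literally a union.
\<close>

definition partial_hom :: "('m::field alg_closure \<times> 'm alg_closure) set \<Rightarrow> bool" where
  "partial_hom F \<longleftrightarrow> (\<forall>m. (to_ac m, to_ac m) \<in> F) \<and>
     (\<forall>x y x' y'. (x, y) \<in> F \<longrightarrow> (x', y') \<in> F \<longrightarrow> (x - x', y - y') \<in> F \<and> (x * x', y * y') \<in> F) \<and>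
     (\<forall>y. (0, y) \<in> F \<longrightarrow> y = 0)"

definition polyrel :: "('a::zero \<times> 'a) set \<Rightarrow> 'a poly \<Rightarrow> 'a poly \<Rightarrow> bool" where
  "polyrel F p q \<longleftrightarrow> (\<forall>i. (Polynomial.coeff p i, Polynomial.coeff q i) \<in> F)"

text \<open>Total functions on the whole closure, so that one \<sigma> acts on the roots of both
  cubics; bijectivity follows from algebraicity, see \<open>aut_bij\<close>.\<close>

definition aut :: "'m::field alg_closure set \<Rightarrow> ('m alg_closure \<Rightarrow> 'm alg_closure) \<Rightarrow> bool" where
  "aut K \<sigma> \<longleftrightarrow> (\<forall>x y. \<sigma> (x + y) = \<sigma> x + \<sigma> y) \<and> (\<forall>x y. \<sigma> (x * y) = \<sigma> x * \<sigma> y) \<and> (\<forall>x\<in>K. \<sigma> x = x)"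

definition minpoly :: "'a::field set \<Rightarrow> 'a \<Rightarrow> 'a poly \<Rightarrow> bool" where
  "minpoly K \<alpha> \<mu> \<longleftrightarrow> \<mu> \<in> polys K \<and> Polynomial.lead_coeff \<mu> = 1 \<and> poly \<mu> \<alpha> = 0 \<and>
     (\<forall>p\<in>polys K. p \<noteq> 0 \<longrightarrow> poly p \<alpha> = 0 \<longrightarrow> Polynomial.degree \<mu> \<le> Polynomial.degree p)"

text \<open>The witness may be any annihilating polynomial with as many roots as its degree, not
  just the minimal one. The same witness then serves over every larger field, and the cubics and
  \<open>H\<close> provide it directly.\<close>

definition separable_over :: "'a::field set \<Rightarrow> 'a \<Rightarrow> bool" where
  "separable_over K \<alpha> \<longleftrightarrow> (\<exists>f\<in>polys K. f \<noteq> 0 \<and> poly f \<alpha> = 0 \<and> card {x. poly f x = 0} = Polynomial.degree f)"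

section \<open>Calculating with partial homomorphisms and intermediate fields\<close>

lemma partial_hom_base: "partial_hom F \<Longrightarrow> (to_ac m, to_ac m) \<in> F"
  and partial_hom_diff: "partial_hom F \<Longrightarrow> (x, y) \<in> F \<Longrightarrow> (x', y') \<in> F \<Longrightarrow> (x - x', y - y') \<in> F"
  and partial_hom_mult: "partial_hom F \<Longrightarrow> (x, y) \<in> F \<Longrightarrow> (x', y') \<in> F \<Longrightarrow> (x * x', y * y') \<in> F"
  and partial_hom_zero: "partial_hom F \<Longrightarrow> (0, y) \<in> F \<Longrightarrow> y = 0"
  by (auto simp: partial_hom_def)

lemma partial_hom_0: "partial_hom F \<Longrightarrow> (0, 0) \<in> F"
  using partial_hom_base[of F 0] by simp

lemma partial_hom_1: "partial_hom F \<Longrightarrow> (1, 1) \<in> F"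
  using partial_hom_base[of F 1] by simp

lemma partial_hom_uminus: "partial_hom F \<Longrightarrow> (x, y) \<in> F \<Longrightarrow> (-x, -y) \<in> F"
  using partial_hom_diff[OF _ partial_hom_0, of F x y] by simp

lemma partial_hom_add: "partial_hom F \<Longrightarrow> (x, y) \<in> F \<Longrightarrow> (x', y') \<in> F \<Longrightarrow> (x + x', y + y') \<in> F"
  using partial_hom_diff[OF _ _ partial_hom_uminus, of F x y x' y'] by simp

lemma partial_hom_power: "partial_hom F \<Longrightarrow> (x, y) \<in> F \<Longrightarrow> (x ^ n, y ^ n) \<in> F"
  by (induction n) (auto intro: partial_hom_1 partial_hom_mult)

lemma partial_hom_sum: "partial_hom F \<Longrightarrow> (\<And>i. i \<in> A \<Longrightarrow> (f i, g i) \<in> F) \<Longrightarrow> (sum f A, sum g A) \<in> F"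
  by (induction A rule: infinite_finite_induct) (auto intro: partial_hom_0 partial_hom_add)

lemma partial_hom_unique: "partial_hom F \<Longrightarrow> (x, y) \<in> F \<Longrightarrow> (x, y') \<in> F \<Longrightarrow> y = y'"
  using partial_hom_diff[of F x y x y'] partial_hom_zero[of F "y - y'"] by simp

lemma partial_hom_poly:
  assumes "partial_hom F" "polyrel F p q" "(x, y) \<in> F"
  shows "(poly p x, poly q y) \<in> F"
proof -
  let ?n = "max (Polynomial.degree p) (Polynomial.degree q)"
  have "poly p x = (\<Sum>i\<le>?n. Polynomial.coeff p i * x ^ i)"
    "poly q y = (\<Sum>i\<le>?n. Polynomial.coeff q i * y ^ i)"
    unfolding poly_altdef by (rule sum.mono_neutral_left; auto simp: coeff_eq_0)+
  then show ?thesis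
    using assms by (auto intro!: partial_hom_sum partial_hom_mult partial_hom_power simp: polyrel_def)
qed

text \<open>Multiplicativity alone does not suffice, since \<open>inverse x\<close> is not yet known
  to lie in the domain. By algebraicity x has an annihilating polynomial c + X r over M of least
  degree, so c is nonzero and x r(x) = - c. Thus \<open>inverse x\<close> is a polynomial in x over
  M, and F respects such polynomials.\<close>

lemma partial_hom_inverse:
  assumes F: "partial_hom F" "(x, y) \<in> F"
  shows "(inverse x, inverse y) \<in> F"
proof (cases "x = 0")
  case True
  then show ?thesis using partial_hom_zero[OF F(1), of y] F partial_hom_0[OF F(1)] by auto
next
  case False
  obtain p0 :: "'a poly" where p0: "p0 \<noteq> 0" "poly (map_poly to_ac p0) x = 0"
    using alg_closure_algebraic by blast
  define P where "P = (\<lambda>p :: 'a poly. p \<noteq> 0 \<and> poly (map_poly to_ac p) x = 0)"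
  obtain p where p: "P p" "\<And>q. P q \<Longrightarrow> Polynomial.degree p \<le> Polynomial.degree q"
    using ex_has_least_nat[of P p0 Polynomial.degree] p0 P_def by auto
  obtain c r where cr: "p = pCons c r" by (cases p) auto
  have [simp]: "map_poly to_ac p = pCons (to_ac c) (map_poly to_ac r)"
    unfolding cr by (rule map_poly_pCons) simp
  have "c \<noteq> 0"
  proof
    assume "c = 0"
    then have "P r" using p(1) False \<open>map_poly to_ac p = _\<close> by (auto simp: P_def cr)
    with p(2)[of r] p(1) show False by (auto simp: cr P_def split: if_splits)
  qed
  have e: "x * poly (map_poly to_ac r) x = - to_ac c"
    using p(1) by (simp add: P_def eq_neg_iff_add_eq_0 add.commute)
  have "polyrel F (map_poly to_ac r) (map_poly to_ac r)"
    using partial_hom_base[OF F(1)] by (auto simp: polyrel_def coeff_map_poly)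
  note R = partial_hom_poly[OF F(1) this F(2)]
  have "(- to_ac c, y * poly (map_poly to_ac r) y) \<in> F"
    using partial_hom_mult[OF F(1) F(2) R] e by simp
  from partial_hom_unique[OF F(1) this, of "- to_ac c"] partial_hom_base[OF F(1), of "-c"]
  have e': "y * poly (map_poly to_ac r) y = - to_ac c" by auto
  have "inverse x = poly (map_poly to_ac r) x * to_ac (- inverse c)"
    using e \<open>c \<noteq> 0\<close> False by (simp add: field_simps)
  moreover have "inverse y = poly (map_poly to_ac r) y * to_ac (- inverse c)"
  proof -
    have "y \<noteq> 0" using e' \<open>c \<noteq> 0\<close> by auto
    then show ?thesis using e' \<open>c \<noteq> 0\<close> by (simp add: field_simps)
  qed
  ultimately show ?thesis using partial_hom_mult[OF F(1) R partial_hom_base[OF F(1), of "- inverse c"]] by simp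
qed

text \<open>Closure properties of intermediate fields become instances of those of partial
  homomorphisms, applied to the identity on K; inverses come from
  \<open>partial_hom_inverse\<close>.\<close>

lemma intermediate_iff_partial_hom: "intermediate K \<longleftrightarrow> partial_hom {(x, x) |x. x \<in> K}"
  by (auto simp: intermediate_def partial_hom_def)

lemma intermediate_closed:
  assumes "intermediate K"
  shows "to_ac m \<in> K" "0 \<in> K" "1 \<in> K"
    and "x \<in> K \<Longrightarrow> y \<in> K \<Longrightarrow> x + y \<in> K"
    and "x \<in> K \<Longrightarrow> y \<in> K \<Longrightarrow> x - y \<in> K"
    and "x \<in> K \<Longrightarrow> y \<in> K \<Longrightarrow> x * y \<in> K"
    and "x \<in> K \<Longrightarrow> - x \<in> K"
    and "x \<in> K \<Longrightarrow> inverse x \<in> K"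
    and "x \<in> K \<Longrightarrow> y \<in> K \<Longrightarrow> x / y \<in> K"
    and "x \<in> K \<Longrightarrow> x ^ n \<in> K"
proof -
  note F = assms[unfolded intermediate_iff_partial_hom]
  show "to_ac m \<in> K" "0 \<in> K" "1 \<in> K"
    using partial_hom_base[OF F] partial_hom_0[OF F] partial_hom_1[OF F] by auto
  show "x \<in> K \<Longrightarrow> y \<in> K \<Longrightarrow> x + y \<in> K" "x \<in> K \<Longrightarrow> y \<in> K \<Longrightarrow> x - y \<in> K"
    "x \<in> K \<Longrightarrow> y \<in> K \<Longrightarrow> x * y \<in> K" "x \<in> K \<Longrightarrow> - x \<in> K" "x \<in> K \<Longrightarrow> inverse x \<in> K"
    "x \<in> K \<Longrightarrow> x ^ n \<in> K"
    using partial_hom_add[OF F, of x x y y] partial_hom_diff[OF F, of x x y y] partial_hom_mult[OF F, of x x y y]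
      partial_hom_uminus[OF F, of x x] partial_hom_inverse[OF F, of x x] partial_hom_power[OF F, of x x n] by auto
  then show "x \<in> K \<Longrightarrow> y \<in> K \<Longrightarrow> x / y \<in> K"
    using partial_hom_inverse[OF F, of y y] partial_hom_mult[OF F, of x x "inverse y" "inverse y"]
    by (auto simp: field_class.field_divide_inverse)
qed

lemma intermediate_base: "intermediate base"
  unfolding intermediate_def by (auto simp flip: to_ac_diff to_ac_mult)

lemma intermediate_polys:
  assumes K: "intermediate K"
  shows "p \<in> polys K \<Longrightarrow> q \<in> polys K \<Longrightarrow> p - q \<in> polys K"
    and "p \<in> polys K \<Longrightarrow> q \<in> polys K \<Longrightarrow> p * q \<in> polys K"
    and "c \<in> K \<Longrightarrow> Polynomial.monom c n \<in> polys K"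
    and "c \<in> K \<Longrightarrow> p \<in> polys K \<Longrightarrow> pCons c p \<in> polys K"
    and "c \<in> K \<Longrightarrow> p \<in> polys K \<Longrightarrow> Polynomial.smult c p \<in> polys K"
    and "0 \<in> polys K"
proof -
  have sum: "(\<And>i. i \<in> A \<Longrightarrow> f i \<in> K) \<Longrightarrow> sum f A \<in> K" for f and A :: "nat set"
    by (induction A rule: infinite_finite_induct) (auto intro: intermediate_closed[OF K])
  show "p \<in> polys K \<Longrightarrow> q \<in> polys K \<Longrightarrow> p - q \<in> polys K"
    "p \<in> polys K \<Longrightarrow> q \<in> polys K \<Longrightarrow> p * q \<in> polys K"
    "c \<in> K \<Longrightarrow> Polynomial.monom c n \<in> polys K"
    "c \<in> K \<Longrightarrow> p \<in> polys K \<Longrightarrow> pCons c p \<in> polys K"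
    "c \<in> K \<Longrightarrow> p \<in> polys K \<Longrightarrow> Polynomial.smult c p \<in> polys K" "0 \<in> polys K"
    by (auto simp: polys_def coeff_mult coeff_pCons intro!: sum intermediate_closed[OF K]
        split: nat.splits)
qed

lemma polys_base: "map_poly to_ac p \<in> polys base"
  by (auto simp: polys_def coeff_map_poly)

lemma polys_baseE:
  assumes "q \<in> polys base"
  obtains p where "q = map_poly to_ac p"
proof
  show "q = map_poly to_ac (map_poly of_ac q)"
    using assms by (intro poly_eqI) (auto simp: polys_def coeff_map_poly to_ac_of_ac)
qed

lemma polys_mono: "K \<subseteq> K' \<Longrightarrow> polys K \<subseteq> polys K'"
  by (auto simp: polys_def)

section \<open>Minimal polynomials over intermediate fields\<close>

lemma minpoly_exists:
  fixes \<alpha> :: "'m::field alg_closure"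
  assumes K: "intermediate K"
  shows "\<exists>\<mu>. minpoly K \<alpha> \<mu>"
proof -
  define P where "P = (\<lambda>p. p \<in> polys K \<and> p \<noteq> 0 \<and> poly p \<alpha> = 0)"
  obtain p0 :: "'m poly" where "p0 \<noteq> 0" "poly (map_poly to_ac p0) \<alpha> = 0"
    using alg_closure_algebraic by blast
  then have "P (map_poly to_ac p0)"
    using polys_base polys_mono[of base K] K by (auto simp: P_def intermediate_def map_poly_eq_0_iff)
  then obtain p where p: "P p" "\<And>q. P q \<Longrightarrow> Polynomial.degree p \<le> Polynomial.degree q"
    using ex_has_least_nat[of P _ Polynomial.degree] by blast
  have "minpoly K \<alpha> (Polynomial.smult (inverse (Polynomial.lead_coeff p)) p)"
    using p unfolding minpoly_def P_def
    by (auto intro!: intermediate_polys[OF K] intermediate_closed[OF K] simp: polys_def)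
  then show ?thesis by blast
qed

lemma minpoly_degree_pos: "minpoly K \<alpha> \<mu> \<Longrightarrow> Polynomial.degree \<mu> > 0"
proof (rule ccontr)
  assume m: "minpoly K \<alpha> \<mu>" and "\<not> Polynomial.degree \<mu> > 0"
  then obtain c where "\<mu> = [:c:]" by (auto elim: degree_eq_zeroE)
  with m show False by (auto simp: minpoly_def)
qed

text \<open>One step of long division by a monic divisor, isolated so that the coefficients can be
  followed: they stay in K, and the same step is later performed on two related polynomials at
  once.\<close>

lemma reduce_degree:
  fixes p :: "'a::field poly"
  assumes "Polynomial.lead_coeff \<mu> = 1" "Polynomial.degree \<mu> > 0" "Polynomial.degree \<mu> \<le> Polynomial.degree p"
  shows "Polynomial.degree (p - Polynomial.monom (Polynomial.lead_coeff p)
            (Polynomial.degree p - Polynomial.degree \<mu>) * \<mu>) < Polynomial.degree p"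
    (is "Polynomial.degree ?r < _")
proof -
  have "p \<noteq> 0" "\<mu> \<noteq> 0" using assms by auto
  then have d: "Polynomial.degree (Polynomial.monom (Polynomial.lead_coeff p)
      (Polynomial.degree p - Polynomial.degree \<mu>) * \<mu>) = Polynomial.degree p"
    using assms by (simp add: Polynomial.degree_mult_eq degree_monom_eq)
  have "Polynomial.degree ?r \<le> Polynomial.degree p" using d by (intro degree_diff_le) auto
  moreover have "Polynomial.coeff ?r (Polynomial.degree p) = 0"
    using assms by (simp add: coeff_monom_mult)
  ultimately show ?thesis
    using eq_zero_or_degree_less[of ?r "Polynomial.degree p"] assms(2,3) by force
qed

lemma minpoly_rep:
  assumes K: "intermediate K" and m: "minpoly K \<alpha> \<mu>" and "p \<in> polys K"
  shows "\<exists>q\<in>polys K. poly q \<alpha> = poly p \<alpha> \<and> Polynomial.degree q < Polynomial.degree \<mu>"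
  using assms(3)
proof (induction "Polynomial.degree p" arbitrary: p rule: less_induct)
  case less
  show ?case
  proof (cases "Polynomial.degree p < Polynomial.degree \<mu>")
    case False
    let ?r = "p - Polynomial.monom (Polynomial.lead_coeff p) (Polynomial.degree p - Polynomial.degree \<mu>) * \<mu>"
    have "Polynomial.degree ?r < Polynomial.degree p"
      using reduce_degree[of \<mu> p] m False minpoly_degree_pos[OF m] by (auto simp: minpoly_def)
    moreover have "?r \<in> polys K"
      using less.prems m by (intro intermediate_polys[OF K]) (auto simp: polys_def minpoly_def)
    moreover have "poly ?r \<alpha> = poly p \<alpha>" using m by (simp add: minpoly_def)
    ultimately show ?thesis using less.hyps[of ?r] by auto
  qed (use less in auto)
qed

lemma minpoly_dvd:
  assumes K: "intermediate K" and m: "minpoly K \<alpha> \<mu>" and "p \<in> polys K" "poly p \<alpha> = 0"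
  shows "\<mu> dvd p"
  using assms(3,4)
proof (induction "Polynomial.degree p" arbitrary: p rule: less_induct)
  case less
  show ?case
  proof (cases "p = 0")
    case False
    let ?r = "p - Polynomial.monom (Polynomial.lead_coeff p) (Polynomial.degree p - Polynomial.degree \<mu>) * \<mu>"
    have "Polynomial.degree \<mu> \<le> Polynomial.degree p" using less.prems m False by (auto simp: minpoly_def)
    then have "Polynomial.degree ?r < Polynomial.degree p"
      using reduce_degree[of \<mu> p] m minpoly_degree_pos[OF m] by (auto simp: minpoly_def)
    moreover have "?r \<in> polys K"
      using less.prems m by (intro intermediate_polys[OF K]) (auto simp: polys_def minpoly_def)
    moreover have "poly ?r \<alpha> = 0" using m less.prems by (simp add: minpoly_def)
    ultimately have "\<mu> dvd ?r" using less.hyps[of ?r] by auto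
    from dvd_add[OF this dvd_triv_right[of \<mu> "Polynomial.monom (Polynomial.lead_coeff p)
      (Polynomial.degree p - Polynomial.degree \<mu>)"]] show ?thesis by simp
  qed auto
qed

text \<open>Write f = \<mu> g. The roots of f number deg \<mu> + deg g, while \<mu> and g have at
  most deg \<mu> and deg g roots; so neither bound can be strict.\<close>

lemma separable_over_minpoly_card:
  assumes K: "intermediate K" and m: "minpoly K \<alpha> \<mu>" and "separable_over K \<alpha>"
  shows "card {x. poly \<mu> x = 0} = Polynomial.degree \<mu>"
proof -
  obtain f where f: "f \<in> polys K" "f \<noteq> 0" "poly f \<alpha> = 0" "card {x. poly f x = 0} = Polynomial.degree f"
    using assms(3) by (auto simp: separable_over_def)
  obtain g where g: "f = \<mu> * g" using minpoly_dvd[OF K m f(1,3)] by (auto elim: dvdE)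
  have n: "\<mu> \<noteq> 0" "g \<noteq> 0" using f(2) g by auto
  have "{x. poly f x = 0} = {x. poly \<mu> x = 0} \<union> {x. poly g x = 0}" by (auto simp: g)
  then have "Polynomial.degree f \<le> card {x. poly \<mu> x = 0} + card {x. poly g x = 0}"
    using f(4) by (metis card_Un_le)
  moreover have "Polynomial.degree f = Polynomial.degree \<mu> + Polynomial.degree g"
    using n by (simp add: g Polynomial.degree_mult_eq)
  moreover have "card {x. poly \<mu> x = 0} \<le> Polynomial.degree \<mu>" "card {x. poly g x = 0} \<le> Polynomial.degree g"
    using n card_poly_roots_bound by auto
  ultimately show ?thesis by linarith
qed

text \<open>Well-definedness of the extension sending \<alpha> to \<beta>: p is divided by \<mu> and
  q by \<nu> in parallel, and the remainders stay related by F.\<close>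

lemma partial_hom_poly_zero:
  assumes F: "partial_hom F" and m: "minpoly (Domain F) \<alpha> \<mu>" and \<nu>: "polyrel F \<mu> \<nu>" "poly \<nu> \<beta> = 0"
    and "polyrel F p q" "poly p \<alpha> = 0"
  shows "poly q \<beta> = 0"
  using assms(5,6)
proof (induction "Polynomial.degree p" arbitrary: p q rule: less_induct)
  case less
  show ?case
  proof (cases "p = 0")
    case True
    then have "q = 0" using less.prems partial_hom_zero[OF F] by (intro poly_eqI) (auto simp: polyrel_def)
    then show ?thesis by simp
  next
    case False
    let ?n = "Polynomial.degree p" and ?d = "Polynomial.degree p - Polynomial.degree \<mu>"
    let ?r = "p - Polynomial.monom (Polynomial.lead_coeff p) ?d * \<mu>"
    \<comment> \<open>The coefficient of q at the degree of p is the partner under F of the leading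
      coefficient of p; the degree of q is not tracked.\<close>
    let ?s = "q - Polynomial.monom (Polynomial.coeff q ?n) ?d * \<nu>"
    have "p \<in> polys (Domain F)" using less.prems by (auto simp: polys_def polyrel_def)
    then have "Polynomial.degree \<mu> \<le> Polynomial.degree p" using less.prems m False by (auto simp: minpoly_def)
    then have "Polynomial.degree ?r < Polynomial.degree p"
      using reduce_degree[of \<mu> p] m minpoly_degree_pos[OF m] by (auto simp: minpoly_def)
    moreover have "polyrel F ?r ?s"
      using less.prems \<nu> unfolding polyrel_def
      by (auto simp: coeff_monom_mult intro!: partial_hom_diff[OF F] partial_hom_mult[OF F] partial_hom_0[OF F])
    moreover have "poly ?r \<alpha> = 0" using m less.prems by (simp add: minpoly_def)
    ultimately have "poly ?s \<beta> = 0" using less.hyps by blast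
    then show ?thesis using \<nu> by simp
  qed
qed

lemma polyrel_pCons: "(c, d) \<in> F \<Longrightarrow> polyrel F p q \<Longrightarrow> polyrel F (pCons c p) (pCons d q)"
  by (auto simp: polyrel_def coeff_pCons split: nat.splits)

text \<open>The extension evaluates related polynomials at \<alpha> and \<beta>; that the result
  depends only on the element, not on the polynomial, is
  \<open>partial_hom_poly_zero\<close>.\<close>

lemma partial_hom_extend:
  assumes F: "partial_hom F" and m: "minpoly (Domain F) \<alpha> \<mu>" and \<nu>: "polyrel F \<mu> \<nu>" "poly \<nu> \<beta> = 0"
  shows "\<exists>F'. partial_hom F' \<and> F \<subseteq> F' \<and> (\<alpha>, \<beta>) \<in> F'"
proof -
  define F' where "F' = {(poly p \<alpha>, poly q \<beta>) |p q. polyrel F p q}"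
  have z: "polyrel F 0 0" using partial_hom_0[OF F] by (auto simp: polyrel_def)
  have sub: "F \<subseteq> F'"
  proof
    fix v assume v: "v \<in> F"
    obtain x y where [simp]: "v = (x, y)" by (cases v)
    have "polyrel F [:x:] [:y:]" using v by (auto intro!: polyrel_pCons z)
    then show "v \<in> F'" by (force simp: F'_def)
  qed
  have "polyrel F [:0, 1:] [:0, 1:]" using partial_hom_0[OF F] partial_hom_1[OF F] by (auto intro!: polyrel_pCons z)
  then have ab: "(\<alpha>, \<beta>) \<in> F'" by (force simp: F'_def)
  have "partial_hom F'" unfolding partial_hom_def
  proof (intro conjI allI impI)
    fix m show "(to_ac m, to_ac m) \<in> F'" using sub partial_hom_base[OF F] by auto
  next
    fix x y x' y' assume "(x, y) \<in> F'" "(x', y') \<in> F'"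
    then obtain p q p' q' where *: "polyrel F p q" "polyrel F p' q'"
      "x = poly p \<alpha>" "y = poly q \<beta>" "x' = poly p' \<alpha>" "y' = poly q' \<beta>"
      by (auto simp: F'_def)
    have "polyrel F (p - p') (q - q')" using * by (auto simp: polyrel_def intro: partial_hom_diff[OF F])
    then show "(x - x', y - y') \<in> F'" using * by (force simp: F'_def)
    have "polyrel F (p * p') (q * q')"
      using * by (auto simp: polyrel_def coeff_mult intro!: partial_hom_sum[OF F] partial_hom_mult[OF F])
    then show "(x * x', y * y') \<in> F'" using * by (force simp: F'_def)
  next
    fix y assume "(0, y) \<in> F'"
    then show "y = 0" using partial_hom_poly_zero[OF F m \<nu>] by (force simp: F'_def)
  qed
  with sub ab show ?thesis by blast
qed

text \<open>Positive degree guarantees a root of the transported polynomial in the closure. It holds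
  because the leading coefficient 1 is carried to 1.\<close>

lemma partial_hom_extend_minpoly:
  assumes F: "partial_hom F" and m: "minpoly (Domain F) \<alpha> \<mu>"
  shows "\<exists>\<nu>. polyrel F \<mu> \<nu> \<and> Polynomial.degree \<nu> > 0"
proof -
  \<comment> \<open>The value at 0 is fixed to be 0 because \<open>map_poly\<close> acts
    coefficientwise for maps that preserve 0.\<close>
  define s where "s = (\<lambda>x. if x = 0 then 0 else SOME y. (x, y) \<in> F)"
  have s: "(x, s x) \<in> F" if "x \<in> Domain F" for x
    using that someI_ex[of "\<lambda>y. (x, y) \<in> F"] partial_hom_0[OF F] by (auto simp: s_def)
  have "s 0 = 0" by (simp add: s_def)
  then have tsch_rel: "polyrel F \<mu> (map_poly s \<mu>)"
    using m s by (auto simp: polyrel_def coeff_map_poly minpoly_def polys_def)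
  have "Polynomial.coeff (map_poly s \<mu>) (Polynomial.degree \<mu>) = 1"
    using tsch_rel m partial_hom_unique[OF F _ partial_hom_1[OF F]] unfolding polyrel_def minpoly_def by metis
  then have "Polynomial.degree (map_poly s \<mu>) \<ge> Polynomial.degree \<mu>"
    by (metis le_degree one_neq_zero)
  then show ?thesis using tsch_rel minpoly_degree_pos[OF m] by auto
qed

lemma intermediate_Domain: "partial_hom F \<Longrightarrow> intermediate (Domain F)"
  unfolding intermediate_def
  by (auto intro: partial_hom_base partial_hom_diff partial_hom_mult DomainI)

text \<open>Zorn's lemma for graphs ordered by inclusion. A maximal graph is total: for any
  \<alpha>, the transported minimal polynomial has a root \<beta>, and the graph extends by the pair
  of \<alpha> and \<beta>.\<close>

theorem partial_hom_extends_to_aut: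
  fixes F :: "('m::field alg_closure \<times> 'm alg_closure) set"
  assumes F: "partial_hom F"
  shows "\<exists>\<sigma>. aut base \<sigma> \<and> (\<forall>(x, y)\<in>F. \<sigma> x = y)"
proof -
  define A where "A = {G. partial_hom G \<and> F \<subseteq> G}"
  have "\<exists>M\<in>A. \<forall>B\<in>A. M \<subseteq> B \<longrightarrow> B = M"
  proof (rule subset_Zorn_nonempty)
    show "A \<noteq> {}" using F by (auto simp: A_def)
  next
    fix C assume C: "C \<noteq> {}" "subset.chain A C"
    have CA: "\<And>G. G \<in> C \<Longrightarrow> partial_hom G \<and> F \<subseteq> G" using C(2) by (auto simp: subset_chain_def A_def)
    \<comment> \<open>In a chain, two pairs of the union lie in a common member, which is closed
      under the operations.\<close>
    have common: "\<exists>G\<in>C. u \<in> G \<and> v \<in> G" if uv: "u \<in> \<Union>C" "v \<in> \<Union>C" for u v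
    proof -
      obtain G G' where "G \<in> C" "u \<in> G" "G' \<in> C" "v \<in> G'" using uv by blast
      moreover from this have "G \<subseteq> G' \<or> G' \<subseteq> G" using C(2) by (simp add: subset_chain_def)
      ultimately show ?thesis by blast
    qed
    have "partial_hom (\<Union>C)" unfolding partial_hom_def
    proof (intro conjI allI impI)
      fix m show "(to_ac m, to_ac m) \<in> \<Union>C" using C(1) CA partial_hom_base by fastforce
    next
      fix x y x' y' assume "(x, y) \<in> \<Union>C" "(x', y') \<in> \<Union>C"
      from common[OF this] obtain G where "G \<in> C" "(x, y) \<in> G" "(x', y') \<in> G" by blast
      moreover from this have "(x - x', y - y') \<in> G" "(x * x', y * y') \<in> G"
        using CA[of G] partial_hom_diff[of G] partial_hom_mult[of G] by auto
      ultimately show "(x - x', y - y') \<in> \<Union>C" "(x * x', y * y') \<in> \<Union>C" by auto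
    next
      fix y assume "(0, y) \<in> \<Union>C" then show "y = 0" using CA partial_hom_zero by auto
    qed
    then show "\<Union>C \<in> A" using C(1) CA by (auto simp: A_def)
  qed
  then obtain G where GA: "G \<in> A" and max: "\<forall>B\<in>A. G \<subseteq> B \<longrightarrow> B = G" by blast
  then have G: "partial_hom G" "F \<subseteq> G" by (auto simp: A_def)
  have G_max: "B = G" if "partial_hom B" "G \<subseteq> B" for B
    using that max G(2) unfolding A_def by blast
  have dom: "\<alpha> \<in> Domain G" for \<alpha>
  proof -
    obtain \<mu> where m: "minpoly (Domain G) \<alpha> \<mu>"
      using minpoly_exists[OF intermediate_Domain[OF G(1)]] by blast
    obtain \<nu> where \<nu>: "polyrel G \<mu> \<nu>" "Polynomial.degree \<nu> > 0"
      using partial_hom_extend_minpoly[OF G(1) m] by blast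
    obtain \<beta> where "poly \<nu> \<beta> = 0" using alg_closed_imp_poly_has_root[OF \<nu>(2)] by blast
    then show ?thesis using partial_hom_extend[OF G(1) m \<nu>(1)] G_max by blast
  qed
  define \<sigma> where "\<sigma> x = (SOME y. (x, y) \<in> G)" for x
  have s: "(x, \<sigma> x) \<in> G" for x using dom[of x] someI_ex[of "\<lambda>y. (x, y) \<in> G"] by (auto simp: \<sigma>_def)
  have s': "(x, y) \<in> G \<Longrightarrow> \<sigma> x = y" for x y using s partial_hom_unique[OF G(1)] by blast
  have "aut base \<sigma>" unfolding aut_def
    using partial_hom_add[OF G(1) s s] partial_hom_mult[OF G(1) s s] partial_hom_base[OF G(1)] by (auto intro!: s')
  then show ?thesis using s' G(2) by blast
qed

section \<open>Automorphisms of the algebraic closure\<close>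

lemma aut_closed:
  fixes \<sigma> :: "'m::field alg_closure \<Rightarrow> 'm alg_closure"
  assumes "aut K \<sigma>" "intermediate K"
  shows "\<sigma> (x + y) = \<sigma> x + \<sigma> y" "\<sigma> (x * y) = \<sigma> x * \<sigma> y" "\<sigma> (to_ac m) = to_ac m"
    "\<sigma> 0 = 0" "\<sigma> 1 = 1" "\<sigma> (- x) = - \<sigma> x" "\<sigma> (x - y) = \<sigma> x - \<sigma> y"
    "\<sigma> (x ^ n) = \<sigma> x ^ n" "\<sigma> (numeral k) = numeral k"
    "\<sigma> (inverse x) = inverse (\<sigma> x)" "\<sigma> (x / y) = \<sigma> x / \<sigma> y" "\<sigma> x = 0 \<longleftrightarrow> x = 0"
proof -
  show a: "\<sigma> (x + y) = \<sigma> x + \<sigma> y" "\<sigma> (x * y) = \<sigma> x * \<sigma> y" for x y using assms by (auto simp: aut_def)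
  show b: "\<sigma> (to_ac m) = to_ac m" for m
    using assms(1) intermediate_closed(1)[OF assms(2)] by (auto simp: aut_def)
  show z: "\<sigma> 0 = 0" and o: "\<sigma> 1 = 1" using b[of 0] b[of 1] by auto
  show n: "\<sigma> (- x) = - \<sigma> x" for x using a(1)[of x "-x"] z by (simp add: eq_neg_iff_add_eq_0 add.commute)
  show "\<sigma> (x - y) = \<sigma> x - \<sigma> y" using a(1)[of x "-y"] n by simp
  show "\<sigma> (x ^ n) = \<sigma> x ^ n" by (induction n) (auto simp: a o)
  show "\<sigma> (numeral k) = numeral k" using b[of "numeral k"] by simp
  show i: "\<sigma> (inverse x) = inverse (\<sigma> x)" for x
  proof (cases "x = 0")
    case False
    then have "\<sigma> x * \<sigma> (inverse x) = 1" using a(2)[of x "inverse x"] o by simp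
    then show ?thesis by (metis inverse_unique)
  qed (simp add: z)
  show "\<sigma> (x / y) = \<sigma> x / \<sigma> y" by (simp add: field_class.field_divide_inverse a i)
  show "\<sigma> x = 0 \<longleftrightarrow> x = 0" using z o a(2)[of x "inverse x"] by (cases "x = 0") auto
qed

lemma aut_poly:
  assumes "aut K \<sigma>" "intermediate K" "p \<in> polys K"
  shows "\<sigma> (poly p x) = poly p (\<sigma> x)"
  using assms(3)
proof (induction p)
  case (pCons c p)
  have "p \<in> polys K" "c \<in> K"
    using pCons.prems unfolding polys_def by (auto simp: coeff_pCons split: nat.splits dest: spec[of _ "Suc _"] spec[of _ 0])
  then show ?case using pCons.IH assms(1) by (simp add: aut_closed[OF assms(1,2)]) (simp add: aut_def)
qed (simp add: aut_closed[OF assms(1,2)])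

lemma aut_inj: "aut K \<sigma> \<Longrightarrow> intermediate K \<Longrightarrow> \<sigma> x = \<sigma> y \<longleftrightarrow> x = y"
  using aut_closed(7)[of K \<sigma> x y] aut_closed(12)[of K \<sigma> "x - y"] by auto

lemma aut_mono: "aut K \<sigma> \<Longrightarrow> K' \<subseteq> K \<Longrightarrow> aut K' \<sigma>"
  by (auto simp: aut_def)

lemma aut_to_base: "aut K \<sigma> \<Longrightarrow> intermediate K \<Longrightarrow> aut base \<sigma>"
  by (rule aut_mono) (auto simp: intermediate_def)

lemma aut_comp: "aut K \<sigma> \<Longrightarrow> aut K \<tau> \<Longrightarrow> aut K (\<sigma> \<circ> \<tau>)"
  by (auto simp: aut_def)

lemma aut_id: "aut K id"
  by (auto simp: aut_def)

text \<open>Surjectivity: y is among the finitely many roots of a polynomial over M, and \<sigma>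
  maps this set injectively into itself.\<close>

lemma aut_bij:
  assumes "aut base \<sigma>"
  shows "bij \<sigma>"
proof (rule bijI)
  show "inj \<sigma>" using aut_inj[OF assms intermediate_base] by (auto simp: inj_def)
  then have inj: "inj_on \<sigma> A" for A by (auto simp: inj_on_def)
  show "surj \<sigma>" unfolding surj_def
  proof
    fix y :: "'a alg_closure"
    obtain p :: "'a poly" where p: "p \<noteq> 0" "poly (map_poly to_ac p) y = 0" using alg_closure_algebraic by blast
    let ?R = "{x. poly (map_poly to_ac p) x = 0}"
    have "finite ?R" using p by (intro poly_roots_finite) (simp add: map_poly_eq_0_iff)
    moreover have "\<sigma> ` ?R \<subseteq> ?R"
    proof safe
      fix x assume "poly (map_poly to_ac p) x = 0"
      then show "poly (map_poly to_ac p) (\<sigma> x) = 0"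
        using aut_poly[OF assms intermediate_base polys_base[of p], of x] aut_closed(4)[OF assms intermediate_base]
        by simp
    qed
    ultimately have "\<sigma> ` ?R = ?R" using inj by (intro endo_inj_surj) auto
    then show "\<exists>x. y = \<sigma> x" using p by blast
  qed
qed

lemma aut_inv:
  assumes "aut K \<sigma>" "intermediate K"
  shows "aut K (inv' \<sigma>)"
proof -
  have b: "bij \<sigma>" using aut_bij aut_to_base assms by blast
  then have [simp]: "\<sigma> (inv' \<sigma> x) = x" "inv' \<sigma> (\<sigma> x) = x" for x
    by (auto simp: bij_is_surj surj_f_inv_f bij_is_inj)
  have *: "inv' \<sigma> x = y" if "x = \<sigma> y" for x y using that by simp
  have "inv' \<sigma> x = x" if "x \<in> K" for x
    using that assms(1) by (intro *) (auto simp: aut_def)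
  moreover have "inv' \<sigma> (x + y) = inv' \<sigma> x + inv' \<sigma> y" "inv' \<sigma> (x * y) = inv' \<sigma> x * inv' \<sigma> y" for x y
    by (rule *, simp add: aut_closed[OF assms])+
  ultimately show ?thesis by (simp add: aut_def)
qed

text \<open>The identity on K carries \<mu> to itself, so every root of \<mu> is an admissible image
  of \<alpha>; the extension theorem then reaches the whole closure.\<close>

lemma minpoly_conjugate:
  fixes \<alpha> :: "'m::field alg_closure"
  assumes K: "intermediate K" and m: "minpoly K \<alpha> \<mu>" and \<beta>: "poly \<mu> \<beta> = 0"
  shows "\<exists>\<sigma>. aut K \<sigma> \<and> \<sigma> \<alpha> = \<beta>"
proof -
  let ?F = "{(x, x) |x. x \<in> K}"
  have F: "partial_hom ?F" using K by (simp add: intermediate_iff_partial_hom)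
  have D: "Domain ?F = K" by auto
  have "polyrel ?F \<mu> \<mu>" using m by (auto simp: polyrel_def minpoly_def polys_def)
  moreover have "minpoly (Domain ?F) \<alpha> \<mu>" unfolding D by (rule m)
  ultimately have "\<exists>F'. partial_hom F' \<and> ?F \<subseteq> F' \<and> (\<alpha>, \<beta>) \<in> F'"
    using partial_hom_extend[OF F] \<beta> by blast
  then obtain F' where F': "partial_hom F'" "?F \<subseteq> F'" "(\<alpha>, \<beta>) \<in> F'" by blast
  from partial_hom_extends_to_aut[OF F'(1)] obtain \<sigma> where "aut base \<sigma>" "\<forall>(x, y)\<in>F'. \<sigma> x = y" by blast
  with F' show ?thesis by (intro exI[of _ \<sigma>]) (auto simp: aut_def)
qed

text \<open>This is K[\<alpha>], which for intermediate K is already the field K(\<alpha>) because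
  \<alpha> is algebraic.\<close>

definition adjoin :: "'m::field alg_closure set \<Rightarrow> 'm alg_closure \<Rightarrow> 'm alg_closure set" where
  "adjoin K \<alpha> = {poly p \<alpha> |p. p \<in> polys K}"

lemma adjoin_supset:
  assumes "intermediate K" shows "K \<subseteq> adjoin K \<alpha>" "\<alpha> \<in> adjoin K \<alpha>"
proof -
  show "K \<subseteq> adjoin K \<alpha>"
  proof
    fix x assume "x \<in> K"
    then have "[:x:] \<in> polys K" by (intro intermediate_polys[OF assms])
    then show "x \<in> adjoin K \<alpha>" unfolding adjoin_def by force
  qed
  have "[:0, 1:] \<in> polys K" by (intro intermediate_polys[OF assms] intermediate_closed[OF assms])
  then show "\<alpha> \<in> adjoin K \<alpha>" unfolding adjoin_def by force
qed

lemma intermediate_adjoin: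
  assumes K: "intermediate K" shows "intermediate (adjoin K \<alpha>)"
  unfolding intermediate_def
proof (intro conjI ballI)
  show "base \<subseteq> adjoin K \<alpha>" using adjoin_supset(1)[OF K, of \<alpha>] K unfolding intermediate_def by blast
  fix x y assume "x \<in> adjoin K \<alpha>" "y \<in> adjoin K \<alpha>"
  then obtain p q where *: "p \<in> polys K" "q \<in> polys K" "x = poly p \<alpha>" "y = poly q \<alpha>"
    by (auto simp: adjoin_def)
  show "x - y \<in> adjoin K \<alpha>" "x * y \<in> adjoin K \<alpha>"
    unfolding adjoin_def using * intermediate_polys(1,2)[OF K *(1,2)]
    by (auto intro: exI[of _ "p - q"] exI[of _ "p * q"])
qed

text \<open>
  If \<open>u = p(\<alpha>)\<close> with \<open>deg p < deg \<mu>\<close>, then \<open>p - u\<close> vanishes at all \<open>deg \<mu>\<close> conjugates of \<open>\<alpha>\<close>, so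
  \<open>p\<close> is constant.
\<close>

lemma fixed_adjoin:
  assumes K: "intermediate K" and s: "separable_over K \<alpha>" and u: "u \<in> adjoin K \<alpha>"
    and fixed: "\<And>\<sigma>. aut K \<sigma> \<Longrightarrow> \<sigma> u = u"
  shows "u \<in> K"
proof -
  obtain \<mu> where m: "minpoly K \<alpha> \<mu>" using minpoly_exists[OF K] by blast
  obtain p where p: "p \<in> polys K" "u = poly p \<alpha>" "Polynomial.degree p < Polynomial.degree \<mu>"
    using u minpoly_rep[OF K m] unfolding adjoin_def by force
  have eq: "poly p \<beta> = poly [:u:] \<beta>" if \<beta>: "poly \<mu> \<beta> = 0" for \<beta>
  proof -
    obtain \<sigma> where "aut K \<sigma>" "\<sigma> \<alpha> = \<beta>" using minpoly_conjugate[OF K m \<beta>] by blast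
    then show ?thesis using fixed[of \<sigma>] p aut_poly[of K \<sigma> p \<alpha>] K by auto
  qed
  have "p = [:u:]"
    by (rule poly_eqI_degree[of "{x. poly \<mu> x = 0}"])
      (use eq p separable_over_minpoly_card[OF K m s] minpoly_degree_pos[OF m] in auto)
  with p(1) show ?thesis by (auto simp: polys_def dest: spec[of _ 0])
qed

lemma separable_over_mono: "K \<subseteq> K' \<Longrightarrow> separable_over K \<alpha> \<Longrightarrow> separable_over K' \<alpha>"
  using polys_mono[of K K'] by (auto simp: separable_over_def)

text \<open>One generator is peeled off: automorphisms fixing K(\<alpha>) also fix K, so by
  induction u lies in K(\<alpha>), and \<open>fixed_adjoin\<close> descends to K.\<close>

lemma fixed_foldl_adjoin:
  assumes "intermediate K" "\<And>\<alpha>. \<alpha> \<in> set \<alpha>s \<Longrightarrow> separable_over K \<alpha>" "u \<in> foldl adjoin K \<alpha>s"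
    and "\<And>\<sigma>. aut K \<sigma> \<Longrightarrow> \<sigma> u = u"
  shows "u \<in> K"
  using assms
proof (induction \<alpha>s arbitrary: K)
  case (Cons \<alpha> \<alpha>s)
  note K = Cons.prems(1)
  have sub: "K \<subseteq> adjoin K \<alpha>" using adjoin_supset[OF K] by blast
  have "u \<in> adjoin K \<alpha>"
  proof (rule Cons.IH)
    show "intermediate (adjoin K \<alpha>)" by (rule intermediate_adjoin[OF K])
    show "separable_over (adjoin K \<alpha>) \<beta>" if "\<beta> \<in> set \<alpha>s" for \<beta>
      using that Cons.prems(2) by (intro separable_over_mono[OF sub]) auto
    show "u \<in> foldl adjoin (adjoin K \<alpha>) \<alpha>s" using Cons.prems(3) by simp
    show "\<sigma> u = u" if "aut (adjoin K \<alpha>) \<sigma>" for \<sigma>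
      using aut_mono[OF that sub] Cons.prems(4) by blast
  qed
  then show ?case using fixed_adjoin[OF K] Cons.prems by auto
qed auto

lemma foldl_adjoin:
  assumes "intermediate K"
  shows "intermediate (foldl adjoin K \<alpha>s)" "K \<union> set \<alpha>s \<subseteq> foldl adjoin K \<alpha>s"
proof -
  have "intermediate (foldl adjoin K \<alpha>s) \<and> K \<union> set \<alpha>s \<subseteq> foldl adjoin K \<alpha>s"
    using assms
  proof (induction \<alpha>s arbitrary: K)
    case (Cons \<alpha> \<alpha>s)
    then show ?case using intermediate_adjoin[of K \<alpha>] adjoin_supset[of K \<alpha>] by fastforce
  qed auto
  then show "intermediate (foldl adjoin K \<alpha>s)" "K \<union> set \<alpha>s \<subseteq> foldl adjoin K \<alpha>s" by auto
qed

section \<open>Orbits, splitting fields and Galois groups\<close>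

definition orb :: "'m::field alg_closure \<Rightarrow> 'm alg_closure set" where
  "orb u = {\<sigma> u |\<sigma>. aut base \<sigma>}"

section \<open>Polynomials over M, orbits and irreducible factors\<close>

lemma map_poly_to_ac_mult: "map_poly to_ac (p * q) = map_poly to_ac p * map_poly to_ac q"
  by (rule poly_eqI) (simp add: coeff_map_poly coeff_mult to_ac_sum)

lemma map_poly_to_ac_1: "map_poly to_ac 1 = 1"
  by (rule poly_eqI) (simp add: coeff_map_poly)

lemma map_poly_to_ac_prod_list: "map_poly to_ac (prod_list ps) = prod_list (map (map_poly to_ac) ps)"
  by (induction ps) (simp_all add: map_poly_to_ac_mult map_poly_to_ac_1)

lemma degree_map_poly_to_ac: "Polynomial.degree (map_poly to_ac p) = Polynomial.degree p"
  by (rule degree_map_poly) simp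

lemma map_poly_to_ac_inject: "map_poly to_ac p = map_poly to_ac q \<longleftrightarrow> p = q"
  by (auto simp: poly_eq_iff coeff_map_poly)

lemma map_poly_to_ac_smult: "map_poly to_ac (Polynomial.smult c p) = Polynomial.smult (to_ac c) (map_poly to_ac p)"
  by (rule poly_eqI) (simp add: coeff_map_poly)

lemma orb_eq_roots:
  assumes "minpoly base u \<mu>" shows "orb u = {x. poly \<mu> x = 0}"
proof
  show "orb u \<subseteq> {x. poly \<mu> x = 0}"
  proof
    fix x assume "x \<in> orb u"
    then obtain \<sigma> where "aut base \<sigma>" "x = \<sigma> u" by (auto simp: orb_def)
    then show "x \<in> {x. poly \<mu> x = 0}"
      using assms aut_poly[of base \<sigma> \<mu> u] aut_closed(4)[of base \<sigma>] intermediate_base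
      by (auto simp: minpoly_def)
  qed
  show "{x. poly \<mu> x = 0} \<subseteq> orb u"
    using minpoly_conjugate[OF intermediate_base assms] unfolding orb_def by blast
qed

lemma minpoly_irreducible:
  assumes m: "minpoly base u (map_poly to_ac m)"
  shows "Factorial_Ring.irreducible m"
proof -
  have d: "Polynomial.degree m \<noteq> 0" using minpoly_degree_pos[OF m] by (simp add: degree_map_poly_to_ac)
  then have "m \<noteq> 0" by auto
  show ?thesis
  proof (rule Factorial_Ring.irreducibleI)
    fix p q assume pq: "m = p * q"
    have n: "p \<noteq> 0" "q \<noteq> 0" using pq \<open>m \<noteq> 0\<close> by auto
    have *: "Polynomial.degree m \<le> Polynomial.degree r" if "r \<noteq> 0" "poly (map_poly to_ac r) u = 0" for r
      using m polys_base[of r] that unfolding minpoly_def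
      by (metis degree_map_poly_to_ac map_poly_0 map_poly_to_ac_inject)
    have "poly (map_poly to_ac p) u = 0 \<or> poly (map_poly to_ac q) u = 0"
      using m by (auto simp: minpoly_def pq map_poly_to_ac_mult)
    then have "Polynomial.degree p = 0 \<or> Polynomial.degree q = 0"
      using *[OF n(1)] *[OF n(2)] n by (auto simp: pq Polynomial.degree_mult_eq)
    then show "p dvd 1 \<or> q dvd 1" using n by (auto simp: is_unit_iff_degree)
  qed (use \<open>m \<noteq> 0\<close> d in \<open>auto simp: is_unit_iff_degree\<close>)
qed

lemma monic_eq_prod_roots:
  fixes p :: "'a::field poly"
  assumes "Polynomial.lead_coeff p = 1" "card {x. poly p x = 0} = Polynomial.degree p"
  shows "p = (\<Prod>v\<in>{x. poly p x = 0}. [:- v, 1:])"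
proof -
  let ?R = "{x. poly p x = 0}"
  have fin: "finite ?R" using assms by (intro poly_roots_finite) auto
  have d: "Polynomial.degree (\<Prod>v\<in>?R. [:- v, 1:]) = card ?R"
    by (subst degree_prod_eq_sum_degree) auto
  have "Polynomial.lead_coeff (\<Prod>v\<in>?R. [:- v, 1:]) = 1" by (simp add: lead_coeff_prod)
  then show ?thesis
    using fin d assms
    by (intro poly_eqI_degree_lead_coeff[of _ "Polynomial.degree p" _ ?R]) (auto simp: poly_prod)
qed

text \<open>The orbit is the root set of the minimal polynomial; by separability its degree counts
  the orbit, so it is the product of the linear factors.\<close>

lemma orbit_polynomial:
  assumes "separable_over base u"
  shows "\<exists>m. Factorial_Ring.irreducible m \<and> Polynomial.degree m = card (orb u) \<and>
    map_poly to_ac m = (\<Prod>v\<in>orb u. [:- v, 1:])"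
proof -
  obtain \<mu> where m: "minpoly base u \<mu>" using minpoly_exists[OF intermediate_base] by blast
  then obtain p where p: "\<mu> = map_poly to_ac p" unfolding minpoly_def by (auto elim: polys_baseE)
  note c = separable_over_minpoly_card[OF intermediate_base m assms]
  show ?thesis
    using minpoly_irreducible[of u p] m monic_eq_prod_roots[of \<mu>] c degree_map_poly_to_ac[of p]
    by (intro exI[of _ p]) (auto simp: orb_eq_roots[OF m] p minpoly_def)
qed

definition separable_poly :: "'m::field poly \<Rightarrow> bool" where
  "separable_poly f \<longleftrightarrow> f \<noteq> 0 \<and> card {x. poly (map_poly to_ac f) x = 0} = Polynomial.degree f"

lemma separable_poly_sep:
  assumes "separable_poly f" "poly (map_poly to_ac f) x = 0" shows "separable_over base x"
  using assms unfolding separable_over_def separable_poly_def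
  by (intro bexI[of _ "map_poly to_ac f"]) (auto simp: polys_base degree_map_poly_to_ac map_poly_eq_0_iff)

text \<open>As all roots of f are simple, the monic multiple of f is the product of the orbit
  polynomials, which are irreducible over M. The list makes orbits of equal size contribute
  separately to the multiset.\<close>

lemma factor_degrees_orbits:
  fixes f :: "'m::field poly"
  assumes f: "separable_poly f" "Polynomial.degree f > 0"
    and As: "\<Union>(set As) = {x. poly (map_poly to_ac f) x = 0}" "distinct As" "pairwise disjnt (set As)"
    and orb: "\<And>A. A \<in> set As \<Longrightarrow> \<exists>u. A = orb u"
  shows "factor_degrees f (mset (map card As))"
proof -
  let ?R = "{x. poly (map_poly to_ac f) x = 0}"
  have "\<exists>m. Factorial_Ring.irreducible m \<and> Polynomial.degree m = card A \<and>
    map_poly to_ac m = (\<Prod>v\<in>A. [:- v, 1:])" if A: "A \<in> set As" for A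
  proof -
    obtain u where u: "A = orb u" using orb[OF A] by blast
    have "u \<in> orb u" unfolding orb_def using aut_id[of base] by (force intro: exI[of _ id])
    then have "u \<in> ?R" using As(1) A u by auto
    then show ?thesis using orbit_polynomial[of u] separable_poly_sep[OF f(1), of u] u by auto
  qed
  then obtain P where P: "\<And>A. A \<in> set As \<Longrightarrow> Factorial_Ring.irreducible (P A) \<and>
    Polynomial.degree (P A) = card A \<and> map_poly to_ac (P A) = (\<Prod>v\<in>A. [:- v, 1:])"
    by metis
  define c where "c = Polynomial.lead_coeff f"
  have c: "c \<noteq> 0" using f by (auto simp: c_def separable_poly_def)
  have fin: "finite ?R" using f by (intro poly_roots_finite) (auto simp: separable_poly_def map_poly_eq_0_iff)
  have "map_poly to_ac (prod_list (map P As)) = prod_list (map (\<lambda>A. \<Prod>v\<in>A. [:- v, 1:]) As)"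
    using P by (auto simp: map_poly_to_ac_prod_list intro!: arg_cong[of _ _ prod_list])
  also have "\<dots> = (\<Prod>A\<in>set As. \<Prod>v\<in>A. [:- v, 1:])" using As(2) by (simp add: prod.distinct_set_conv_list)
  also have "\<dots> = (\<Prod>v\<in>\<Union>(set As). [:- v, 1:])"
    using As fin finite_subset[OF Union_upper, of _ "set As"]
    by (subst prod.Union_disjoint) (auto simp: pairwise_def disjnt_def)
  also have "\<dots> = map_poly to_ac (Polynomial.smult (inverse c) f)"
  proof -
    have s: "poly (map_poly to_ac (Polynomial.smult (inverse c) f)) x = 0 \<longleftrightarrow> x \<in> ?R" for x
      using c by (simp add: map_poly_to_ac_smult)
    have "map_poly to_ac (Polynomial.smult (inverse c) f) = (\<Prod>v\<in>{x. poly (map_poly to_ac (Polynomial.smult (inverse c) f)) x = 0}. [:- v, 1:])"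
      using c f unfolding s
      by (intro monic_eq_prod_roots[of "map_poly to_ac (Polynomial.smult (inverse c) f)", unfolded s])
        (auto simp: degree_map_poly_to_ac coeff_map_poly c_def separable_poly_def)
    then show ?thesis unfolding s As(1) by simp
  qed
  finally have "prod_list (map P As) = Polynomial.smult (inverse c) f"
    by (simp only: map_poly_to_ac_inject)
  then have fac: "f = Polynomial.smult c (prod_list (map P As))" using c by simp
  \<comment> \<open>Positive degree of f rules out the empty list, so there is a factor that can
    absorb the leading coefficient.\<close>
  have "As \<noteq> []"
  proof
    assume "As = []"
    then have "prod_list (map P As) = 1" by simp
    then show False using fac f(2) by simp
  qed
  then obtain A Bs where A: "As = A # Bs" by (cases As) auto
  let ?ps = "Polynomial.smult c (P A) # map P Bs"
  have "Factorial_Ring.irreducible (Polynomial.smult c (P A))"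
    using P[of A] c A irreducible_mult_unit_left[of "[:c:]" "P A"] by (simp add: is_unit_iff_degree)
  then have "\<forall>p\<in>set ?ps. Factorial_Ring.irreducible p" using P A by auto
  moreover have "prod_list ?ps = f" by (simp add: fac A)
  moreover have "map Polynomial.degree ?ps = map card As" using P A c by auto
  ultimately show ?thesis unfolding factor_degrees_def
    by (intro exI[of _ "mset ?ps"]) (metis mset_map prod_mset_prod_list set_mset_mset)
qed

section \<open>Splitting fields and their automorphisms\<close>

abbreviation roots_of :: "'m::field poly \<Rightarrow> 'm alg_closure set" where
  "roots_of f \<equiv> {x. poly (map_poly to_ac f) x = 0}"

text \<open>Bridge to the record-based fields in which \<open>spl\<close> and dimensions are stated;
  the record's inverses have to be identified with \<open>-\<close> and, away from 0, with
  \<open>inverse\<close>.\<close>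

lemma subfield_intermediate:
  "intermediate K \<longleftrightarrow> base \<subseteq> K \<and> subfield K ring_of_type_algebra"
proof -
  interpret F: field "ring_of_type_algebra :: 'a alg_closure ring" by (rule field_from_type_algebra)
  have a: "a_inv ring_of_type_algebra x = - x" for x :: "'a alg_closure"
    by (rule F.minus_equality) (simp_all add: ring_of_type_algebra_def)
  have m: "m_inv ring_of_type_algebra x = inverse x" if "x \<noteq> 0" for x :: "'a alg_closure"
    using that by (intro F.comm_inv_char) (simp_all add: ring_of_type_algebra_def)
  show ?thesis
  proof
    assume K: "intermediate K"
    have ops: "carrier (ring_of_type_algebra :: 'a alg_closure ring) = UNIV"
      "x \<otimes>\<^bsub>ring_of_type_algebra\<^esub> y = x * y" "x \<oplus>\<^bsub>ring_of_type_algebra\<^esub> y = x + y"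
      "\<one>\<^bsub>ring_of_type_algebra\<^esub> = (1 :: 'a alg_closure)" "\<zero>\<^bsub>ring_of_type_algebra\<^esub> = (0 :: 'a alg_closure)"
      for x y :: "'a alg_closure"
      by (simp_all add: ring_of_type_algebra_def)
    have "subring K ring_of_type_algebra"
      by (rule F.subringI) (simp_all add: a ops intermediate_closed[OF K])
    then have "subfield K ring_of_type_algebra"
      by (rule F.subfieldI') (auto simp: m ops intermediate_closed[OF K])
    then show "base \<subseteq> K \<and> subfield K ring_of_type_algebra" using K by (auto simp: intermediate_def)
  next
    assume K: "base \<subseteq> K \<and> subfield K ring_of_type_algebra"
    then have s: "subring K ring_of_type_algebra" using subfieldE(1) by blast
    have "x - y \<in> K" "x * y \<in> K" if "x \<in> K" "y \<in> K" for x y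
      using subringE(6)[OF s, of x y] subringE(7)[OF s, of x "-y"] subringE(5)[OF s, of y] that a[of y]
      by (auto simp: ring_of_type_algebra_def)
    then show "intermediate K" using K by (simp add: intermediate_def)
  qed
qed

text \<open>The universal property of the splitting field. Later arguments use these three facts and
  never \<open>generate_field\<close> itself.\<close>

lemma spl_intermediate: "intermediate (spl f)"
  and spl_roots: "roots_of f \<subseteq> spl f"
  and spl_minimal: "intermediate K \<Longrightarrow> roots_of f \<subseteq> K \<Longrightarrow> spl f \<subseteq> K"
proof -
  interpret F: field "ring_of_type_algebra :: 'a alg_closure ring" by (rule field_from_type_algebra)
  have c: "A \<subseteq> carrier ring_of_type_algebra" for A :: "'a alg_closure set" by (simp add: ring_of_type_algebra_def)
  note * = F.generate_fieldE[OF c, of "spl f" "base \<union> roots_of f"]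
  show "intermediate (spl f)" using * by (simp add: subfield_intermediate spl_def)
  show "roots_of f \<subseteq> spl f" using * by (simp add: spl_def)
  show "intermediate K \<Longrightarrow> roots_of f \<subseteq> K \<Longrightarrow> spl f \<subseteq> K"
    using *(3) by (simp add: subfield_intermediate spl_def)
qed

lemma aut_fixes_spl:
  assumes \<sigma>: "aut base \<sigma>" and "\<And>x. x \<in> roots_of f \<Longrightarrow> \<sigma> x = x" and x: "x \<in> spl f"
  shows "\<sigma> x = x"
proof -
  have "intermediate {x. \<sigma> x = x}"
    by (auto simp: intermediate_def aut_closed[OF \<sigma> intermediate_base])
  from spl_minimal[OF this, of f] show ?thesis using assms by auto
qed

lemma aut_roots:
  assumes "aut base \<sigma>" "x \<in> roots_of f" shows "\<sigma> x \<in> roots_of f"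
  using aut_poly[OF assms(1) intermediate_base polys_base, of f x] assms(2)
    aut_closed(4)[OF assms(1) intermediate_base] by simp

text \<open>Normality. The elements that \<tau> sends into the splitting field form an intermediate
  field containing the roots, so minimality gives one inclusion; the inverse automorphism gives the
  other.\<close>

lemma aut_image_spl:
  assumes \<sigma>: "aut base \<sigma>"
  shows "\<sigma> ` spl f = spl f"
proof -
  have *: "\<tau> ` spl f \<subseteq> spl f" if \<tau>: "aut base \<tau>" for \<tau>
  proof -
    have "intermediate {x. \<tau> x \<in> spl f}"
      using intermediate_closed[OF spl_intermediate[of f]]
      by (auto simp: intermediate_def aut_closed[OF \<tau> intermediate_base])
    from spl_minimal[OF this, of f] show ?thesis using aut_roots[OF \<tau>, of _ f] spl_roots[of f] by blast
  qed
  have "inv' \<sigma> ` spl f \<subseteq> spl f" using * aut_inv[OF \<sigma> intermediate_base] by blast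
  then have "\<sigma> ` inv' \<sigma> ` spl f \<subseteq> \<sigma> ` spl f" by (rule image_mono)
  moreover have "\<sigma> ` inv' \<sigma> ` spl f = spl f"
    using aut_bij[OF \<sigma>] by (simp add: image_f_inv_f bij_is_surj)
  ultimately show ?thesis using *[OF \<sigma>] by auto
qed

text \<open>Half of the Galois correspondence, for any intermediate K: adjoining the roots to K one
  by one gives a field containing \<open>spl f\<close>, to which \<open>fixed_foldl_adjoin\<close>
  applies. Later K is also taken to be the other splitting field.\<close>

lemma fixed_spl:
  assumes f: "separable_poly f" and K: "intermediate K" and u: "u \<in> spl f"
    and fixed: "\<And>\<sigma>. aut K \<sigma> \<Longrightarrow> \<sigma> u = u"
  shows "u \<in> K"
proof -
  have "finite (roots_of f)"
    using f by (intro poly_roots_finite) (auto simp: separable_poly_def map_poly_eq_0_iff)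
  then obtain xs where xs: "set xs = roots_of f" using finite_list by blast
  have "spl f \<subseteq> foldl adjoin K xs"
    using foldl_adjoin[OF K, of xs] xs by (intro spl_minimal) auto
  moreover have "base \<subseteq> K" using K by (simp add: intermediate_def)
  ultimately show ?thesis
    using u fixed xs separable_poly_sep[OF f] separable_over_mono[of base K]
    by (intro fixed_foldl_adjoin[OF K, of xs u]) auto
qed

text \<open>Restrictions are automorphisms by normality; conversely, the graph of an automorphism of
  the splitting field is a partial homomorphism and extends to the closure. Galois groups can thus
  be studied through \<open>aut base\<close>.\<close>

lemma gal_carrier: "carrier (gal (spl f)) = {restrict \<sigma> (spl f) |\<sigma>. aut base \<sigma>}"
proof (intro equalityI subsetI)
  let ?L = "spl f"
  note L = spl_intermediate[of f]
  fix g assume "g \<in> carrier (gal ?L)"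
  then have g: "g \<in> Bij ?L" "g \<in> ring_hom (ring_of_type_algebra\<lparr>carrier := ?L\<rparr>) (ring_of_type_algebra\<lparr>carrier := ?L\<rparr>)"
    "\<And>m. g (to_ac m) = to_ac m" by (auto simp: gal_def)
  have h: "g (x + y) = g x + g y" "g (x * y) = g x * g y" if "x \<in> ?L" "y \<in> ?L" for x y
    using g(2) that by (auto simp: ring_hom_def ring_of_type_algebra_def)
  have m: "g (- y) = - g y" if "y \<in> ?L" for y
    using h(1)[of y "-y"] that intermediate_closed(7)[OF L, of y] g(3)[of 0]
    by (simp add: eq_neg_iff_add_eq_0 add.commute)
  have "partial_hom {(x, g x) |x. x \<in> ?L}"
    unfolding partial_hom_def
  proof (intro conjI allI impI)
    fix c show "(to_ac c, to_ac c) \<in> {(x, g x) |x. x \<in> ?L}"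
      using g(3)[of c] intermediate_closed(1)[OF L, of c] by auto
  next
    fix x y x' y' assume *: "(x, y) \<in> {(x, g x) |x. x \<in> ?L}" "(x', y') \<in> {(x, g x) |x. x \<in> ?L}"
    then show "(x - x', y - y') \<in> {(x, g x) |x. x \<in> ?L}" "(x * x', y * y') \<in> {(x, g x) |x. x \<in> ?L}"
      using h(1)[of x "- x'"] m[of x'] h(2)[of x x'] intermediate_closed[OF L] by auto
  next
    fix y assume "(0, y) \<in> {(x, g x) |x. x \<in> ?L}" then show "y = 0" using g(3)[of 0] by auto
  qed
  from partial_hom_extends_to_aut[OF this] obtain \<sigma> where "aut base \<sigma>" "\<And>x. x \<in> ?L \<Longrightarrow> \<sigma> x = g x" by auto
  then show "g \<in> {restrict \<sigma> ?L |\<sigma>. aut base \<sigma>}"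
    using Bij_imp_extensional[OF g(1)] by (auto intro!: exI[of _ \<sigma>] simp: extensional_def restrict_def)
next
  let ?L = "spl f"
  note L = spl_intermediate[of f]
  fix g assume "g \<in> {restrict \<sigma> ?L |\<sigma>. aut base \<sigma>}"
  then obtain \<sigma> where \<sigma>: "aut base \<sigma>" and g: "g = restrict \<sigma> ?L" by auto
  note im = aut_image_spl[OF \<sigma>, of f]
  have "bij_betw g ?L ?L"
    unfolding g bij_betw_restrict_eq bij_betw_def using im aut_bij[OF \<sigma>] by (auto simp: bij_def inj_on_def)
  then have "g \<in> Bij ?L" by (auto simp: Bij_def g)
  moreover have "g \<in> ring_hom (ring_of_type_algebra\<lparr>carrier := ?L\<rparr>) (ring_of_type_algebra\<lparr>carrier := ?L\<rparr>)"
    using im intermediate_closed[OF L] by (auto simp: ring_hom_def ring_of_type_algebra_def g aut_closed[OF \<sigma> intermediate_base])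
  ultimately show "g \<in> carrier (gal ?L)"
    using intermediate_closed(1)[OF L] by (auto simp: gal_def g aut_closed[OF \<sigma> intermediate_base])
qed

lemma gal_mult:
  assumes "aut base \<sigma>" "aut base \<tau>"
  shows "restrict \<sigma> (spl f) \<otimes>\<^bsub>gal (spl f)\<^esub> restrict \<tau> (spl f) = restrict (\<sigma> \<circ> \<tau>) (spl f)"
proof -
  have "restrict \<sigma> (spl f) \<in> Bij (spl f)" "restrict \<tau> (spl f) \<in> Bij (spl f)"
    using gal_carrier[of f] assms by (auto simp: gal_def)
  moreover have "\<tau> x \<in> spl f" if "x \<in> spl f" for x using aut_image_spl[OF assms(2)] that by blast
  ultimately show ?thesis by (auto simp: gal_def BijGroup_def compose_def restrict_def)
qed

lemma gal_one: "\<one>\<^bsub>gal (spl f)\<^esub> = restrict id (spl f)"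
  by (auto simp: gal_def BijGroup_def restrict_def)

lemma gal_group: "group (gal (spl f))"
proof (rule groupI)
  show "\<one>\<^bsub>gal (spl f)\<^esub> \<in> carrier (gal (spl f))"
    unfolding gal_one gal_carrier using aut_id by blast
next
  fix g h assume "g \<in> carrier (gal (spl f))" "h \<in> carrier (gal (spl f))"
  then show "g \<otimes>\<^bsub>gal (spl f)\<^esub> h \<in> carrier (gal (spl f))"
    unfolding gal_carrier using gal_mult aut_comp by blast
next
  fix g h k assume "g \<in> carrier (gal (spl f))" "h \<in> carrier (gal (spl f))" "k \<in> carrier (gal (spl f))"
  then show "g \<otimes>\<^bsub>gal (spl f)\<^esub> h \<otimes>\<^bsub>gal (spl f)\<^esub> k = g \<otimes>\<^bsub>gal (spl f)\<^esub> (h \<otimes>\<^bsub>gal (spl f)\<^esub> k)"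
    unfolding gal_carrier by (auto simp: gal_mult aut_comp comp_assoc)
next
  fix g assume "g \<in> carrier (gal (spl f))"
  then obtain \<sigma> where \<sigma>: "aut base \<sigma>" "g = restrict \<sigma> (spl f)" by (auto simp: gal_carrier)
  have \<tau>: "aut base (inv' \<sigma>)" using aut_inv[OF \<sigma>(1) intermediate_base] .
  have "inv' \<sigma> \<circ> \<sigma> = id" using aut_bij[OF \<sigma>(1)] by (simp add: bij_is_inj)
  then have "restrict (inv' \<sigma>) (spl f) \<otimes>\<^bsub>gal (spl f)\<^esub> g = \<one>\<^bsub>gal (spl f)\<^esub>"
    by (simp only: \<sigma>(2) gal_mult[OF \<tau> \<sigma>(1)] gal_one)
  then show "\<exists>h\<in>carrier (gal (spl f)). h \<otimes>\<^bsub>gal (spl f)\<^esub> g = \<one>\<^bsub>gal (spl f)\<^esub>"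
    unfolding gal_carrier using \<tau> by blast
  show "\<one>\<^bsub>gal (spl f)\<^esub> \<otimes>\<^bsub>gal (spl f)\<^esub> g = g"
    using \<sigma> by (simp add: gal_one gal_mult aut_id)
qed

section \<open>Tschirnhausen transformations of the cubic\<close>

text \<open>The indices are named 0, 1, -1 so that indices and signs share their numerals; the
  rewrite rules below accordingly turn 2 into -1.\<close>

lemma three_cases: "(i :: 3) = 0 \<or> i = 1 \<or> i = -1"
proof (cases i)
  case (of_int z)
  then have "z = 0 \<or> z = 1 \<or> z = 2" by auto
  then show ?thesis using of_int(1) by auto
qed

lemma three_arith [simp]:
  "(1::3) + 1 = -1" "(-1::3) - 1 = 1" "(2::3) = -1" "(3::3) = 0" "(1::3) \<noteq> -1" "(-1::3) \<noteq> 1"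
  by simp_all

lemma UNIV_three: "(UNIV :: 3 set) = {0, 1, -1}"
  using three_cases by auto

lemma all_three: "(\<forall>i::3. P i) \<longleftrightarrow> P 0 \<and> P 1 \<and> P (-1)"
  using three_cases by metis

section \<open>The roots of the cubic\<close>

definition enumerates :: "(3 \<Rightarrow> 'm::field alg_closure) \<Rightarrow> 'm poly \<Rightarrow> bool" where
  "enumerates x f \<longleftrightarrow> inj x \<and> range x = roots_of f"

lemma map_poly_cubic: "map_poly to_ac (cubic a) = [:to_ac a, to_ac a, 0, 1:]"
  by (rule poly_eqI) (simp add: cubic_def coeff_map_poly coeff_pCons split: nat.splits)

lemma degree_cubic: "Polynomial.degree (cubic a) = 3"
  by (simp add: cubic_def)

text \<open>The roots come from factoring: \<beta> is a root of the quotient of the cubic by X -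
  \<alpha>, and the third root is - \<alpha> - \<beta>. This expresses A in two ways, which turns
  the discriminant into the square of the product of root differences.\<close>

lemma cubic_enumerate:
  fixes a :: "'m::field"
  assumes "a * (4 * a + 27) \<noteq> 0"
  shows "\<exists>x. enumerates x (cubic a)"
proof -
  define A where "A = to_ac a"
  have A: "A * (4 * A + 27) \<noteq> 0"
    using assms unfolding A_def by (metis to_ac_add to_ac_eq_0_iff to_ac_mult to_ac_numeral)
  obtain \<alpha> where "poly [:A, A, 0, 1:] \<alpha> = 0" using alg_closed_imp_poly_has_root[of "[:A, A, 0, 1:]"] by auto
  then have \<alpha>: "A + A * \<alpha> + \<alpha> ^ 3 = 0" by (simp add: algebra_simps power3_eq_cube)
  obtain \<beta> where "poly [:\<alpha> ^ 2 + A, \<alpha>, 1:] \<beta> = 0" using alg_closed_imp_poly_has_root[of "[:\<alpha> ^ 2 + A, \<alpha>, 1:]"] by auto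
  then have \<beta>: "A = - (\<alpha> ^ 2 + \<alpha> * \<beta> + \<beta> ^ 2)" by (simp add: algebra_simps power2_eq_square add_eq_0_iff)
  have A': "A = \<alpha> * \<beta> * (\<alpha> + \<beta>)"
  proof -
    have "A = - (\<alpha> ^ 3) - A * \<alpha>" using \<alpha> by (simp add: algebra_simps eq_neg_iff_add_eq_0)
    also have "\<dots> = - (\<alpha> ^ 3) + (\<alpha> ^ 2 + \<alpha> * \<beta> + \<beta> ^ 2) * \<alpha>"
      by (simp only: \<beta> mult_minus_left diff_minus_eq_add)
    finally show ?thesis by (simp add: algebra_simps power2_eq_square power3_eq_cube)
  qed
  \<comment> \<open>The cube stems from the quadratic expression for A, the square from the cubic
    one; the factors of the final square are the differences of \<alpha>, \<beta> and - \<alpha> -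
    \<beta>.\<close>
  have "- (A * A * (4 * A + 27)) = 4 * (\<alpha> ^ 2 + \<alpha> * \<beta> + \<beta> ^ 2) ^ 3 - 27 * (\<alpha> * \<beta> * (\<alpha> + \<beta>)) ^ 2"
    by (subst A'[symmetric], subst minus_minus[of "\<alpha> ^ 2 + \<alpha> * \<beta> + \<beta> ^ 2", symmetric], subst \<beta>[symmetric])
      (simp add: algebra_simps power2_eq_square power3_eq_cube)
  also have "\<dots> = ((\<alpha> - \<beta>) * (\<alpha> + 2 * \<beta>) * (2 * \<alpha> + \<beta>)) ^ 2"
    by (simp add: algebra_simps power2_eq_square power3_eq_cube)
  finally have ne: "(\<alpha> - \<beta>) * (\<alpha> + 2 * \<beta>) * (2 * \<alpha> + \<beta>) \<noteq> 0" using A by auto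
  define x where "x = (\<lambda>i::3. if i = 0 then \<alpha> else if i = 1 then \<beta> else - \<alpha> - \<beta>)"
  have "inj x"
  proof -
    have "2 * \<alpha> + \<beta> = \<alpha> - (- \<alpha> - \<beta>)" "\<alpha> + 2 * \<beta> = \<beta> - (- \<alpha> - \<beta>)" by simp_all
    then have "\<alpha> \<noteq> \<beta>" "\<alpha> \<noteq> - \<alpha> - \<beta>" "\<beta> \<noteq> - \<alpha> - \<beta>" using ne by auto
    then show ?thesis unfolding inj_def all_three by (simp add: x_def)
  qed
  moreover have "range x = roots_of (cubic a)"
  proof -
    have "poly (map_poly to_ac (cubic a)) v = (v - \<alpha>) * (v - \<beta>) * (v - (- \<alpha> - \<beta>))" for v
    proof -
      have "poly (map_poly to_ac (cubic a)) v = A + A * v + v ^ 3"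
        by (simp add: map_poly_cubic A_def algebra_simps power3_eq_cube)
      also have "\<dots> = \<alpha> * \<beta> * (\<alpha> + \<beta>) + - (\<alpha> ^ 2 + \<alpha> * \<beta> + \<beta> ^ 2) * v + v ^ 3"
        by (subst A'[symmetric], subst \<beta>[symmetric]) simp
      finally show ?thesis by (simp add: algebra_simps power2_eq_square power3_eq_cube)
    qed
    then have "roots_of (cubic a) = {\<alpha>, \<beta>, - \<alpha> - \<beta>}" by auto
    then show ?thesis by (auto simp: UNIV_three x_def)
  qed
  ultimately show ?thesis by (auto simp: enumerates_def)
qed

lemma enumerates_separable:
  assumes "enumerates x (cubic a)" shows "separable_poly (cubic a)"
proof -
  have "card (range x) = CARD(3)" using assms unfolding enumerates_def by (intro card_image) blast
  then show ?thesis using assms by (auto simp: separable_poly_def enumerates_def degree_cubic cubic_def)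
qed

text \<open>Vieta. The coefficient a occurs twice in the cubic, so it has a cubic expression in x 0
  and x 1 from the constant term and a quadratic one from the linear coefficient.\<close>

lemma enumerates_symmetric:
  assumes x: "enumerates x (cubic a)"
  shows "x (-1) = - x 0 - x 1" "to_ac a = x 0 * x 1 * (x 0 + x 1)"
    "to_ac a = - (x 0 ^ 2 + x 0 * x 1 + x 1 ^ 2)"
proof -
  have "map_poly to_ac (cubic a) = (\<Prod>v\<in>roots_of (cubic a). [:- v, 1:])"
    using enumerates_separable[OF x] degree_map_poly_to_ac[of "cubic a"]
    by (intro monic_eq_prod_roots) (simp_all add: separable_poly_def degree_cubic, simp add: map_poly_cubic numeral_3_eq_3)
  also have "\<dots> = (\<Prod>i\<in>UNIV. [:- x i, 1:])"
    using x prod.reindex[of x UNIV "\<lambda>v. [:- v, 1:]"] by (simp add: enumerates_def)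
  also have "\<dots> = [:- x 0, 1:] * ([:- x 1, 1:] * [:- x (-1), 1:])"
    by (simp add: UNIV_three)
  finally have e: "to_ac a = - (x 0 * (x 1 * x (-1)))" "to_ac a = x 0 * (x 1 + x (-1)) + x 1 * x (-1)"
    "x 0 + (x 1 + x (-1)) = 0"
    by (auto simp: map_poly_cubic algebra_simps)
  show 1: "x (-1) = - x 0 - x 1" using e(3) by (simp add: eq_diff_eq add.commute add_eq_0_iff)
  show "to_ac a = x 0 * x 1 * (x 0 + x 1)" using e(1) by (simp add: 1 algebra_simps)
  show "to_ac a = - (x 0 ^ 2 + x 0 * x 1 + x 1 ^ 2)"
    by (subst e(2), simp add: 1) (simp add: algebra_simps power2_eq_square)
qed

text \<open>The last two expressions are the differences x 0 - x (-1) and x 1 - x (-1), in the form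
  in which they occur as factors in \<open>tsch_solvable\<close>.\<close>

lemma enumerates_distinct:
  assumes x: "enumerates x (cubic a)"
  shows "x 0 \<noteq> x 1" "2 * x 0 + x 1 \<noteq> 0" "x 0 + 2 * x 1 \<noteq> 0"
proof -
  have i: "inj x" using x by (simp add: enumerates_def)
  show "x 0 \<noteq> x 1" using injD[OF i, of 0 1] by auto
  have "x 0 \<noteq> x (-1)" "x 1 \<noteq> x (-1)" using injD[OF i, of 0 "-1"] injD[OF i, of 1 "-1"] by auto
  then have n: "x 0 - x (-1) \<noteq> 0" "x 1 - x (-1) \<noteq> 0" by (simp_all only: right_minus_eq not_False_eq_True)
  have "2 * x 0 + x 1 = x 0 - x (-1)" "x 0 + 2 * x 1 = x 1 - x (-1)"
    by (simp_all add: enumerates_symmetric(1)[OF x])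
  then show "2 * x 0 + x 1 \<noteq> 0" "x 0 + 2 * x 1 \<noteq> 0" using n by (simp_all only: not_False_eq_True)
qed

text \<open>
  The trace-zero elements of \<open>M[X]/(X\<^sup>3 + aX + a)\<close> are spanned by the classes of \<open>X\<close> and
  \<open>3X\<^sup>2 + 2a\<close>; up to scaling, those with nonzero second coordinate are parametrised by \<open>u\<close>.
\<close>

definition tsch :: "'m::field \<Rightarrow> 'm alg_closure \<Rightarrow> 'm alg_closure \<Rightarrow> 'm alg_closure" where
  "tsch a u v = u * v + 3 * v ^ 2 + 2 * to_ac a"

definition tsch_rel :: "'m::field \<Rightarrow> (3 \<Rightarrow> 'm alg_closure) \<Rightarrow> (3 \<Rightarrow> 'm alg_closure) \<Rightarrow> 'm alg_closure \<Rightarrow> bool" where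
  "tsch_rel a x y u \<longleftrightarrow> (\<exists>c. \<forall>i. y i = c * tsch a u (x i))"

text \<open>In the notation of the overview, a * \<open>H_num\<close> and a * \<open>H_den\<close>
  are A and B.\<close>

definition H_num :: "'a::field \<Rightarrow> 'a \<Rightarrow> 'a" where
  "H_num a u = u ^ 2 + 9 * u - 3 * a"

definition H_den :: "'a::field \<Rightarrow> 'a \<Rightarrow> 'a" where
  "H_den a u = u ^ 3 - 2 * a * u ^ 2 - 9 * a * u - 2 * a ^ 2 - 27 * a"

lemma tsch_symmetric:
  fixes u :: "'m::field alg_closure"
  assumes x: "enumerates x (cubic a)"
    defines "w \<equiv> \<lambda>i. tsch a u (x i)"
  shows "w 0 * w 1 + w 0 * w (-1) + w 1 * w (-1) = to_ac a * H_num (to_ac a) u"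
    "w 0 * w 1 * w (-1) = - to_ac a * H_den (to_ac a) u"
proof -
  define p q A where "p = x 0" and "q = x 1" and "A = to_ac a"
  note s = enumerates_symmetric[OF x, folded p_def q_def A_def]
  have w: "w 0 = u * p + 3 * p ^ 2 + 2 * A" "w 1 = u * q + 3 * q ^ 2 + 2 * A"
    "w (-1) = u * (- p - q) + 3 * (- p - q) ^ 2 + 2 * A"
    unfolding w_def tsch_def s(1) by (simp_all add: p_def q_def A_def)
  \<comment> \<open>Give p and q weight 1. Then e has weight 2 and f weight 3, although both equal
    A. Each coefficient in u below is homogeneous in p and q, and its weight restricts the monomials
    in e and f that can express it. The identities hold in p, q and u as indeterminates; only
    afterwards are e and f both replaced by A.\<close>
  define e f where "e = - (p ^ 2 + p * q + q ^ 2)" and "f = p * q * (p + q)"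
  have A: "A = e" "A = f" using s by (simp_all add: e_def f_def)
  have w': "w 0 = u * p + (p * p - 2 * (p * q) - 2 * (q * q))" "w 1 = u * q + (q * q - 2 * (p * q) - 2 * (p * p))"
    "w (-1) = p * p + 4 * (p * q) + q * q - u * (p + q)"
    unfolding w A(1) e_def by (simp_all add: algebra_simps power2_eq_square)
  have "w 0 * w 1 + w 0 * w (-1) + w 1 * w (-1) = e * u ^ 2 + 9 * f * u - 3 * e ^ 2"
    unfolding w' e_def f_def by (simp add: algebra_simps power2_eq_square power3_eq_cube)
  then show "w 0 * w 1 + w 0 * w (-1) + w 1 * w (-1) = to_ac a * H_num (to_ac a) u"
    unfolding A[symmetric] H_num_def A_def by (simp add: algebra_simps power2_eq_square)
  have "w 0 * w 1 * w (-1) = - f * u ^ 3 + 2 * e ^ 2 * u ^ 2 + 9 * e * f * u + 2 * e ^ 3 + 27 * f ^ 2"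
    unfolding w' e_def f_def by (simp add: algebra_simps power2_eq_square power3_eq_cube)
  then show "w 0 * w 1 * w (-1) = - to_ac a * H_den (to_ac a) u"
    unfolding A[symmetric] H_den_def A_def by (simp add: algebra_simps power2_eq_square power3_eq_cube)
qed

text \<open>The determinant of the interpolation at x 0 and x 1 is, up to sign, the product of the
  three root differences.\<close>

lemma tsch_solvable:
  assumes x: "enumerates x (cubic a)"
  defines "W \<equiv> \<lambda>i. 3 * x i ^ 2 + 2 * to_ac a"
  shows "x 0 * W 1 - x 1 * W 0 \<noteq> 0"
proof -
  have "x 0 * W 1 - x 1 * W 0 = - ((x 0 - x 1) * (2 * x 0 + x 1) * (x 0 + 2 * x 1))"
    unfolding W_def enumerates_symmetric(3)[OF x] by (simp add: algebra_simps power2_eq_square)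
  then show ?thesis using enumerates_distinct[OF x] by simp
qed

lemma tsch_rel_exists:
  assumes x: "enumerates x (cubic a)" and y_enum: "enumerates y (cubic b)" and ne: "a \<noteq> b" "b \<noteq> 0"
  shows "\<exists>u. tsch_rel a x y u"
proof -
  define W where "W = (\<lambda>i. 3 * x i ^ 2 + 2 * to_ac a)"
  define D where "D = x 0 * W 1 - x 1 * W 0"
  have D: "D \<noteq> 0" using tsch_solvable[OF x] by (simp add: D_def W_def)
  \<comment> \<open>Cramer's rule for the equations at the indices 0 and 1; the third equation
    follows because x, W and y each sum to zero.\<close>
  define k c where "k = (y 0 * W 1 - y 1 * W 0) / D" and "c = (x 0 * y 1 - x 1 * y 0) / D"
  have y0: "y 0 = k * x 0 + c * W 0" and y1: "y 1 = k * x 1 + c * W 1"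
    using D by (simp_all add: k_def c_def divide_simps) (simp_all add: D_def algebra_simps)
  have W: "W (-1) = - W 0 - W 1"
    unfolding W_def enumerates_symmetric(1)[OF x] enumerates_symmetric(3)[OF x]
    by (simp add: algebra_simps power2_eq_square)
  have "y (-1) = k * x (-1) + c * W (-1)"
    unfolding W enumerates_symmetric(1)[OF x] enumerates_symmetric(1)[OF y_enum] y0 y1
    by (simp add: algebra_simps)
  then have y: "\<forall>i. y i = k * x i + c * W i" unfolding all_three using y0 y1 by simp
  \<comment> \<open>If y were k * x, both expressions for b would give b = k^2 a = k^3 a, hence k =
    1 and a = b.\<close>
  have c: "c \<noteq> 0"
  proof
    assume "c = 0"
    then have yk: "y 0 = k * x 0" "y 1 = k * x 1" using y by auto
    have "to_ac b = k ^ 3 * (x 0 * x 1 * (x 0 + x 1))" "to_ac b = k ^ 2 * (- (x 0 ^ 2 + x 0 * x 1 + x 1 ^ 2))"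
      by (subst enumerates_symmetric(2)[OF y_enum], simp add: yk algebra_simps power3_eq_cube)
        (subst enumerates_symmetric(3)[OF y_enum], simp add: yk algebra_simps power2_eq_square)
    then have "to_ac b = k ^ 3 * to_ac a" "to_ac b = k ^ 2 * to_ac a"
      by (simp_all only: enumerates_symmetric(2)[OF x, symmetric] enumerates_symmetric(3)[OF x, symmetric])
    moreover from this ne have "k ^ 2 \<noteq> 0" "to_ac a \<noteq> 0" by auto
    ultimately have "k = 1" by (simp add: power3_eq_cube power2_eq_square)
    then show False using \<open>to_ac b = k ^ 2 * to_ac a\<close> ne by simp
  qed
  have "tsch_rel a x y (k / c)"
    unfolding tsch_rel_def tsch_def using y c
    by (intro exI[of _ c]) (simp add: W_def algebra_simps)
  then show ?thesis by blast
qed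

text \<open>Subtracting the two representations leaves a linear relation between x and W; the
  nonzero determinant makes first the scales and then the parameters agree.\<close>

lemma tsch_rel_unique:
  assumes x: "enumerates x (cubic a)" and y: "inj y" and u: "tsch_rel a x y u" and u': "tsch_rel a x y u'"
  shows "u = u'"
proof -
  define W where "W = (\<lambda>i. 3 * x i ^ 2 + 2 * to_ac a)"
  obtain c where c: "\<And>i. y i = c * (u * x i + W i)"
    using u by (auto simp: tsch_rel_def tsch_def W_def algebra_simps)
  obtain c' where c': "\<And>i. y i = c' * (u' * x i + W i)"
    using u' by (auto simp: tsch_rel_def tsch_def W_def algebra_simps)
  have c0: "c \<noteq> 0" using c injD[OF y, of 0 1] by force
  have e: "(c * u - c' * u') * x i = (c' - c) * W i" for i
    using c[of i] c'[of i] by (simp add: algebra_simps)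
  have "(c' - c) * (x 0 * W 1 - x 1 * W 0) = x 0 * ((c' - c) * W 1) - x 1 * ((c' - c) * W 0)"
    by (simp add: algebra_simps)
  also have "\<dots> = 0" unfolding e[symmetric] by simp
  finally have cc: "c' = c" using tsch_solvable[OF x] by (simp add: W_def)
  have "x 0 \<noteq> x 1" using enumerates_distinct[OF x] by simp
  then have "x 0 \<noteq> 0 \<or> x 1 \<noteq> 0" by metis
  then have "c * u = c' * u'" using e[of 0] e[of 1] cc by auto
  then show ?thesis using cc c0 by simp
qed

text \<open>Both coefficients of the target cubic equal b, so b = c^2 a \<open>H_num\<close> = c^3 a
  \<open>H_den\<close>. Hence c = \<open>H_num\<close> / \<open>H_den\<close>, and eliminating c
  leaves the equation of \<open>H\<close>. In particular u determines every y i.\<close>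

lemma tsch_rel_scale:
  assumes x: "enumerates x (cubic a)" and y: "enumerates y (cubic b)" and b: "b \<noteq> 0" and u: "tsch_rel a x y u"
  shows "H_den (to_ac a) u \<noteq> 0"
    and "y i = H_num (to_ac a) u / H_den (to_ac a) u * tsch a u (x i)"
    and "to_ac b * H_den (to_ac a) u ^ 2 = to_ac a * H_num (to_ac a) u ^ 3"
proof -
  obtain c where c: "\<And>i. y i = c * tsch a u (x i)" using u by (auto simp: tsch_rel_def)
  note w = tsch_symmetric[OF x, of u] and s = enumerates_symmetric[OF y]
  have "to_ac b = y 0 * y 1 + y 0 * y (-1) + y 1 * y (-1)"
    unfolding s(3) by (simp add: s(1) algebra_simps power2_eq_square)
  also have "\<dots> = c ^ 2 * (to_ac a * H_num (to_ac a) u)"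
    unfolding w(1)[symmetric] c by (simp add: algebra_simps power2_eq_square)
  finally have 1: "to_ac b = c ^ 2 * (to_ac a * H_num (to_ac a) u)" .
  have "to_ac b = - (y 0 * y 1 * y (-1))"
    unfolding s(2) by (simp add: s(1) algebra_simps)
  also have "\<dots> = - (c ^ 3 * (tsch a u (x 0) * tsch a u (x 1) * tsch a u (x (-1))))"
    unfolding c by (simp add: algebra_simps power3_eq_cube)
  finally have 2: "to_ac b = c ^ 3 * (to_ac a * H_den (to_ac a) u)" unfolding w(2) by simp
  show d: "H_den (to_ac a) u \<noteq> 0" using 2 b by auto
  have nz: "c \<noteq> 0" "to_ac a \<noteq> 0" using 1 b by auto
  have "c ^ 2 * to_ac a * H_num (to_ac a) u = c ^ 2 * to_ac a * (c * H_den (to_ac a) u)"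
  proof -
    have "c ^ 2 * to_ac a * H_num (to_ac a) u = to_ac b" unfolding 1 by (simp only: mult.assoc)
    also have "\<dots> = c ^ 2 * to_ac a * (c * H_den (to_ac a) u)"
      unfolding 2 by (simp add: power2_eq_square power3_eq_cube algebra_simps)
    finally show ?thesis .
  qed
  then have "H_num (to_ac a) u = c * H_den (to_ac a) u" using nz by simp
  then have cc: "c = H_num (to_ac a) u / H_den (to_ac a) u" using d by (simp add: field_simps)
  show "y i = H_num (to_ac a) u / H_den (to_ac a) u * tsch a u (x i)" using c[of i] cc by simp
  show "to_ac b * H_den (to_ac a) u ^ 2 = to_ac a * H_num (to_ac a) u ^ 3"
    unfolding 1 cc using d by (simp add: power_divide) (simp add: power2_eq_square power3_eq_cube)
qed

section \<open>The six roots of H\<close>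

lemma map_poly_to_ac_diff: "map_poly to_ac (p - q) = map_poly to_ac p - map_poly to_ac q"
  by (rule poly_eqI) (simp add: coeff_map_poly)

lemma map_poly_to_ac_power: "map_poly to_ac (p ^ n) = map_poly to_ac p ^ n"
  by (induction n) (simp_all add: map_poly_to_ac_mult map_poly_to_ac_1)

lemma poly_H:
  "poly (map_poly to_ac (H a b)) u = to_ac a * H_num (to_ac a) u ^ 3 - to_ac b * H_den (to_ac a) u ^ 2"
proof -
  have 1: "map_poly to_ac [:- 3 * a, 9, 1:] = [:- 3 * to_ac a, 9, 1:]"
    and 2: "map_poly to_ac [:- 2 * a ^ 2 - 27 * a, - 9 * a, - 2 * a, 1:] =
      [:- 2 * to_ac a ^ 2 - 27 * to_ac a, - 9 * to_ac a, - 2 * to_ac a, 1:]"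
    by (rule poly_eqI; simp add: coeff_map_poly coeff_pCons split: nat.splits)+
  have 3: "poly [:- 3 * to_ac a, 9, 1:] u = H_num (to_ac a) u"
    and 4: "poly [:- 2 * to_ac a ^ 2 - 27 * to_ac a, - 9 * to_ac a, - 2 * to_ac a, 1:] u = H_den (to_ac a) u"
    by (simp_all add: H_num_def H_den_def algebra_simps power2_eq_square power3_eq_cube)
  show ?thesis
    unfolding H_def map_poly_to_ac_diff map_poly_to_ac_smult map_poly_to_ac_power 1 2
    by (simp only: poly_diff poly_smult poly_power 3 4)
qed

lemma degree_H: "a \<noteq> b \<Longrightarrow> Polynomial.degree (H a b) = 6"
proof -
  assume ab: "a \<noteq> b"
  have d: "Polynomial.degree ([:- 3 * a, 9, 1:] ^ 3) = 6"
    "Polynomial.degree ([:- 2 * a ^ 2 - 27 * a, - 9 * a, - 2 * a, 1:] ^ 2) = 6"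
    by (simp_all add: degree_power_eq)
  have "Polynomial.lead_coeff ([:- 3 * a, 9, 1:] ^ 3) = 1"
    "Polynomial.lead_coeff ([:- 2 * a ^ 2 - 27 * a, - 9 * a, - 2 * a, 1:] ^ 2) = 1"
    unfolding lead_coeff_power by simp_all
  then have "Polynomial.coeff (H a b) 6 = a - b" unfolding d H_def by simp
  then have "6 \<le> Polynomial.degree (H a b)" using ab by (intro le_degree) simp
  moreover have "Polynomial.degree (H a b) \<le> 6"
    unfolding H_def by (intro degree_diff_le order_trans[OF degree_smult_le]) (simp_all only: d order_refl)
  ultimately show ?thesis by simp
qed

lemma affine_three:
  assumes "e = 1 \<or> e = (-1 :: 3)"
  shows "bij (\<lambda>i. e * i + t)"
proof -
  have ee: "e * e = 1" using assms by auto
  show ?thesis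
    by (rule bij_betw_byWitness[where f' = "\<lambda>i. e * (i - t)"])
      (auto simp: ee algebra_simps simp flip: mult.assoc)
qed

lemma enumerates_affine:
  assumes "enumerates z f" "e = 1 \<or> e = (-1 :: 3)"
  shows "enumerates (\<lambda>i. z (e * i + t)) f"
proof -
  note b = affine_three[OF assms(2), of t]
  have "(\<lambda>i. z (e * i + t)) = z \<circ> (\<lambda>i. e * i + t)" by auto
  then show ?thesis using assms(1) b unfolding enumerates_def
    by (metis bij_is_inj bij_is_surj image_comp inj_compose)
qed

text \<open>The root of \<open>H\<close> belonging to the bijection x i \<mapsto> z (e * i + t) for
  e = 1 or e = -1; \<open>tsch_param_rel\<close> justifies the definite description.\<close>

definition tsch_param :: "'m::field \<Rightarrow> (3 \<Rightarrow> 'm alg_closure) \<Rightarrow> (3 \<Rightarrow> 'm alg_closure) \<Rightarrow> 3 \<Rightarrow> 3 \<Rightarrow> 'm alg_closure" where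
  "tsch_param a x z e t = (THE u. tsch_rel a x (\<lambda>i. z (e * i + t)) u)"

locale two_cubics =
  fixes a b :: "'m::field" and x z :: "3 \<Rightarrow> 'm alg_closure"
  assumes x: "enumerates x (cubic a)" and z: "enumerates z (cubic b)"
    and ab: "a \<noteq> b" and b0: "b \<noteq> 0"
begin

lemma tsch_param_rel:
  assumes "e = 1 \<or> e = -1" shows "tsch_rel a x (\<lambda>i. z (e * i + t)) (tsch_param a x z e t)"
proof -
  note y = enumerates_affine[OF z assms, of t]
  have "\<exists>!u. tsch_rel a x (\<lambda>i. z (e * i + t)) u"
    using tsch_rel_exists[OF x y ab b0] tsch_rel_unique[OF x] y unfolding enumerates_def by blast
  then show ?thesis unfolding tsch_param_def by (rule theI')
qed

lemma tsch_param_eqI: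
  assumes "e = 1 \<or> e = -1" "tsch_rel a x (\<lambda>i. z (e * i + t)) u" shows "tsch_param a x z e t = u"
  using tsch_rel_unique[OF x _ tsch_param_rel[OF assms(1)] assms(2)] enumerates_affine[OF z assms(1), of t]
  by (simp add: enumerates_def)

text \<open>By \<open>tsch_rel_scale\<close> the parameter determines all values z (e * i + t), and
  z is injective.\<close>

lemma tsch_param_inj:
  assumes e: "e = 1 \<or> e = -1" and e': "e' = 1 \<or> e' = -1" and eq: "tsch_param a x z e t = tsch_param a x z e' t'"
  shows "e = e' \<and> t = t'"
proof -
  have "z (e * i + t) = z (e' * i + t')" for i
    using tsch_rel_scale(2)[OF x enumerates_affine[OF z e, of t] b0 tsch_param_rel[OF e, of t], of i]
      tsch_rel_scale(2)[OF x enumerates_affine[OF z e', of t'] b0 tsch_param_rel[OF e', of t'], of i] eq by simp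
  then have "e * i + t = e' * i + t'" for i using z by (auto simp: enumerates_def inj_def)
  from this[of 0] this[of 1] show ?thesis by auto
qed

text \<open>The bijections give six distinct roots, as many as the degree permits; so there are no
  others and all are simple.\<close>

lemma H_separable: "separable_poly (H a b)"
  and roots_H: "roots_of (H a b) = {tsch_param a x z e t |e t. e = 1 \<or> e = -1}"
proof -
  let ?S = "{1, -1 :: 3} \<times> (UNIV :: 3 set)" and ?f = "\<lambda>(e, t). tsch_param a x z e t"
  have eq: "{tsch_param a x z e t |e t. e = 1 \<or> e = -1} = ?f ` ?S" by auto
  have "inj_on ?f ?S"
  proof (rule inj_onI)
    fix p q assume "p \<in> ?S" "q \<in> ?S" "?f p = ?f q"
    then show "p = q"
      using tsch_param_inj[of "fst p" "fst q" "snd p" "snd q"] by (auto simp: case_prod_unfold prod_eq_iff)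
  qed
  then have c: "card (?f ` ?S) = 6" by (simp add: card_image card_cartesian_product)
  have sub: "?f ` ?S \<subseteq> roots_of (H a b)"
    using tsch_rel_scale(3)[OF x enumerates_affine[OF z] b0 tsch_param_rel] by (auto simp: poly_H)
  have n: "H a b \<noteq> 0" using degree_H[OF ab] by auto
  then have fin: "finite (roots_of (H a b))" by (intro poly_roots_finite) (simp add: map_poly_eq_0_iff)
  have "card (roots_of (H a b)) \<le> 6"
    using card_poly_roots_bound[of "map_poly to_ac (H a b)"] n degree_H[OF ab]
    by (simp add: map_poly_eq_0_iff degree_map_poly_to_ac)
  then show r: "roots_of (H a b) = {tsch_param a x z e t |e t. e = 1 \<or> e = -1}"
    unfolding eq using card_subset_eq[OF fin sub] card_mono[OF fin sub] c by simp
  show "separable_poly (H a b)"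
    unfolding separable_poly_def r eq using n c degree_H[OF ab] by simp
qed

end

section \<open>Permutations of three roots\<close>

text \<open>
  The roots are indexed by \<open>\<int>/3\<close>, so that every permutation of them is an affine map
  \<open>i \<mapsto> s i + r\<close>, where \<open>s = \<plusminus>1\<close> is its sign.
\<close>

definition act :: "(3 \<Rightarrow> 'a) \<Rightarrow> ('a \<Rightarrow> 'a) \<Rightarrow> 3 \<Rightarrow> 3 \<Rightarrow> bool" where
  "act x \<sigma> s r \<longleftrightarrow> (s = 1 \<or> s = -1) \<and> (\<forall>i. \<sigma> (x i) = x (s * i + r))"

lemma inj_three_affine:
  fixes p :: "3 \<Rightarrow> 3"
  assumes "inj p"
  shows "\<exists>s r. (s = 1 \<or> s = -1) \<and> (\<forall>i. p i = s * i + r)"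
proof -
  have "p 0 \<noteq> p 1" "p 0 \<noteq> p (-1)" "p 1 \<noteq> p (-1)" 
    using injD[OF assms, of 0 1] injD[OF assms, of 0 "-1"] injD[OF assms, of 1 "-1"] by auto
  then show ?thesis
    unfolding all_three
    using three_cases[of "p 0"] three_cases[of "p 1"] three_cases[of "p (-1)"]
    by (intro exI[of _ "p 1 - p 0"] exI[of _ "p 0"]) auto
qed

lemma act_exists:
  assumes x: "enumerates x f" and \<sigma>: "aut base \<sigma>"
  shows "\<exists>s r. act x \<sigma> s r"
proof -
  have ix: "inj x" and rx: "range x = roots_of f" using x by (auto simp: enumerates_def)
  define p where "p i = inv' x (\<sigma> (x i))" for i
  have "\<sigma> (x i) \<in> range x" for i using aut_roots[OF \<sigma>, of "x i" f] rx by blast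
  then have p: "x (p i) = \<sigma> (x i)" for i unfolding p_def by (rule f_inv_into_f)
  have "inj p"
    using p aut_inj[OF \<sigma> intermediate_base] ix by (auto simp: inj_def) metis
  from inj_three_affine[OF this] obtain s r where "s = 1 \<or> s = -1" "\<And>i. p i = s * i + r" by blast
  then show ?thesis unfolding act_def using p by (intro exI[of _ s] exI[of _ r]) auto
qed

lemma act_unique:
  assumes "inj x" "act x \<sigma> s r" "act x \<sigma> s' r'"
  shows "s = s' \<and> r = r'"
proof -
  have "s * i + r = s' * i + r'" for i using assms by (metis act_def injD)
  from this[of 0] this[of 1] show ?thesis by auto
qed

lemma act_sign: "act x \<sigma> s r \<Longrightarrow> s = 1 \<or> s = -1"
  by (simp add: act_def)

lemma act_id: "act x id 1 0"
  by (simp add: act_def)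

lemma act_comp: "act x \<sigma> s r \<Longrightarrow> act x \<tau> s' r' \<Longrightarrow> act x (\<sigma> \<circ> \<tau>) (s * s') (s * r' + r)"
  by (auto simp: act_def algebra_simps)

lemma act_inv:
  assumes "bij \<sigma>" "act x \<sigma> s r"
  shows "act x (inv' \<sigma>) s (- (s * r))"
proof -
  have ss: "s * s = 1" using assms by (auto simp: act_def)
  have "inv' \<sigma> (x i) = x (s * i - s * r)" for i
  proof -
    have "\<sigma> (x (s * i - s * r)) = x i"
      using assms by (simp add: act_def algebra_simps ss flip: mult.assoc)
    then show ?thesis using assms(1) by (metis bij_inv_eq_iff)
  qed
  then show ?thesis using assms(2) by (auto simp: act_def)
qed

text \<open>The image of the Galois group in S_3, an affine map being recorded by its slope and
  translation.\<close>

definition acts :: "(3 \<Rightarrow> 'm::field alg_closure) \<Rightarrow> (3 \<times> 3) set" where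
  "acts x = {(s, r). \<exists>\<sigma>. aut base \<sigma> \<and> act x \<sigma> s r}"

lemma acts_sign: "(s, r) \<in> acts x \<Longrightarrow> s = 1 \<or> s = -1"
  by (auto simp: acts_def dest: act_sign)

lemma acts_id: "(1, 0) \<in> acts x"
  unfolding acts_def using act_id aut_id by blast

lemma acts_comp: "(s, r) \<in> acts x \<Longrightarrow> (s', r') \<in> acts x \<Longrightarrow> (s * s', s * r' + r) \<in> acts x"
  unfolding acts_def using act_comp aut_comp by blast

text \<open>\<open>rot\<close> and \<open>odd_act\<close> say that the image contains a 3-cycle,
  respectively a reflection. Together they fix its order and, among subgroups of S_3, its
  isomorphism type.\<close>

definition rot :: "(3 \<Rightarrow> 'm::field alg_closure) \<Rightarrow> bool" where "rot x \<longleftrightarrow> (1, 1) \<in> acts x"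

definition odd_act :: "(3 \<Rightarrow> 'm::field alg_closure) \<Rightarrow> bool" where "odd_act x \<longleftrightarrow> (\<exists>r. (-1, r) \<in> acts x)"

lemma rotI: "(1, r) \<in> acts x \<Longrightarrow> r \<noteq> 0 \<Longrightarrow> rot x"
  using three_cases[of r] acts_comp[of 1 r x 1 r] by (auto simp: rot_def)

lemma rotD: "rot x \<Longrightarrow> (1, r) \<in> acts x"
  using three_cases[of r] acts_comp[of 1 1 x 1 1] acts_id[of x] by (auto simp: rot_def)

text \<open>V is the group of translations in the image, either trivial or everything; the odd
  elements, if there are any, form one coset of it.\<close>

lemma card_acts: "card (acts x) = (if rot x then 3 else 1) * (if odd_act x then 2 else 1)"
proof -
  define V where "V = (if rot x then UNIV else {0 :: 3})"
  have V: "(1, r) \<in> acts x \<longleftrightarrow> r \<in> V" for r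
    using rotI[of r x] rotD[of x r] acts_id[of x] by (auto simp: V_def)
  have cV: "card V = (if rot x then 3 else 1)" by (simp add: V_def)
  show ?thesis
  proof (cases "odd_act x")
    case True
    then obtain q where q: "(-1, q) \<in> acts x" by (auto simp: odd_act_def)
    \<comment> \<open>Composition with the odd element (-1, q) exchanges odd elements and
      translations.\<close>
    have o: "(-1, r) \<in> acts x \<longleftrightarrow> q - r \<in> V" for r
      using acts_comp[OF q, of "-1" r] acts_comp[OF q, of 1 "q - r"] V[of "q - r"] by auto
    have "acts x = Pair (1::3) ` V \<union> Pair (-1::3) ` ((\<lambda>v. q - v) ` V)"
    proof (intro equalityI subsetI)
      fix p assume "p \<in> acts x"
      then show "p \<in> Pair (1::3) ` V \<union> Pair (-1::3) ` ((\<lambda>v. q - v) ` V)"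
        using acts_sign[of "fst p" "snd p" x] V[of "snd p"] o[of "snd p"]
        by (cases p) (auto simp: image_iff intro!: bexI[of _ "q - snd p"])
    qed (use V o in auto)
    moreover have "card (Pair (1::3) ` V \<union> Pair (-1::3) ` ((\<lambda>v. q - v) ` V)) = card (Pair (1::3) ` V) + card (Pair (-1::3) ` ((\<lambda>v. q - v) ` V))"
      by (rule card_Un_disjoint) auto
    moreover have "card (Pair (1::3) ` V) = card V" "card (Pair (-1::3) ` ((\<lambda>v. q - v) ` V)) = card V"
      by (simp_all add: card_image inj_on_def)
    ultimately show ?thesis using True cV by simp
  next
    case False
    then have "acts x = Pair (1::3) ` V"
      using acts_sign[of _ _ x] V by (fastforce simp: odd_act_def)
    then show ?thesis using False cV by (simp add: card_image inj_on_def)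
  qed
qed

lemma aut_agree_spl:
  assumes \<sigma>: "aut base \<sigma>" and \<tau>: "aut base \<tau>" and "\<And>v. v \<in> roots_of f \<Longrightarrow> \<sigma> v = \<tau> v" and "v \<in> spl f"
  shows "\<sigma> v = \<tau> v"
proof -
  have "intermediate {v. \<sigma> v = \<tau> v}"
    by (auto simp: intermediate_def aut_closed[OF \<sigma> intermediate_base] aut_closed[OF \<tau> intermediate_base])
  from spl_minimal[OF this, of f] show ?thesis using assms by auto
qed

text \<open>An automorphism of the splitting field is determined by its affine map on the indices,
  which \<phi> reads off.\<close>

lemma order_gal:
  assumes x: "enumerates x f"
  shows "Coset.order (gal (spl f)) = card (acts x)"
proof -
  have ix: "inj x" and rx: "range x = roots_of f" using x by (auto simp: enumerates_def)
  have xs: "x i \<in> spl f" for i using rx spl_roots[of f] by blast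
  have act_res: "act x (restrict \<sigma> (spl f)) s r \<longleftrightarrow> act x \<sigma> s r" for \<sigma> s r
    by (simp add: act_def xs)
  define \<phi> where "\<phi> g = (THE p. act x g (fst p) (snd p))" for g
  have \<phi>: "\<phi> (restrict \<sigma> (spl f)) = (s, r)" if "act x \<sigma> s r" for \<sigma> s r
    unfolding \<phi>_def using that act_unique[OF ix] by (intro the_equality) (auto simp: act_res prod_eq_iff)
  have "bij_betw \<phi> (carrier (gal (spl f))) (acts x)"
    unfolding bij_betw_def
  proof
    show "inj_on \<phi> (carrier (gal (spl f)))"
    proof (rule inj_onI)
      fix g h assume "g \<in> carrier (gal (spl f))" "h \<in> carrier (gal (spl f))" and e: "\<phi> g = \<phi> h"
      then obtain \<sigma> \<tau> where st: "aut base \<sigma>" "aut base \<tau>" "g = restrict \<sigma> (spl f)" "h = restrict \<tau> (spl f)"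
        by (auto simp: gal_carrier)
      obtain s r where a: "act x \<sigma> s r" using act_exists[OF x st(1)] by blast
      obtain s' r' where b: "act x \<tau> s' r'" using act_exists[OF x st(2)] by blast
      have "s = s'" "r = r'" using e \<phi>[OF a] \<phi>[OF b] st by auto
      then have "\<sigma> v = \<tau> v" if "v \<in> roots_of f" for v
        using that a b unfolding rx[symmetric] by (auto simp: act_def)
      then show "g = h"
        using aut_agree_spl[OF st(1,2), of f] by (auto simp: st(3,4) restrict_def)
    qed
    show "\<phi> ` carrier (gal (spl f)) = acts x"
    proof (intro equalityI subsetI)
      fix p assume "p \<in> \<phi> ` carrier (gal (spl f))"
      then obtain \<sigma> where s: "aut base \<sigma>" "p = \<phi> (restrict \<sigma> (spl f))" by (auto simp: gal_carrier)
      obtain s r where "act x \<sigma> s r" using act_exists[OF x s(1)] by blast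
      then show "p \<in> acts x" using s \<phi> by (auto simp: acts_def)
    next
      fix p assume "p \<in> acts x"
      then obtain \<sigma> s r where "aut base \<sigma>" "act x \<sigma> s r" "p = (s, r)" by (auto simp: acts_def)
      then show "p \<in> \<phi> ` carrier (gal (spl f))" using \<phi> by (force simp: gal_carrier)
    qed
  qed
  then show ?thesis by (simp add: Coset.order_def bij_betw_same_card)
qed

section \<open>Isomorphism types of the Galois groups\<close>

lemma prime_order_iso_integer_mod_group:
  assumes G: "group G" and p: "Factorial_Ring.prime (Coset.order G)"
  shows "G \<cong> integer_mod_group (Coset.order G)"
proof -
  interpret group G by (rule G)
  let ?p = "Coset.order G"
  have fin: "finite (carrier G)" using p by (metis card.infinite not_prime_0 Coset.order_def)
  have "\<exists>g\<in>carrier G. g \<noteq> \<one>\<^bsub>G\<^esub>"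
  proof (rule ccontr)
    assume "\<not> ?thesis"
    then have "carrier G = {\<one>\<^bsub>G\<^esub>}" by auto
    then show False using p by (simp add: Coset.order_def)
  qed
  then obtain g where g: "g \<in> carrier G" "g \<noteq> \<one>\<^bsub>G\<^esub>" by blast
  have "ord g dvd ?p" using ord_dvd_group_order[OF g(1)] .
  then have o: "ord g = ?p" using p g ord_eq_1[OF g(1)] by (auto simp: prime_nat_iff)
  let ?h = "\<lambda>k::int. g [^]\<^bsub>G\<^esub> k" and ?Z = "integer_mod_group ?p"
  have p0: "?p > 0" using p by (simp add: prime_gt_0_nat)
  have "?h \<in> hom ?Z G"
    using g p0 o by (intro homI) (auto simp: int_pow_mult[symmetric] int_pow_eq)
  moreover have "inj_on ?h (carrier ?Z)"
  proof (rule inj_onI)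
    fix k l assume kl: "k \<in> carrier ?Z" "l \<in> carrier ?Z" "?h k = ?h l"
    then have "int ?p dvd k - l \<or> int ?p dvd l - k" using int_pow_eq[OF g(1)] o by auto
    then have "int ?p dvd k - l" by (metis dvd_minus_iff minus_diff_eq)
    then have "k mod int ?p = l mod int ?p" by (simp add: mod_eq_dvd_iff)
    then show "k = l" using kl(1,2) p0 by (simp add: carrier_integer_mod_group)
  qed
  moreover have "?h ` carrier ?Z = carrier G"
  proof (rule card_subset_eq[OF fin])
    show "?h ` carrier ?Z \<subseteq> carrier G" using g by auto
    show "card (?h ` carrier ?Z) = card (carrier G)"
      using card_image[OF calculation(2)] p0 by (simp add: carrier_integer_mod_group Coset.order_def)
  qed
  ultimately have "?Z \<cong> G" by (auto simp: is_iso_def iso_def bij_betw_def)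
  then show ?thesis using group.iso_sym[OF group_integer_mod_group] by blast
qed

text \<open>The action on the numbered roots is an injective homomorphism into a group of the same
  order 6.\<close>

lemma gal_iso_sym_group:
  assumes x: "enumerates x f" and o: "Coset.order (gal (spl f)) = 6"
  shows "gal (spl f) \<cong> sym_group 3"
proof -
  have ix: "inj x" and rx: "range x = roots_of f" using x by (auto simp: enumerates_def)
  let ?N = "{1..3::nat}"
  \<comment> \<open>\<open>sym_group 3\<close> permutes {1, 2, 3}, so the roots are renumbered;
    \<open>of_nat\<close> sends 1, 2, 3 to 1, -1, 0.\<close>
  define \<iota> :: "nat \<Rightarrow> 'a alg_closure" where "\<iota> n = x (of_nat n)" for n
  have N: "?N = {1, 2, 3}" by auto
  have \<iota>: "bij_betw \<iota> ?N (roots_of f)"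
  proof -
    have "bij_betw (of_nat :: nat \<Rightarrow> 3) ?N UNIV"
      unfolding bij_betw_def N UNIV_three by auto
    moreover have "bij_betw x UNIV (roots_of f)" using ix rx by (simp add: bij_betw_def)
    ultimately have "bij_betw (x \<circ> of_nat) ?N (roots_of f)" by (rule bij_betw_trans)
    then show ?thesis by (simp add: \<iota>_def[abs_def] comp_def)
  qed
  let ?j = "inv_into ?N \<iota>"
  have j: "?j v \<in> ?N" "\<iota> (?j v) = v" if "v \<in> roots_of f" for v
  proof -
    have "v \<in> \<iota> ` ?N" using \<iota> that by (simp add: bij_betw_def)
    then show "?j v \<in> ?N" "\<iota> (?j v) = v" by (rule inv_into_into, rule f_inv_into_f)
  qed
  have \<iota>j: "?j (\<iota> n) = n" if "n \<in> ?N" for n using \<iota> that by (simp add: bij_betw_def)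
  have \<iota>r: "\<iota> n \<in> roots_of f" if "n \<in> ?N" for n using \<iota> that by (auto simp: bij_betw_def)
  define h where "h g = (\<lambda>n. if n \<in> ?N then ?j (g (\<iota> n)) else n)" for g
  have root: "v \<in> spl f" if "v \<in> roots_of f" for v using that spl_roots by blast
  have hr: "h (restrict \<sigma> (spl f)) n = ?j (\<sigma> (\<iota> n))" if "n \<in> ?N" for n \<sigma>
    using that root[OF \<iota>r[OF that]] by (simp add: h_def)
  have hp: "h (restrict \<sigma> (spl f)) permutes ?N" if \<sigma>: "aut base \<sigma>" for \<sigma>
  proof (rule inj_imp_permutes)
    show "inj_on (h (restrict \<sigma> (spl f))) ?N"
    proof (rule inj_onI)
      fix n m assume n: "n \<in> ?N" and m: "m \<in> ?N" and "h (restrict \<sigma> (spl f)) n = h (restrict \<sigma> (spl f)) m"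
      then have "?j (\<sigma> (\<iota> n)) = ?j (\<sigma> (\<iota> m))" using hr by simp
      then have "\<sigma> (\<iota> n) = \<sigma> (\<iota> m)" using j(2) aut_roots[OF \<sigma>] \<iota>r n m by metis
      then have "\<iota> n = \<iota> m" using aut_inj[OF \<sigma> intermediate_base] by simp
      then show "n = m" using \<iota>j n m by metis
    qed
    show "h (restrict \<sigma> (spl f)) n \<in> ?N" if "n \<in> ?N" for n
      unfolding hr[OF that] by (rule j(1)[OF aut_roots[OF \<sigma> \<iota>r[OF that]]])
    show "h (restrict \<sigma> (spl f)) n = n" if "n \<notin> ?N" for n unfolding h_def using that by auto
  qed auto
  have hom: "h \<in> hom (gal (spl f)) (sym_group 3)"
  proof (rule homI)
    fix g assume "g \<in> carrier (gal (spl f))"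
    then show "h g \<in> carrier (sym_group 3)" using hp by (auto simp: gal_carrier sym_group_carrier)
  next
    fix g k assume "g \<in> carrier (gal (spl f))" "k \<in> carrier (gal (spl f))"
    then obtain \<sigma> \<tau> where st: "aut base \<sigma>" "aut base \<tau>" "g = restrict \<sigma> (spl f)" "k = restrict \<tau> (spl f)"
      by (auto simp: gal_carrier)
    have "h (restrict (\<sigma> \<circ> \<tau>) (spl f)) n = h (restrict \<sigma> (spl f)) (h (restrict \<tau> (spl f)) n)" for n
    proof (cases "n \<in> ?N")
      case True
      note v = aut_roots[OF st(2) \<iota>r[OF True]]
      have "h (restrict (\<sigma> \<circ> \<tau>) (spl f)) n = ?j (\<sigma> (\<tau> (\<iota> n)))" unfolding hr[OF True] by simp
      also have "\<dots> = h (restrict \<sigma> (spl f)) (?j (\<tau> (\<iota> n)))" unfolding hr[OF j(1)[OF v]] j(2)[OF v] ..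
      finally show ?thesis unfolding hr[OF True] .
    next
      case False
      then have "h g n = n" for g unfolding h_def by (rule if_not_P)
      then show ?thesis by (simp only:)
    qed
    then show "h (g \<otimes>\<^bsub>gal (spl f)\<^esub> k) = h g \<otimes>\<^bsub>sym_group 3\<^esub> h k"
      unfolding st gal_mult[OF st(1,2)] sym_group_mult by (auto simp: fun_eq_iff)
  qed
  have inj: "inj_on h (carrier (gal (spl f)))"
  proof (rule inj_onI)
    fix g k assume "g \<in> carrier (gal (spl f))" "k \<in> carrier (gal (spl f))" and e: "h g = h k"
    then obtain \<sigma> \<tau> where st: "aut base \<sigma>" "aut base \<tau>" "g = restrict \<sigma> (spl f)" "k = restrict \<tau> (spl f)"
      by (auto simp: gal_carrier)
    have "\<sigma> v = \<tau> v" if v: "v \<in> roots_of f" for v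
    proof -
      have "?j (\<sigma> (\<iota> (?j v))) = ?j (\<tau> (\<iota> (?j v)))"
        using e hr[OF j(1)[OF v]] unfolding st by metis
      then have "?j (\<sigma> v) = ?j (\<tau> v)" by (simp only: j(2)[OF v])
      then show ?thesis using j(2)[OF aut_roots[OF st(1) v]] j(2)[OF aut_roots[OF st(2) v]] by metis
    qed
    then show "g = k" using aut_agree_spl[OF st(1,2), of f] by (auto simp: st(3,4) restrict_def)
  qed
  have "finite (carrier (sym_group 3))" by (simp add: sym_group_def finite_permutations)
  moreover have "card (h ` carrier (gal (spl f))) = card (carrier (sym_group 3))"
    using card_image[OF inj] o by (simp add: sym_group_card_carrier Coset.order_def fact_numeral)
  moreover have "h ` carrier (gal (spl f)) \<subseteq> carrier (sym_group 3)" using hom by (auto simp: hom_def)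
  ultimately have "h ` carrier (gal (spl f)) = carrier (sym_group 3)" by (metis card_subset_eq)
  then show ?thesis using hom inj by (auto simp: is_iso_def iso_def bij_betw_def)
qed

text \<open>The four possible orders 6, 3, 2, 1 are distinct, so the order decides the case: 6
  forces the full symmetric group, and prime order forces a cyclic group.\<close>

lemma gal_types:
  assumes x: "enumerates x f"
  shows "gal (spl f) \<cong> sym_group 3 \<longleftrightarrow> rot x \<and> odd_act x"
    "gal (spl f) \<cong> integer_mod_group 3 \<longleftrightarrow> rot x \<and> \<not> odd_act x"
    "gal (spl f) \<cong> integer_mod_group 2 \<longleftrightarrow> \<not> rot x \<and> odd_act x"
    "trivial_group (gal (spl f)) \<longleftrightarrow> \<not> rot x \<and> \<not> odd_act x"
proof -
  let ?G = "gal (spl f)"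
  have o: "Coset.order ?G = (if rot x then 3 else 1) * (if odd_act x then 2 else 1)"
    by (simp only: order_gal[OF x] card_acts)
  have "?G \<cong> sym_group 3 \<Longrightarrow> Coset.order ?G = 6"
    using iso_same_card[of ?G "sym_group 3"] by (simp add: Coset.order_def sym_group_card_carrier fact_numeral)
  then show "?G \<cong> sym_group 3 \<longleftrightarrow> rot x \<and> odd_act x"
    using gal_iso_sym_group[OF x] o by (auto split: if_splits)
  have "?G \<cong> integer_mod_group n \<longleftrightarrow> Coset.order ?G = n" if n: "Factorial_Ring.prime n" for n
  proof
    assume "?G \<cong> integer_mod_group n"
    from iso_same_card[OF this] show "Coset.order ?G = n"
      using n by (auto simp: Coset.order_def carrier_integer_mod_group)
  next
    assume "Coset.order ?G = n"
    then show "?G \<cong> integer_mod_group n"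
      using prime_order_iso_integer_mod_group[OF gal_group, of f] n by simp
  qed
  from this[of 3] this[of 2] show "?G \<cong> integer_mod_group 3 \<longleftrightarrow> rot x \<and> \<not> odd_act x"
    "?G \<cong> integer_mod_group 2 \<longleftrightarrow> \<not> rot x \<and> odd_act x"
    by (simp_all add: o)
  have "trivial_group ?G \<longleftrightarrow> Coset.order ?G = 1"
    using group.order_one_triv_iff[OF gal_group, of f] gal_group[of f] by (simp add: trivial_group_def)
  then show "trivial_group ?G \<longleftrightarrow> \<not> rot x \<and> \<not> odd_act x" using o by (auto split: if_splits)
qed

section \<open>The Galois action on the roots of $H$\<close>

lemma enumerates_roots: "enumerates x f \<Longrightarrow> x i \<in> roots_of f"
  by (auto simp: enumerates_def)

lemma enumerates_in_spl: "enumerates x f \<Longrightarrow> x i \<in> spl f"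
  using enumerates_roots spl_roots by blast

lemma act_trivial_fixes_spl:
  assumes x: "enumerates x f" and \<sigma>: "aut base \<sigma>" and a: "act x \<sigma> 1 0" and v: "v \<in> spl f"
  shows "\<sigma> v = v"
proof (rule aut_fixes_spl[OF \<sigma> _ v])
  fix w assume "w \<in> roots_of f"
  then obtain i where "w = x i" using x by (auto simp: enumerates_def)
  then show "\<sigma> w = w" using a by (simp add: act_def)
qed

text \<open>The minimal polynomial of a root comes from M and divides the irreducible cubic, so it
  has degree 3 and its roots are a single orbit.\<close>

lemma irreducible_cubic_orb:
  assumes x: "enumerates x (cubic a)" and irr: "Factorial_Ring.irreducible (cubic a)"
  shows "orb (x i) = roots_of (cubic a)"
proof -
  obtain \<mu> where m: "minpoly base (x i) \<mu>" using minpoly_exists[OF intermediate_base] by blast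
  then obtain p where p: "\<mu> = map_poly to_ac p" unfolding minpoly_def by (auto elim: polys_baseE)
  have dp: "Polynomial.degree p > 0" using minpoly_degree_pos[OF m] by (simp add: p degree_map_poly_to_ac)
  then have p0: "p \<noteq> 0" by auto
  \<comment> \<open>The division takes place over M; a nonzero remainder would annihilate x i in a
    degree below that of the minimal polynomial.\<close>
  have "cubic a mod p = 0"
  proof (rule ccontr)
    assume n: "cubic a mod p \<noteq> 0"
    have "map_poly to_ac (cubic a) = map_poly to_ac (cubic a - cubic a mod p) + map_poly to_ac (cubic a mod p)"
      by (simp add: map_poly_to_ac_diff)
    also have "cubic a - cubic a mod p = p * (cubic a div p)" by (simp add: minus_mod_eq_mult_div)
    finally have "poly (map_poly to_ac (cubic a mod p)) (x i) = 0"
      using enumerates_roots[OF x, of i] m by (simp add: map_poly_to_ac_mult p minpoly_def)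
    moreover have "map_poly to_ac (cubic a mod p) \<noteq> 0" using n by (simp add: map_poly_eq_0_iff)
    ultimately have "Polynomial.degree p \<le> Polynomial.degree (cubic a mod p)"
      using m polys_base unfolding minpoly_def p by (metis degree_map_poly_to_ac)
    then show False using degree_mod_less'[OF p0 n] by simp
  qed
  then have "p dvd cubic a" by auto
  then obtain q where q: "cubic a = p * q" by (auto elim: dvdE)
  have "\<not> p dvd 1" using dp p0 by (simp add: is_unit_iff_degree)
  then have "q dvd 1" using Factorial_Ring.irreducibleD[OF irr q] by blast
  moreover have "q \<noteq> 0" using q degree_cubic[of a] by auto
  ultimately have "Polynomial.degree q = 0" by (simp add: is_unit_iff_degree)
  then have "Polynomial.degree p = 3" using q degree_cubic[of a] p0 \<open>q \<noteq> 0\<close> by (simp add: Polynomial.degree_mult_eq)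
  note s = separable_poly_sep[OF enumerates_separable[OF x] enumerates_roots[OF x, of i, simplified]]
  have "card (orb (x i)) = card (roots_of (cubic a))"
    using separable_over_minpoly_card[OF intermediate_base m s] orb_eq_roots[OF m] \<open>Polynomial.degree p = 3\<close>
      enumerates_separable[OF x] by (simp add: p degree_map_poly_to_ac separable_poly_def degree_cubic)
  moreover have "orb (x i) \<subseteq> roots_of (cubic a)"
    unfolding orb_def using aut_roots enumerates_roots[OF x] by blast
  moreover have "finite (roots_of (cubic a))"
    using x by (metis enumerates_def finite_class.finite_UNIV finite_imageI)
  ultimately show ?thesis by (metis card_subset_eq)
qed

text \<open>Transitivity supplies elements with translation parts 1 and -1. An even one among them
  is a rotation; if both are reflections, their product is a rotation.\<close>

lemma irreducible_rot:
  assumes x: "enumerates x (cubic a)" and irr: "Factorial_Ring.irreducible (cubic a)"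
  shows "rot x"
proof -
  have "\<exists>s. (s, i) \<in> acts x" for i
  proof -
    have "x i \<in> orb (x 0)" using irreducible_cubic_orb[OF x irr] enumerates_roots[OF x] by blast
    then obtain \<sigma> where \<sigma>: "aut base \<sigma>" "\<sigma> (x 0) = x i" by (auto simp: orb_def)
    obtain s r where a: "act x \<sigma> s r" using act_exists[OF x \<sigma>(1)] by blast
    then have "x r = x i" using \<sigma>(2) by (simp add: act_def)
    then have "r = i" using x by (auto simp: enumerates_def inj_def)
    then show ?thesis using a \<sigma> by (auto simp: acts_def)
  qed
  then obtain s s' where s: "(s, 1) \<in> acts x" "(s', -1) \<in> acts x" by meson
  show ?thesis
    using acts_sign[OF s(1)] acts_sign[OF s(2)] s acts_comp[OF s] rotI[of _ x] by auto
qed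

context two_cubics
begin

text \<open>
  For example, \<open>(1, 1, 1, 0)\<close> belongs to this set iff some automorphism permutes the roots of the first
  cubic cyclically and fixes those of the second.
\<close>

definition joint_acts :: "(3 \<times> 3 \<times> 3 \<times> 3) set" where
  "joint_acts = {(s, r, s', r'). \<exists>\<sigma>. aut base \<sigma> \<and> act x \<sigma> s r \<and> act z \<sigma> s' r'}"

abbreviation La where "La \<equiv> spl (cubic a)"
abbreviation Lb where "Lb \<equiv> spl (cubic b)"

lemma joint_acts_sign: "(s, r, s', r') \<in> joint_acts \<Longrightarrow> (s = 1 \<or> s = -1) \<and> (s' = 1 \<or> s' = -1)"
  by (auto simp: joint_acts_def dest: act_sign)

lemma joint_acts_id: "(1, 0, 1, 0) \<in> joint_acts"
  unfolding joint_acts_def using act_id aut_id by blast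

lemma joint_acts_comp:
  "(s, r, s', r') \<in> joint_acts \<Longrightarrow> (p, q, p', q') \<in> joint_acts \<Longrightarrow> (s * p, s * q + r, s' * p', s' * q' + r') \<in> joint_acts"
  unfolding joint_acts_def by clarsimp (use act_comp aut_comp in blast)

lemma joint_acts_inv: "(s, r, s', r') \<in> joint_acts \<Longrightarrow> (s, - (s * r), s', - (s' * r')) \<in> joint_acts"
proof -
  assume "(s, r, s', r') \<in> joint_acts"
  then obtain \<sigma> where \<sigma>: "aut base \<sigma>" "act x \<sigma> s r" "act z \<sigma> s' r'" by (auto simp: joint_acts_def)
  note i = aut_inv[OF \<sigma>(1) intermediate_base] act_inv[OF aut_bij[OF \<sigma>(1)] \<sigma>(2)] act_inv[OF aut_bij[OF \<sigma>(1)] \<sigma>(3)]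
  show "(s, - (s * r), s', - (s' * r')) \<in> joint_acts"
    unfolding joint_acts_def by clarsimp (use i in blast)
qed

lemma joint_acts_exists:
  assumes "aut base \<sigma>"
  obtains s r s' r' where "act x \<sigma> s r" "act z \<sigma> s' r'" "(s, r, s', r') \<in> joint_acts"
  using act_exists[OF x assms] act_exists[OF z assms] assms unfolding joint_acts_def by blast

lemma acts_x: "(s, r) \<in> acts x \<longleftrightarrow> (\<exists>s' r'. (s, r, s', r') \<in> joint_acts)"
  unfolding acts_def joint_acts_def using act_exists[OF z] by blast

lemma acts_z: "(s', r') \<in> acts z \<longleftrightarrow> (\<exists>s r. (s, r, s', r') \<in> joint_acts)"
  unfolding acts_def joint_acts_def using act_exists[OF x] by blast

text \<open>Applying \<sigma> to the relation for (e, t) shows that the image parameter belongs to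
  the bijection conjugated by \<sigma>: first undo \<sigma> on the x-indices, then apply (e, t),
  then \<sigma> on the z-indices. The stated slope and offset are this composite.\<close>

lemma aut_U:
  assumes \<sigma>: "aut base \<sigma>" and ax: "act x \<sigma> s r" and az: "act z \<sigma> s' r'" and e: "e = 1 \<or> e = -1"
  shows "\<sigma> (tsch_param a x z e t) = tsch_param a x z (s' * e * s) (s' * t + r' - s' * e * s * r)"
proof (rule tsch_param_eqI[symmetric])
  note [simp] = aut_closed[OF \<sigma> intermediate_base]
  have ss: "s * s = 1" using ax by (auto simp: act_def)
  show "s' * e * s = 1 \<or> s' * e * s = -1" using ax az e by (auto simp: act_def)
  obtain c where c: "\<And>i. z (e * i + t) = c * tsch a (tsch_param a x z e t) (x i)"
    using tsch_param_rel[OF e, of t] by (auto simp: tsch_rel_def)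
  have "z (s' * e * s * i + (s' * t + r' - s' * e * s * r)) = \<sigma> c * tsch a (\<sigma> (tsch_param a x z e t)) (x i)" for i
  proof -
    \<comment> \<open>The index of the root that \<sigma> sends to x i.\<close>
    let ?j = "s * (i - r)"
    have "s * ?j + r = i" by (simp add: ss flip: mult.assoc)
    then have xi: "x i = \<sigma> (x ?j)" using ax by (simp add: act_def)
    have "z (s' * e * s * i + (s' * t + r' - s' * e * s * r)) = z (s' * (e * ?j + t) + r')"
      by (simp add: algebra_simps)
    also have "\<dots> = \<sigma> (z (e * ?j + t))" using az by (simp add: act_def)
    also have "\<dots> = \<sigma> c * tsch a (\<sigma> (tsch_param a x z e t)) (\<sigma> (x ?j))"
      unfolding c by (simp add: tsch_def)
    finally show ?thesis unfolding xi .
  qed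
  then show "tsch_rel a x (\<lambda>i. z (s' * e * s * i + (s' * t + r' - s' * e * s * r))) (\<sigma> (tsch_param a x z e t))"
    unfolding tsch_rel_def by blast
qed

lemma orb_U:
  assumes e: "e = 1 \<or> e = -1"
  shows "orb (tsch_param a x z e t) = {tsch_param a x z (s' * e * s) (s' * t + r' - s' * e * s * r) |s r s' r'. (s, r, s', r') \<in> joint_acts}"
proof (intro equalityI subsetI)
  fix v assume "v \<in> orb (tsch_param a x z e t)"
  then obtain \<sigma> where \<sigma>: "aut base \<sigma>" "v = \<sigma> (tsch_param a x z e t)" by (auto simp: orb_def)
  obtain s r s' r' where "act x \<sigma> s r" "act z \<sigma> s' r'" "(s, r, s', r') \<in> joint_acts" using joint_acts_exists[OF \<sigma>(1)] .
  then show "v \<in> {tsch_param a x z (s' * e * s) (s' * t + r' - s' * e * s * r) |s r s' r'. (s, r, s', r') \<in> joint_acts}"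
    using aut_U[OF \<sigma>(1) _ _ e] \<sigma>(2) by blast
next
  fix v assume "v \<in> {tsch_param a x z (s' * e * s) (s' * t + r' - s' * e * s * r) |s r s' r'. (s, r, s', r') \<in> joint_acts}"
  then show "v \<in> orb (tsch_param a x z e t)"
    unfolding orb_def joint_acts_def using aut_U[OF _ _ _ e, symmetric] by blast
qed

lemma orb_U_I:
  assumes "(s, r, s', r') \<in> joint_acts" "e = 1 \<or> e = -1" "e' = s' * e * s" "t' = s' * t + r' - s' * e * s * r"
  shows "tsch_param a x z e' t' \<in> orb (tsch_param a x z e t)"
  unfolding orb_U[OF assms(2)] using assms by blast

lemma tsch_param_in_roots: "e = 1 \<or> e = -1 \<Longrightarrow> tsch_param a x z e t \<in> roots_of (H a b)"
  unfolding roots_H by blast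

lemma orb_roots: "e = 1 \<or> e = -1 \<Longrightarrow> orb (tsch_param a x z e t) \<subseteq> roots_of (H a b)"
  unfolding orb_def using tsch_param_in_roots aut_roots by blast

lemma card_U:
  assumes "e = 1 \<or> e = -1" shows "card (tsch_param a x z e ` T) = card T"
  using tsch_param_inj[OF assms assms] by (intro card_image) (auto simp: inj_on_def)

lemma factor_degrees_H:
  assumes "\<Union>(set As) = roots_of (H a b)" "distinct As" "pairwise disjnt (set As)"
    and "\<And>A. A \<in> set As \<Longrightarrow> \<exists>u. A = orb u"
  shows "factor_degrees (H a b) (mset (map card As))"
  using factor_degrees_orbits[OF H_separable _ assms] degree_H[OF ab] by simp

section \<open>Orbit patterns on the six bijections\<close>

lemma E_power: "(1, 1, 1, 0) \<in> joint_acts \<Longrightarrow> (1, k, 1, 0) \<in> joint_acts"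
  using three_cases[of k] joint_acts_id joint_acts_comp[of 1 1 1 0 1 1 1 0] by auto

text \<open>Powers of the 3-cycle acting on x alone move t freely, and an element with unequal signs
  exchanges the two slopes; so all six bijections form one orbit.\<close>

lemma factor_6:
  assumes E: "(1, 1, 1, 0) \<in> joint_acts" and D: "(s, r, s', r') \<in> joint_acts" "s \<noteq> s'"
  shows "factor_degrees (H a b) {#6#}"
proof -
  have ss: "s' * s = -1" using D(2) joint_acts_sign[OF D(1)] by auto
  have "tsch_param a x z e t \<in> orb (tsch_param a x z 1 0)" if "e = 1 \<or> e = -1" for e t
  proof (cases "e = 1")
    case True
    then show ?thesis using orb_U_I[OF E_power[OF E, of "-t"], of 1 1 t 0] by simp
  next
    case False
    \<comment> \<open>The exponent k = t - r - r' solves t = r' + (r + k), the formula for the new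
      offset when s' * s = -1.\<close>
    have g: "(s, r + (t - r - r'), s', r') \<in> joint_acts" using joint_acts_comp[OF E_power[OF E, of "t - r - r'"] D(1)] by (simp add: algebra_simps)
    have "- 1 = s' * 1 * s" "t = s' * 0 + r' - s' * 1 * s * (r + (t - r - r'))" using ss by simp_all
    with orb_U_I[OF g, of 1 "-1" t 0] have "tsch_param a x z (- 1) t \<in> orb (tsch_param a x z 1 0)" by blast
    then show ?thesis using that False by simp
  qed
  then have "orb (tsch_param a x z 1 0) = roots_of (H a b)" using orb_roots[of 1 0] unfolding roots_H by blast
  moreover have "card (roots_of (H a b)) = 6"
    using H_separable degree_H[OF ab] by (simp add: separable_poly_def)
  ultimately show ?thesis using factor_degrees_H[of "[orb (tsch_param a x z 1 0)]"] by auto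
qed

lemma roots_H_split: "roots_of (H a b) = tsch_param a x z 1 ` UNIV \<union> tsch_param a x z (-1) ` UNIV"
  unfolding roots_H by auto

lemma tsch_param_image_eq:
  assumes "e = 1 \<or> e = -1" "e' = 1 \<or> e' = -1" "T \<noteq> {}"
  shows "tsch_param a x z e ` T = tsch_param a x z e' ` T' \<longleftrightarrow> e = e' \<and> T = T'"
proof
  assume eq: "tsch_param a x z e ` T = tsch_param a x z e' ` T'"
  have m: "tsch_param a x z e t \<in> tsch_param a x z e' ` T' \<longleftrightarrow> e = e' \<and> t \<in> T'" for t
    using tsch_param_inj[OF assms(1,2)] by blast
  have m': "tsch_param a x z e' t \<in> tsch_param a x z e ` T \<longleftrightarrow> e' = e \<and> t \<in> T" for t
    using tsch_param_inj[OF assms(2,1)] by blast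
  show "e = e' \<and> T = T'" using m m' eq assms(3) by blast
qed auto

lemma tsch_param_image_disjnt:
  assumes "e = 1 \<or> e = -1" "e' = 1 \<or> e' = -1"
  shows "disjnt (tsch_param a x z e ` T) (tsch_param a x z e' ` T') \<longleftrightarrow> e \<noteq> e' \<or> disjnt T T'"
  using tsch_param_inj[OF assms] unfolding disjnt_def by blast

text \<open>Equal signs preserve the slope e, while the 3-cycle on x alone is transitive on
  t.\<close>

lemma factor_33:
  assumes E: "(1, 1, 1, 0) \<in> joint_acts" and D: "\<And>s r s' r'. (s, r, s', r') \<in> joint_acts \<Longrightarrow> s = s'"
  shows "factor_degrees (H a b) {#3, 3#}"
proof -
  have o: "orb (tsch_param a x z e 0) = tsch_param a x z e ` UNIV" if e: "e = 1 \<or> e = -1" for e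
  proof (intro equalityI subsetI)
    fix v assume "v \<in> orb (tsch_param a x z e 0)"
    then obtain s r s' r' where g: "(s, r, s', r') \<in> joint_acts" "v = tsch_param a x z (s' * e * s) (s' * 0 + r' - s' * e * s * r)"
      unfolding orb_U[OF e] by blast
    have "s' * e * s = e" using D[OF g(1)] joint_acts_sign[OF g(1)] by auto
    then show "v \<in> tsch_param a x z e ` UNIV" using g(2) by auto
  next
    fix v assume "v \<in> tsch_param a x z e ` UNIV"
    then obtain t where "v = tsch_param a x z e t" by auto
    moreover have "e * e = 1" using e by auto
    \<comment> \<open>A translation by k on x alone changes t by - e * k, so k = - e * t leads from
      0 to t.\<close>
    ultimately show "v \<in> orb (tsch_param a x z e 0)"
      using orb_U_I[OF E_power[OF E, of "- (e * t)"] e, of e t 0] by (simp flip: mult.assoc)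
  qed
  have "factor_degrees (H a b) (mset (map card [tsch_param a x z 1 ` UNIV, tsch_param a x z (-1) ` UNIV]))"
  proof (rule factor_degrees_H)
    let ?As = "[tsch_param a x z 1 ` UNIV, tsch_param a x z (-1) ` UNIV]"
    show "\<Union>(set ?As) = roots_of (H a b)" unfolding roots_H_split by auto
    show "distinct ?As" by (simp add: tsch_param_image_eq)
    show "pairwise disjnt (set ?As)" by (auto simp: pairwise_insert tsch_param_image_disjnt)
    show "\<exists>u. A = orb u" if "A \<in> set ?As" for A
    proof -
      have "A = tsch_param a x z 1 ` UNIV \<or> A = tsch_param a x z (-1) ` UNIV" using that by simp
      then show ?thesis using o[of 1] o[of "-1"] by metis
    qed
  qed
  then show ?thesis by (simp add: card_U)
qed

text \<open>When both actions are given by the same affine maps, the bijections form S_3 under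
  conjugation: a translation t goes to s * t, and a rotation permutes the three reflections
  cyclically.\<close>

lemma diag_orb:
  assumes diag: "\<And>s r s' r'. (s, r, s', r') \<in> joint_acts \<Longrightarrow> s = s' \<and> r = r'"
  shows "orb (tsch_param a x z 1 t) = tsch_param a x z 1 ` {s * t |s r. (s, r) \<in> acts x}"
    and "rot x \<Longrightarrow> orb (tsch_param a x z (-1) 0) = tsch_param a x z (-1) ` UNIV"
proof -
  have g: "(s, r, s', r') \<in> joint_acts \<longleftrightarrow> s' = s \<and> r' = r \<and> (s, r) \<in> acts x" for s r s' r'
    using diag acts_x by blast
  have ss: "s * s = 1" if "(s, r) \<in> acts x" for s r using acts_sign[OF that] by auto
  show "orb (tsch_param a x z 1 t) = tsch_param a x z 1 ` {s * t |s r. (s, r) \<in> acts x}"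
  proof (intro equalityI subsetI)
    fix v assume "v \<in> orb (tsch_param a x z 1 t)"
    then obtain s r where sr: "(s, r) \<in> acts x" "v = tsch_param a x z (s * 1 * s) (s * t + r - s * 1 * s * r)"
      unfolding orb_U[of 1, simplified] g by auto
    then have "v = tsch_param a x z 1 (s * t)" using ss[OF sr(1)] by simp
    then show "v \<in> tsch_param a x z 1 ` {s * t |s r. (s, r) \<in> acts x}" using sr(1) by blast
  next
    fix v assume "v \<in> tsch_param a x z 1 ` {s * t |s r. (s, r) \<in> acts x}"
    then obtain s r where sr: "(s, r) \<in> acts x" "v = tsch_param a x z 1 (s * t)" by blast
    then have "(s, r, s, r) \<in> joint_acts" using g by blast
    from orb_U_I[OF this, of 1 1 "s * t" t] show "v \<in> orb (tsch_param a x z 1 t)"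
      using sr(2) ss[OF sr(1)] by simp
  qed
  assume rx: "rot x"
  show "orb (tsch_param a x z (-1) 0) = tsch_param a x z (-1) ` UNIV"
  proof (intro equalityI subsetI)
    fix v assume "v \<in> orb (tsch_param a x z (-1) 0)"
    then obtain s r where "(s, r) \<in> acts x" "v = tsch_param a x z (s * -1 * s) (s * 0 + r - s * -1 * s * r)"
      unfolding orb_U[of "-1", simplified] g by auto
    then show "v \<in> tsch_param a x z (-1) ` UNIV" using ss by auto
  next
    fix v assume "v \<in> tsch_param a x z (-1) ` UNIV"
    then obtain t where t: "v = tsch_param a x z (-1) t" by auto
    \<comment> \<open>Conjugation by the translation - t moves the offset 0 of a reflection to - 2 t
      = t.\<close>
    have "(1, -t, 1, -t) \<in> joint_acts" using rotD[OF rx] g by blast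
    from orb_U_I[OF this, of "-1" "-1" t 0] show "v \<in> orb (tsch_param a x z (-1) 0)"
      using three_cases[of t] by (auto simp: t)
  qed
qed

text \<open>Conjugation by all of S_3 has the orbits of the identity, the two 3-cycles and the three
  reflections; without odd elements the two 3-cycles are fixed separately.\<close>

lemma factor_diag:
  assumes diag: "\<And>s r s' r'. (s, r, s', r') \<in> joint_acts \<Longrightarrow> s = s' \<and> r = r'" and rx: "rot x"
  shows "odd_act x \<Longrightarrow> factor_degrees (H a b) {#1, 2, 3#}"
    and "\<not> odd_act x \<Longrightarrow> factor_degrees (H a b) {#1, 1, 1, 3#}"
proof -
  note o = diag_orb(1)[OF diag] and o' = diag_orb(2)[OF diag rx]
  have c: "card (tsch_param a x z 1 ` T) = card T" "card (tsch_param a x z (-1) ` T) = card T" for T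
    by (rule card_U, simp)+
  {
    assume odd: "odd_act x"
    let ?As = "[tsch_param a x z 1 ` {0}, tsch_param a x z 1 ` {1, -1}, tsch_param a x z (-1) ` UNIV]"
    have st: "{s * t |s r. (s, r) \<in> acts x} = {t, - t}" for t
      using odd acts_sign acts_id[of x] unfolding odd_act_def by force
    have "factor_degrees (H a b) (mset (map card ?As))"
    proof (rule factor_degrees_H)
      show "\<Union>(set ?As) = roots_of (H a b)" unfolding roots_H_split UNIV_three by auto
      show "pairwise disjnt (set ?As)" "distinct ?As"
        by (auto simp: pairwise_insert tsch_param_image_disjnt tsch_param_image_eq simp del: image_insert image_empty cong del: image_cong_simp)
      show "\<exists>u. A = orb u" if "A \<in> set ?As" for A
      proof -
        have "A = tsch_param a x z 1 ` {0} \<or> A = tsch_param a x z 1 ` {1, -1} \<or> A = tsch_param a x z (-1) ` UNIV" using that by simp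
        then show ?thesis using o[of 0] o[of 1] o' unfolding st by (metis insert_absorb2 neg_0_equal_iff_equal)
      qed
    qed
    then show "factor_degrees (H a b) {#1, 2, 3#}" by (simp only: list.map c) (simp add: eval_nat_numeral)
  next
    assume odd: "\<not> odd_act x"
    let ?As = "[tsch_param a x z 1 ` {0}, tsch_param a x z 1 ` {1}, tsch_param a x z 1 ` {-1}, tsch_param a x z (-1) ` UNIV]"
    have st: "{s * t |s r. (s, r) \<in> acts x} = {t}" for t
      using odd acts_sign acts_id[of x] unfolding odd_act_def by force
    have "factor_degrees (H a b) (mset (map card ?As))"
    proof (rule factor_degrees_H)
      show "\<Union>(set ?As) = roots_of (H a b)" unfolding roots_H_split UNIV_three by auto
      show "pairwise disjnt (set ?As)" "distinct ?As"
        by (auto simp: pairwise_insert tsch_param_image_disjnt tsch_param_image_eq simp del: image_insert image_empty cong del: image_cong_simp)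
      show "\<exists>u. A = orb u" if "A \<in> set ?As" for A
      proof -
        have "A = tsch_param a x z 1 ` {0} \<or> A = tsch_param a x z 1 ` {1} \<or> A = tsch_param a x z 1 ` {-1} \<or> A = tsch_param a x z (-1) ` UNIV"
          using that by simp
        then show ?thesis using o[of 0] o[of 1] o[of "-1"] o' unfolding st by metis
      qed
    qed
    then show "factor_degrees (H a b) {#1, 1, 1, 3#}" by (simp only: list.map c) (simp add: eval_nat_numeral)
  }
qed

end

section \<open>Equality of the splitting fields\<close>

text \<open>The Galois correspondence over \<open>spl g\<close>: automorphisms fixing this field act
  trivially on the roots of g, and \<open>fixed_spl\<close> puts the roots of f into it.\<close>

lemma spl_subset_iff:
  assumes x: "enumerates x f" and z: "enumerates z g" and f: "separable_poly f"
  shows "spl f \<subseteq> spl g \<longleftrightarrow> (\<forall>\<sigma> s r. aut base \<sigma> \<longrightarrow> act x \<sigma> s r \<longrightarrow> act z \<sigma> 1 0 \<longrightarrow> s = 1 \<and> r = 0)"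
proof
  assume sub: "spl f \<subseteq> spl g"
  show "\<forall>\<sigma> s r. aut base \<sigma> \<longrightarrow> act x \<sigma> s r \<longrightarrow> act z \<sigma> 1 0 \<longrightarrow> s = 1 \<and> r = 0"
  proof (intro allI impI)
    fix \<sigma> s r assume \<sigma>: "aut base \<sigma>" and ax: "act x \<sigma> s r" and az: "act z \<sigma> 1 0"
    have "\<sigma> (x i) = x i" for i
      using act_trivial_fixes_spl[OF z \<sigma> az] enumerates_in_spl[OF x] sub by blast
    then have "act x \<sigma> 1 0" by (simp add: act_def)
    then show "s = 1 \<and> r = 0" using act_unique[OF _ ax] x by (auto simp: enumerates_def)
  qed
next
  assume triv: "\<forall>\<sigma> s r. aut base \<sigma> \<longrightarrow> act x \<sigma> s r \<longrightarrow> act z \<sigma> 1 0 \<longrightarrow> s = 1 \<and> r = 0"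
  have "x i \<in> spl g" for i
  proof (rule fixed_spl[OF f spl_intermediate enumerates_in_spl[OF x]])
    fix \<sigma> assume s: "aut (spl g) \<sigma>"
    have \<sigma>: "aut base \<sigma>" using aut_to_base[OF s spl_intermediate] .
    obtain s r where ax: "act x \<sigma> s r" using act_exists[OF x \<sigma>] by blast
    have "act z \<sigma> 1 0" using s enumerates_in_spl[OF z] by (simp add: act_def aut_def)
    then have "s = 1 \<and> r = 0" using triv \<sigma> ax by blast
    then show "\<sigma> (x i) = x i" using ax by (simp add: act_def)
  qed
  then have "range x \<subseteq> spl g" by blast
  then have "roots_of f \<subseteq> spl g" using x by (simp only: enumerates_def)
  then show "spl f \<subseteq> spl g" by (rule spl_minimal[OF spl_intermediate])
qed

context two_cubics
begin

lemma La_subset: "La \<subseteq> Lb \<longleftrightarrow> (\<forall>s r. (s, r, 1, 0) \<in> joint_acts \<longrightarrow> s = 1 \<and> r = 0)"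
  unfolding spl_subset_iff[OF x z enumerates_separable[OF x]] joint_acts_def by blast

lemma Lb_subset: "Lb \<subseteq> La \<longleftrightarrow> (\<forall>s' r'. (1, 0, s', r') \<in> joint_acts \<longrightarrow> s' = 1 \<and> r' = 0)"
  unfolding spl_subset_iff[OF z x enumerates_separable[OF z]] joint_acts_def by blast

text \<open>Equivariance of i \<mapsto> e * i + t, by comparing slope and constant term in e * (s *
  i + r) + t = s' * (e * i + t) + r'.\<close>

definition equi :: "3 \<Rightarrow> 3 \<Rightarrow> bool" where
  "equi e t \<longleftrightarrow> (\<forall>s r s' r'. (s, r, s', r') \<in> joint_acts \<longrightarrow> s' = s \<and> s' * t + r' = e * r + t)"

lemma equi_imp_eq:
  assumes e: "e = 1 \<or> e = -1" and eq: "equi e t"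
  shows "La = Lb"
proof
  show "La \<subseteq> Lb" unfolding La_subset using eq e unfolding equi_def by fastforce
  show "Lb \<subseteq> La" unfolding Lb_subset using eq unfolding equi_def by fastforce
qed

text \<open>A form of Goursat's lemma: when no 3-cycle acts on x alone, the joint group is the graph
  of an isomorphism between the two actions, and this isomorphism is induced by an affine
  relabelling of the indices.\<close>

lemma rot_equi:
  assumes rx: "rot x" and nE: "(1, 1, 1, 0) \<notin> joint_acts"
  shows "\<exists>e t. (e = 1 \<or> e = -1) \<and> equi e t"
proof -
  obtain s1 r1 where g1: "(1, 1, s1, r1) \<in> joint_acts" using rx acts_x unfolding rot_def by blast
  \<comment> \<open>Otherwise the square of \<open>g1\<close> would be (1, -1, 1, 0), whose own
    square is the excluded element.\<close>
  have s1: "s1 = 1"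
  proof (rule ccontr)
    assume "s1 \<noteq> 1"
    then have "s1 = -1" using joint_acts_sign[OF g1] by auto
    then have "(1, -1, 1, 0) \<in> joint_acts" using joint_acts_comp[OF g1 g1] by simp
    from joint_acts_comp[OF this this] show False using nE by simp
  qed
  have e: "r1 = 1 \<or> r1 = -1" using three_cases[of r1] g1 nE s1 by auto
  \<comment> \<open>A rotation of z alone could cancel the z-part of \<open>g1\<close> and leave the
    excluded element.\<close>
  have no: "(1, 0, 1, d) \<in> joint_acts \<Longrightarrow> d = 0" for d
  proof (rule ccontr)
    assume d: "(1, 0, 1, d) \<in> joint_acts" "d \<noteq> 0"
    have "(1, 0, 1, - r1) \<in> joint_acts"
      using d e three_cases[of d] joint_acts_comp[OF d(1) d(1)] by auto
    from joint_acts_comp[OF g1 this] show False using nE s1 by simp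
  qed
  have pw: "(1, k, 1, r1 * k) \<in> joint_acts" for k
    using three_cases[of k] joint_acts_id g1 s1 joint_acts_inv[OF g1] by auto
  have even: "r' = r1 * r" if "(1, r, 1, r') \<in> joint_acts" for r r'
    using no[of "r' - r1 * r"] joint_acts_comp[OF that pw[of "-r"]] by simp
  have sgn: "s' = s" if g: "(s, r, s', r') \<in> joint_acts" for s r s' r'
  proof -
    have ss: "s * s = 1" "s' * s' = 1" using joint_acts_sign[OF g] by auto
    \<comment> \<open>Conjugation multiplies the two translations of \<open>g1\<close> by s and s'.
      By \<open>even\<close> their ratio is still r1, so the signs agree.\<close>
    have "(1, s, 1, s' * r1) \<in> joint_acts"
      using joint_acts_comp[OF joint_acts_comp[OF g g1] joint_acts_inv[OF g]] s1 ss
      by (simp add: algebra_simps flip: mult.assoc)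
    from even[OF this] show ?thesis using e by auto
  qed
  show "\<exists>e t. (e = 1 \<or> e = -1) \<and> equi e t"
  proof (cases "odd_act x")
    case True
    then obtain r0 s0 r0' where g0: "(-1, r0, s0, r0') \<in> joint_acts" using acts_x unfolding odd_act_def by blast
    then have s0: "s0 = -1" using sgn by blast
    \<comment> \<open>The offset t solves the condition of \<open>equi\<close> for the chosen odd
      element, - t + r0' = r1 * r0 + t, where 2 t = - t.\<close>
    have "s' = s \<and> s' * (r1 * r0 - r0') + r' = r1 * r + (r1 * r0 - r0')" if g: "(s, r, s', r') \<in> joint_acts" for s r s' r'
    proof (cases "s = 1")
      case True
      then show ?thesis using even[of r r'] sgn[OF g] g by auto
    next
      case False
      then have s: "s = -1" "s' = -1" using joint_acts_sign[OF g] sgn[OF g] by auto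
      from joint_acts_comp[OF g g0] have "(1, r - r0, 1, r' - r0') \<in> joint_acts" using s s0 by simp
      from even[OF this] have r': "r' = r1 * (r - r0) + r0'" by (simp add: diff_eq_eq)
      show ?thesis using s e three_cases[of r] three_cases[of r0] three_cases[of r0'] unfolding r' by auto
    qed
    then show ?thesis using e unfolding equi_def by blast
  next
    case False
    then have "s = 1" if "(s, r, s', r') \<in> joint_acts" for s r s' r'
      using joint_acts_sign[OF that] acts_x that unfolding odd_act_def by blast
    then have "equi r1 0" unfolding equi_def using sgn even by fastforce
    then show ?thesis using e by blast
  qed
qed

text \<open>The first cubic may be reducible here, so \<open>rot x\<close> can fail. In that case
  the joint group has order at most 2 and matching its odd elements suffices.\<close>

lemma eq_imp_equi:
  assumes eq: "La = Lb"
  shows "\<exists>e t. (e = 1 \<or> e = -1) \<and> equi e t"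
proof (cases "rot x")
  case True
  have "(1, 1, 1, 0) \<notin> joint_acts" using eq La_subset by force
  then show ?thesis using rot_equi[OF True] by blast
next
  case False
  have gr: "(s, r, 1, 0) \<in> joint_acts \<Longrightarrow> s = 1 \<and> r = 0" "(1, 0, s, r) \<in> joint_acts \<Longrightarrow> s = 1 \<and> r = 0" for s r
    using eq La_subset Lb_subset by auto
  have even: "s' = 1 \<and> r = 0 \<and> r' = 0" if g: "(1, r, s', r') \<in> joint_acts" for r s' r'
  proof -
    have "(1, r) \<in> acts x" unfolding acts_x using g by blast
    then have "r = 0" using False rotI by blast
    then show ?thesis using g gr(2)[of s' r'] by simp
  qed
  have odd: "s' = -1" if g: "(-1, r, s', r') \<in> joint_acts" for r s' r'
  proof (rule ccontr)
    assume "s' \<noteq> -1"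
    then have s': "s' = 1" using joint_acts_sign[OF g] by auto
    \<comment> \<open>The square of \<open>g\<close> acts on z alone, so it is trivial and r' = 0;
      then \<open>g\<close> itself would act on x alone.\<close>
    then have "(1, 0, 1, r' + r') \<in> joint_acts" using joint_acts_comp[OF g g] by simp
    then have "r' + r' = 0" using gr(2) by blast
    then have "r' = 0" using three_cases[of r'] by auto
    then show False using gr(1)[of "-1" r] g s' by simp
  qed
  show ?thesis
  proof (cases "odd_act x")
    case True
    then obtain r0 s0 r0' where g0: "(-1, r0, s0, r0') \<in> joint_acts" using acts_x unfolding odd_act_def by blast
    then have s0: "s0 = -1" using odd by blast
    have "s' = s \<and> s' * (r0 - r0') + r' = 1 * r + (r0 - r0')" if g: "(s, r, s', r') \<in> joint_acts" for s r s' r'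
    proof (cases "s = 1")
      case True
      then show ?thesis using even[of r s' r'] g by auto
    next
      case False
      then have s: "s = -1" using joint_acts_sign[OF g] by auto
      then have s': "s' = -1" using odd g by blast
      from joint_acts_comp[OF g g0] have "(1, r - r0, 1, r' - r0') \<in> joint_acts" using s s' s0 by simp
      from even[OF this] have "r = r0" "r' = r0'" by auto
      then show ?thesis using s s' three_cases[of r] three_cases[of r0] three_cases[of r0'] by auto
    qed
    then show ?thesis unfolding equi_def by blast
  next
    case False
    then have "s = 1" if "(s, r, s', r') \<in> joint_acts" for s r s' r'
      using joint_acts_sign[OF that] acts_x that unfolding odd_act_def by blast
    then have "equi 1 0" unfolding equi_def using even by fastforce
    then show ?thesis by blast
  qed
qed

text \<open>By separability of \<open>H\<close>, a parameter lies in M iff all automorphisms fix it;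
  \<open>aut_U\<close> and injectivity of the parameters turn this into invariance of the
  bijection.\<close>

lemma equi_fixed:
  assumes e: "e = 1 \<or> e = -1"
  shows "equi e t \<longleftrightarrow> tsch_param a x z e t \<in> base"
proof
  assume eq: "equi e t"
  have fixed: "\<sigma> (tsch_param a x z e t) = tsch_param a x z e t" if \<sigma>: "aut base \<sigma>" for \<sigma>
  proof -
    obtain s r s' r' where g: "act x \<sigma> s r" "act z \<sigma> s' r'" "(s, r, s', r') \<in> joint_acts" using joint_acts_exists[OF \<sigma>] .
    have "s' = s" "s' * t + r' = e * r + t" using eq g(3) unfolding equi_def by auto
    moreover have "s * e * s = e" using joint_acts_sign[OF g(3)] by auto
    ultimately show ?thesis using aut_U[OF \<sigma> g(1,2) e, of t] by (simp add: algebra_simps)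
  qed
  have "separable_over base (tsch_param a x z e t)"
    using separable_poly_sep[OF H_separable] tsch_param_in_roots[OF e] by simp
  then show "tsch_param a x z e t \<in> base"
    by (rule fixed_adjoin[OF intermediate_base]) (simp_all only: adjoin_supset(2)[OF intermediate_base] fixed)
next
  assume "tsch_param a x z e t \<in> base"
  then obtain u where u: "tsch_param a x z e t = to_ac u" by auto
  show "equi e t" unfolding equi_def
  proof (intro allI impI)
    fix s r s' r' assume g: "(s, r, s', r') \<in> joint_acts"
    then obtain \<sigma> where \<sigma>: "aut base \<sigma>" "act x \<sigma> s r" "act z \<sigma> s' r'" by (auto simp: joint_acts_def)
    have "\<sigma> (tsch_param a x z e t) = tsch_param a x z e t" unfolding u using aut_closed(3)[OF \<sigma>(1) intermediate_base] .
    then have eq: "tsch_param a x z (s' * e * s) (s' * t + r' - s' * e * s * r) = tsch_param a x z e t"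
      using aut_U[OF \<sigma> e] by simp
    have "s' * e * s = 1 \<or> s' * e * s = -1" using joint_acts_sign[OF g] e by auto
    from tsch_param_inj[OF this e eq] have *: "s' * e * s = e" "s' * t + r' - s' * e * s * r = t" by auto
    have "s' = s" using *(1) joint_acts_sign[OF g] e by auto
    then show "s' = s \<and> s' * t + r' = e * r + t" using * by (simp add: diff_eq_eq add.commute)
  qed
qed

lemma H_den_to_ac: "H_den (to_ac a) (to_ac u) = to_ac (H_den a u)" and H_num_to_ac: "H_num (to_ac a) (to_ac u) = to_ac (H_num a u)"
  by (simp_all add: H_den_def H_num_def)

text \<open>An equivariant bijection has its parameter u in M, and u solves the equation of
  \<open>H\<close> with nonzero \<open>H_den\<close>. Conversely such a u is a root of
  \<open>H\<close> in M, so it belongs to a bijection, which is equivariant.\<close>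

lemma eq_iff_param:
  "La = Lb \<longleftrightarrow> (\<exists>u. H_den a u \<noteq> 0 \<and> b = a * H_num a u ^ 3 / H_den a u ^ 2)"
proof
  assume "La = Lb"
  then obtain e t where e: "e = 1 \<or> e = -1" and "equi e t" using eq_imp_equi by blast
  then obtain u where u: "tsch_param a x z e t = to_ac u" using equi_fixed by auto
  note r = tsch_rel_scale[OF x enumerates_affine[OF z e, of t] b0 tsch_param_rel[OF e, of t], unfolded u H_den_to_ac H_num_to_ac]
  have "to_ac (b * H_den a u ^ 2) = to_ac (a * H_num a u ^ 3)" using r(3) by simp
  then have "b * H_den a u ^ 2 = a * H_num a u ^ 3" by (simp only: to_ac_eq_iff)
  moreover have "H_den a u \<noteq> 0" using r(1) by simp
  ultimately show "\<exists>u. H_den a u \<noteq> 0 \<and> b = a * H_num a u ^ 3 / H_den a u ^ 2"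
    by (intro exI[of _ u]) (simp add: field_simps)
next
  assume "\<exists>u. H_den a u \<noteq> 0 \<and> b = a * H_num a u ^ 3 / H_den a u ^ 2"
  then obtain u where d: "H_den a u \<noteq> 0" and b: "b = a * H_num a u ^ 3 / H_den a u ^ 2" by blast
  have "b * H_den a u ^ 2 = a * H_num a u ^ 3" using d b by simp
  then have "poly (map_poly to_ac (H a b)) (to_ac u) = 0"
    unfolding poly_H H_den_to_ac H_num_to_ac by (simp flip: to_ac_power to_ac_mult)
  then obtain e t where e: "e = 1 \<or> e = -1" and u: "to_ac u = tsch_param a x z e t"
    using roots_H by blast
  then have "equi e t" unfolding equi_fixed[OF e] by (metis rangeI)
  then show "La = Lb" by (rule equi_imp_eq[OF e])
qed

text \<open>Relabelling the roots of the second cubic along the equivariant bijection makes the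
  joint action diagonal; \<open>H\<close> does not depend on the labelling.\<close>

lemma factor_equi:
  assumes rx: "rot x" and eq: "La = Lb"
  shows "odd_act x \<Longrightarrow> factor_degrees (H a b) {#1, 2, 3#}"
    and "\<not> odd_act x \<Longrightarrow> factor_degrees (H a b) {#1, 1, 1, 3#}"
proof -
  obtain e t where e: "e = 1 \<or> e = -1" and equi: "equi e t" using eq_imp_equi[OF eq] by blast
  define z' where "z' = (\<lambda>i. z (e * i + t))"
  have z': "enumerates z' (cubic b)" unfolding z'_def by (rule enumerates_affine[OF z e])
  interpret T: two_cubics a b x z' by unfold_locales (fact x z' ab b0)+
  have "s = s' \<and> r = r'" if g: "(s, r, s', r') \<in> T.joint_acts" for s r s' r'
  proof -
    obtain \<sigma> where \<sigma>: "aut base \<sigma>" "act x \<sigma> s r" "act z' \<sigma> s' r'" using g by (auto simp: T.joint_acts_def)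
    obtain p q where pq: "act z \<sigma> p q" using act_exists[OF z \<sigma>(1)] by blast
    then have "(s, r, p, q) \<in> joint_acts" using \<sigma> by (auto simp: joint_acts_def)
    then have h: "p = s" "p * t + q = e * r + t" using equi unfolding equi_def by auto
    have "\<sigma> (z' i) = z' (s * i + r)" for i
    proof -
      have "\<sigma> (z' i) = z (p * (e * i + t) + q)" using pq by (simp add: z'_def act_def)
      also have "p * (e * i + t) + q = e * (s * i + r) + t"
        using h(2) by (simp add: h(1) algebra_simps)
      finally show ?thesis by (simp add: z'_def)
    qed
    then have "act z' \<sigma> s r" using \<sigma>(2) by (simp add: act_def)
    then show ?thesis using act_unique[OF _ \<sigma>(3)] z' by (auto simp: enumerates_def)
  qed
  from T.factor_diag[OF this rx]
  show "odd_act x \<Longrightarrow> factor_degrees (H a b) {#1, 2, 3#}"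
    and "\<not> odd_act x \<Longrightarrow> factor_degrees (H a b) {#1, 1, 1, 3#}" by blast+
qed

end

section \<open>The intersection of the splitting fields\<close>

lemma subfield_base: "subfield (base :: 'm::field alg_closure set) ring_of_type_algebra"
  using intermediate_base subfield_intermediate by blast

lemma dimension_one_base: "ring.dimension ring_of_type_algebra 1 base (base :: 'm::field alg_closure set)"
proof -
  interpret F: field "ring_of_type_algebra :: 'm alg_closure ring" by (rule field_from_type_algebra)
  show ?thesis by (rule F.dimension_one[OF subfield_base])
qed

lemma base_dimension_ne_2: "\<not> ring.dimension ring_of_type_algebra 2 base (base :: 'm::field alg_closure set)"
proof
  interpret F: field "ring_of_type_algebra :: 'm alg_closure ring" by (rule field_from_type_algebra)
  assume "F.dimension 2 base base"
  from F.dimension_is_inj[OF subfield_base this dimension_one_base] show False by simp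
qed

lemma line_extension_iff:
  "u \<in> ring.line_extension ring_of_type_algebra base v E \<longleftrightarrow> (\<exists>k. \<exists>w\<in>E. u = to_ac k * v + w)"
  for u v :: "'m::field alg_closure"
proof -
  interpret F: field "ring_of_type_algebra :: 'm alg_closure ring" by (rule field_from_type_algebra)
  show ?thesis unfolding F.line_extension_mem_iff by (auto simp: ring_of_type_algebra_def)
qed

lemma dimension_2I:
  fixes \<beta> :: "'m::field alg_closure"
  assumes "\<beta> \<notin> base" and S: "S = {to_ac k * \<beta> + to_ac l |k l. True}"
  shows "ring.dimension ring_of_type_algebra 2 base S"
proof -
  interpret F: field "ring_of_type_algebra :: 'm alg_closure ring" by (rule field_from_type_algebra)
  have "F.line_extension base \<beta> base = S" unfolding S by (fastforce simp: line_extension_iff)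
  moreover have "F.dimension (Suc 1) base (F.line_extension base \<beta> base)"
    using assms(1) dimension_one_base by (intro F.Suc_dim) (simp add: ring_of_type_algebra_def)
  ultimately show ?thesis by (simp add: numeral_2_eq_2)
qed

text \<open>Rotations carry x 0 to all three roots, so no nonzero polynomial over M of degree below
  3 vanishes at x 0, and 1, x 0, x 0^2 are independent. This separates equality of the fields from
  an intersection of degree 2.\<close>

lemma rot_dimension_ne_2:
  fixes a :: "'m::field"
  assumes x: "enumerates x (cubic a)" and rx: "rot x"
  shows "\<not> ring.dimension ring_of_type_algebra 2 base (spl (cubic a))"
proof
  interpret F: field "ring_of_type_algebra :: 'm alg_closure ring" by (rule field_from_type_algebra)
  assume dim: "F.dimension 2 base (spl (cubic a))"
  have no_root: False if p: "p \<in> polys base" "p \<noteq> 0" "Polynomial.degree p < 3" "poly p (x 0) = 0" for p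
  proof -
    have "poly p (x i) = 0" for i
    proof -
      obtain \<sigma> where \<sigma>: "aut base \<sigma>" "act x \<sigma> 1 i" using rotD[OF rx, of i] by (auto simp: acts_def)
      have "\<sigma> (x 0) = x i" using \<sigma>(2) by (simp add: act_def)
      then show ?thesis
        using aut_poly[OF \<sigma>(1) intermediate_base p(1), of "x 0"] p(4) aut_closed(4)[OF \<sigma>(1) intermediate_base] by simp
    qed
    then have "range x \<subseteq> {v. poly p v = 0}" by auto
    then have "card (range x) \<le> card {v. poly p v = 0}" using p(2) by (intro card_mono poly_roots_finite)
    also have "\<dots> \<le> Polynomial.degree p" by (rule card_poly_roots_bound[OF p(2)])
    also have "card (range x) = CARD(3)" using x unfolding enumerates_def by (intro card_image) blast
    finally show False using p(3) by simp
  qed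
  note L = intermediate_closed[OF spl_intermediate[of "cubic a"]]
  have x0: "x 0 \<in> spl (cubic a)" by (rule enumerates_in_spl[OF x])
  note b = intermediate_closed[OF intermediate_base] intermediate_polys[OF intermediate_base]
  have "F.Span base [1] = base"
    by (auto simp: line_extension_iff) (auto simp: ring_of_type_algebra_def)
  have span: "v \<in> F.Span base [x 0, 1] \<longleftrightarrow> (\<exists>k l. v = to_ac k * x 0 + to_ac l)" for v
  proof -
    have "F.Span base [x 0, 1] = F.line_extension base (x 0) (F.Span base [1])" by simp
    then show ?thesis unfolding \<open>F.Span base [1] = base\<close> by (auto simp: line_extension_iff)
  qed
  have "F.independent base [x 0 ^ 2, x 0, 1]"
  proof (intro F.li_Cons F.li_Nil)
    have "F.Span base [] = {0}" by simp (simp add: ring_of_type_algebra_def)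
    then show "(1 :: 'm alg_closure) \<notin> F.Span base []" by simp
    show "x 0 \<notin> F.Span base [1]"
    proof
      assume "x 0 \<in> F.Span base [1]"
      then obtain k where "x 0 = to_ac k" using \<open>F.Span base [1] = base\<close> by auto
      then show False by (intro no_root[of "[:- to_ac k, 1:]"]) (auto intro!: b)
    qed
    show "x 0 ^ 2 \<notin> F.Span base [x 0, 1]"
    proof
      assume "x 0 ^ 2 \<in> F.Span base [x 0, 1]"
      then obtain k l where "x 0 ^ 2 = to_ac k * x 0 + to_ac l" unfolding span by blast
      then show False
        by (intro no_root[of "[:- to_ac l, - to_ac k, 1:]"])
          (auto intro!: b simp: algebra_simps power2_eq_square)
    qed
  qed (auto simp: ring_of_type_algebra_def)
  from F.independent_length_le_dimension[OF subfield_base dim this] show False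
    using x0 L by simp
qed

context two_cubics
begin

text \<open>On the first splitting field \<sigma> agrees with an automorphism that is trivial on z,
  and the latter fixes the second splitting field.\<close>

lemma even_fixes:
  assumes E: "(1, 1, 1, 0) \<in> joint_acts" and \<sigma>: "aut base \<sigma>" "act x \<sigma> 1 r" and u: "u \<in> La" "u \<in> Lb"
  shows "\<sigma> u = u"
proof -
  obtain \<tau> where \<tau>: "aut base \<tau>" "act x \<tau> 1 r" "act z \<tau> 1 0"
    using E_power[OF E, of r] by (auto simp: joint_acts_def)
  have "\<sigma> v = \<tau> v" if v: "v \<in> roots_of (cubic a)" for v
  proof -
    obtain i where "v = x i" using v x unfolding enumerates_def by (metis rangeE)
    then show ?thesis using \<sigma>(2) \<tau>(2) by (simp add: act_def)
  qed
  then have "\<sigma> u = \<tau> u" using aut_agree_spl[OF \<sigma>(1) \<tau>(1) _ u(1)] by blast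
  also have "\<dots> = u" by (rule act_trivial_fixes_spl[OF z \<tau>(1,3) u(2)])
  finally show ?thesis .
qed

lemma base_subset_inter: "base \<subseteq> La \<inter> Lb"
  using intermediate_closed(1)[OF spl_intermediate] by blast

lemma inter_fixed_base:
  assumes "u \<in> La" "\<And>\<sigma>. aut base \<sigma> \<Longrightarrow> \<sigma> u = u" shows "u \<in> base"
  by (rule fixed_spl[OF enumerates_separable[OF x] intermediate_base]) (use assms in auto)

text \<open>The hypotheses realise every action on x by automorphisms that are trivial on z, so a
  common element of the two fields is fixed by everything.\<close>

lemma inter_eq_base:
  assumes E: "(1, 1, 1, 0) \<in> joint_acts" and o: "\<not> odd_act x \<or> (-1, r0, 1, r0') \<in> joint_acts"
  shows "La \<inter> Lb = base"
proof
  show "La \<inter> Lb \<subseteq> base"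
  proof
    fix u assume "u \<in> La \<inter> Lb"
    then have u: "u \<in> La" "u \<in> Lb" by auto
    show "u \<in> base"
    proof (rule inter_fixed_base[OF u(1)])
      fix \<sigma> :: "'m alg_closure \<Rightarrow> 'm alg_closure" assume \<sigma>: "aut base \<sigma>"
      obtain s r where a: "act x \<sigma> s r" using act_exists[OF x \<sigma>] by blast
      show "\<sigma> u = u"
      proof (cases "s = 1")
        case True
        then show ?thesis using even_fixes[OF E \<sigma> _ u] a by blast
      next
        case False
        then have s: "s = -1" using act_sign[OF a] by auto
        then have "odd_act x" using a \<sigma> unfolding odd_act_def acts_def by blast
        then have g: "(-1, r0, 1, r0') \<in> joint_acts" using o by blast
        \<comment> \<open>The cube of \<open>g\<close>: its involution on x survives, while its
          translation on z is killed.\<close>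
        have "(-1, r0, 1, 0) \<in> joint_acts"
          using joint_acts_comp[OF joint_acts_comp[OF g g] g] three_cases[of r0'] by auto
        then obtain \<tau> where \<tau>: "aut base \<tau>" "act x \<tau> (-1) r0" "act z \<tau> 1 0" by (auto simp: joint_acts_def)
        have tu: "\<tau> u = u" by (rule act_trivial_fixes_spl[OF z \<tau>(1,3) u(2)])
        have "act x (\<sigma> \<circ> \<tau>) 1 (s * r0 + r)" using act_comp[OF a \<tau>(2)] s by simp
        from even_fixes[OF E aut_comp[OF \<sigma> \<tau>(1)] this u] show ?thesis by (simp add: tu)
      qed
    qed
  qed
qed (rule base_subset_inter)

text \<open>
  Adjoining the element \<open>\<beta>\<close> below to \<open>M\<close> gives the quadratic resolvent field in every characteristic,
  including 2, where the square root of the discriminant does not.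
\<close>

lemma inter_dimension:
  assumes E: "(1, 1, 1, 0) \<in> joint_acts" and D: "\<And>s r s' r'. (s, r, s', r') \<in> joint_acts \<Longrightarrow> s = s'" and o: "odd_act x"
  shows "ring.dimension ring_of_type_algebra 2 base (La \<inter> Lb)"
proof -
  obtain \<tau> r0 where \<tau>: "aut base \<tau>" "act x \<tau> (-1) r0" using o by (auto simp: odd_act_def acts_def)
  define \<beta> where "\<beta> = x 0 ^ 2 * x 1 + x 1 ^ 2 * x (-1) + x (-1) ^ 2 * x 0"
  note xL = enumerates_in_spl[OF x] and L = intermediate_closed[OF spl_intermediate[of "cubic a"]]
    and L' = intermediate_closed[OF spl_intermediate[of "cubic b"]]
  have \<beta>L: "\<beta> \<in> La" unfolding \<beta>_def by (intro L xL)
  have \<sigma>\<beta>: "\<sigma> \<beta> = \<sigma> (x 0) ^ 2 * \<sigma> (x 1) + \<sigma> (x 1) ^ 2 * \<sigma> (x (-1)) + \<sigma> (x (-1)) ^ 2 * \<sigma> (x 0)"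
    if "aut base \<sigma>" for \<sigma> unfolding \<beta>_def aut_closed[OF that intermediate_base] ..
  have even\<beta>: "\<sigma> \<beta> = \<beta>" if \<sigma>: "aut base \<sigma>" "act x \<sigma> 1 r" for \<sigma> r
  proof -
    have "\<sigma> (x i) = x (i + r)" for i using \<sigma>(2) by (simp add: act_def)
    then show ?thesis unfolding \<sigma>\<beta>[OF \<sigma>(1)] using three_cases[of r] by (auto simp: \<beta>_def)
  qed
  \<comment> \<open>An automorphism fixing the second field is trivial on z, hence even on x by
    agreement of signs, and even permutations preserve \<beta>.\<close>
  have \<beta>L': "\<beta> \<in> Lb"
  proof (rule fixed_spl[OF enumerates_separable[OF x] spl_intermediate \<beta>L])
    fix \<sigma> assume s: "aut Lb \<sigma>"
    have \<sigma>: "aut base \<sigma>" using aut_to_base[OF s spl_intermediate] .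
    have az: "act z \<sigma> 1 0" using s enumerates_in_spl[OF z] by (simp add: act_def aut_def)
    obtain s r where a: "act x \<sigma> s r" using act_exists[OF x \<sigma>] by blast
    then have "(s, r, 1, 0) \<in> joint_acts" using \<sigma> az by (auto simp: joint_acts_def)
    then have "s = 1" using D by blast
    then show "\<sigma> \<beta> = \<beta>" using even\<beta>[OF \<sigma>] a by blast
  qed
  have "\<tau> \<beta> = x r0 ^ 2 * x (r0 - 1) + x (r0 - 1) ^ 2 * x (r0 + 1) + x (r0 + 1) ^ 2 * x r0"
    unfolding \<sigma>\<beta>[OF \<tau>(1)] using \<tau>(2) by (simp add: act_def algebra_simps)
  also have "\<dots> = x 0 ^ 2 * x (-1) + x (-1) ^ 2 * x 1 + x 1 ^ 2 * x 0"
    using three_cases[of r0] by auto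
  finally have "\<beta> - \<tau> \<beta> = (x 0 - x 1) * (x 1 - x (-1)) * (x 0 - x (-1))"
    by (simp add: \<beta>_def algebra_simps power2_eq_square)
  moreover have "x 0 \<noteq> x 1" "x 1 \<noteq> x (-1)" "x 0 \<noteq> x (-1)"
    using x by (auto simp: enumerates_def inj_eq)
  ultimately have \<beta>ne: "\<beta> - \<tau> \<beta> \<noteq> 0" by simp
  have "\<beta> \<notin> base" using \<beta>ne aut_closed(3)[OF \<tau>(1) intermediate_base] by auto
  moreover have "La \<inter> Lb = {to_ac k * \<beta> + to_ac l |k l. True}"
  proof (intro equalityI subsetI)
    fix u assume "u \<in> {to_ac k * \<beta> + to_ac l |k l. True}"
    then show "u \<in> La \<inter> Lb" using \<beta>L \<beta>L' L L' by auto
  next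
    fix u assume "u \<in> La \<inter> Lb"
    then have u: "u \<in> La" "u \<in> Lb" by auto
    have \<tau>im: "\<tau> v \<in> spl f" if "v \<in> spl f" for v f using aut_image_spl[OF \<tau>(1)] that by blast
    have even: "\<sigma> v = v" if "aut base \<sigma>" "act x \<sigma> 1 r" "v \<in> La" "v \<in> Lb" for \<sigma> r v
      using even_fixes[OF E that] .
    have odd: "\<sigma> v = \<tau> v" "\<sigma> (\<tau> v) = v" if \<sigma>: "aut base \<sigma>" "act x \<sigma> (-1) r" and v: "v \<in> La" "v \<in> Lb" for \<sigma> r v
    proof -
      have "act x (\<sigma> \<circ> \<tau>) 1 (- 1 * r0 + r)" using act_comp[OF \<sigma>(2) \<tau>(2)] by simp
      from even[OF aut_comp[OF \<sigma>(1) \<tau>(1)] this v] show "\<sigma> (\<tau> v) = v" by simp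
      have "act x (inv' \<tau>) (-1) (- (-1 * r0))" by (rule act_inv[OF aut_bij[OF \<tau>(1)] \<tau>(2)])
      from act_comp[OF this \<sigma>(2)] have "act x (inv' \<tau> \<circ> \<sigma>) 1 (- 1 * r + - (-1 * r0))" by simp
      from even[OF aut_comp[OF aut_inv[OF \<tau>(1) intermediate_base] \<sigma>(1)] this v]
      have "inv' \<tau> (\<sigma> v) = v" by simp
      then show "\<sigma> v = \<tau> v" using aut_bij[OF \<tau>(1)] by (metis bij_inv_eq_iff)
    qed
    \<comment> \<open>If u = t \<beta> + l with t and l in M, then applying \<tau> and subtracting
      gives this t. Numerator and denominator are fixed by even elements and negated by odd ones, so
      t is invariant.\<close>
    define t where "t = (u - \<tau> u) / (\<beta> - \<tau> \<beta>)"
    have t: "t \<in> base"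
    proof (rule inter_fixed_base)
      show "t \<in> La" unfolding t_def by (intro L u \<beta>L \<tau>im)
      fix \<sigma> :: "'m alg_closure \<Rightarrow> 'm alg_closure" assume \<sigma>: "aut base \<sigma>"
      obtain s r where a: "act x \<sigma> s r" using act_exists[OF x \<sigma>] by blast
      show "\<sigma> t = t"
      proof (cases "s = 1")
        case True
        have "\<sigma> u = u" "\<sigma> \<beta> = \<beta>" "\<sigma> (\<tau> u) = \<tau> u" "\<sigma> (\<tau> \<beta>) = \<tau> \<beta>"
          using even[OF \<sigma> a[unfolded True]] u \<beta>L \<beta>L' \<tau>im by auto
        then show ?thesis by (simp add: t_def aut_closed[OF \<sigma> intermediate_base])
      next
        case False
        then have s: "s = -1" using act_sign[OF a] by auto
        have "\<sigma> u = \<tau> u" "\<sigma> \<beta> = \<tau> \<beta>" "\<sigma> (\<tau> u) = u" "\<sigma> (\<tau> \<beta>) = \<beta>"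
          using odd[OF \<sigma> a[unfolded s]] u \<beta>L \<beta>L' by auto
        moreover have "(\<tau> u - u) / (\<tau> \<beta> - \<beta>) = (u - \<tau> u) / (\<beta> - \<tau> \<beta>)"
          by (metis minus_diff_eq minus_divide_divide)
        ultimately show ?thesis by (simp add: t_def aut_closed[OF \<sigma> intermediate_base])
      qed
    qed
    define l where "l = u - t * \<beta>"
    have \<sigma>t: "\<sigma> t = t" if "aut base \<sigma>" for \<sigma> using t aut_closed(3)[OF that intermediate_base] by auto
    have l: "l \<in> base"
    proof (rule inter_fixed_base)
      have "t \<in> La" using t L(1) by auto
      then show "l \<in> La" unfolding l_def by (intro L u \<beta>L)
      fix \<sigma> :: "'m alg_closure \<Rightarrow> 'm alg_closure" assume \<sigma>: "aut base \<sigma>"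
      obtain s r where a: "act x \<sigma> s r" using act_exists[OF x \<sigma>] by blast
      show "\<sigma> l = l"
      proof (cases "s = 1")
        case True
        have "\<sigma> u = u" "\<sigma> \<beta> = \<beta>" using even[OF \<sigma> a[unfolded True]] u \<beta>L \<beta>L' by auto
        then show ?thesis by (simp add: l_def aut_closed[OF \<sigma> intermediate_base] \<sigma>t[OF \<sigma>])
      next
        case False
        then have s: "s = -1" using act_sign[OF a] by auto
        have "\<sigma> u = \<tau> u" "\<sigma> \<beta> = \<tau> \<beta>" using odd[OF \<sigma> a[unfolded s]] u \<beta>L \<beta>L' by auto
        moreover have "t * (\<beta> - \<tau> \<beta>) = u - \<tau> u" using \<beta>ne by (simp add: t_def)
        then have "\<tau> u - t * \<tau> \<beta> = u - t * \<beta>" by (simp add: algebra_simps)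
        ultimately show ?thesis by (simp add: l_def aut_closed[OF \<sigma> intermediate_base] \<sigma>t[OF \<sigma>])
      qed
    qed
    have "u = t * \<beta> + l" by (simp add: l_def)
    then show "u \<in> {to_ac k * \<beta> + to_ac l |k l. True}" using t l by blast
  qed
  ultimately show ?thesis by (rule dimension_2I)
qed

text \<open>The sign pairs form a group; if it is not contained in the diagonal but contains a pair
  with s = -1, then it contains (-1, 1).\<close>

lemma odd_even_exists:
  assumes D: "(s, r, s', r') \<in> joint_acts" "s \<noteq> s'" and o: "odd_act x"
  shows "\<exists>r r'. (-1, r, 1, r') \<in> joint_acts"
proof (cases "s = -1")
  case True
  then show ?thesis using D joint_acts_sign[OF D(1)] by auto
next
  case False
  then have s: "s = 1" "s' = -1" using D joint_acts_sign[OF D(1)] by auto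
  obtain q p' q' where g: "(-1, q, p', q') \<in> joint_acts" using o unfolding odd_act_def acts_x by blast
  consider "p' = 1" | "p' = -1" using joint_acts_sign[OF g] by blast
  then show ?thesis
  proof cases
    case 2
    from joint_acts_comp[OF D(1) g] have "(-1, q + r, 1, r' - q') \<in> joint_acts" by (simp add: 2 s)
    then show ?thesis by blast
  qed (use g in blast)
qed

lemma even_odd_exists:
  assumes D: "(s, r, s', r') \<in> joint_acts" "s \<noteq> s'" and o: "odd_act z"
  shows "\<exists>r r'. (1, r, -1, r') \<in> joint_acts"
proof (cases "s' = -1")
  case True
  then show ?thesis using D joint_acts_sign[OF D(1)] by auto
next
  case False
  then have s: "s = -1" "s' = 1" using D joint_acts_sign[OF D(1)] by auto
  obtain p q q' where g: "(p, q, -1, q') \<in> joint_acts" using o unfolding odd_act_def acts_z by blast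
  consider "p = 1" | "p = -1" using joint_acts_sign[OF g] by blast
  then show ?thesis
  proof cases
    case 2
    from joint_acts_comp[OF D(1) g] have "(1, r - q, -1, q' + r') \<in> joint_acts" by (simp add: 2 s)
    then show ?thesis by blast
  qed (use g in blast)
qed

text \<open>A 3-cycle on x alone moves \<open>La\<close> while fixing \<open>Lb\<close>; its absence
  yields an equivariant bijection.\<close>

lemma eq_iff_not_E: "rot x \<Longrightarrow> La = Lb \<longleftrightarrow> (1, 1, 1, 0) \<notin> joint_acts"
  using rot_equi equi_imp_eq La_subset by fastforce

lemma Lb_subset_iff:
  assumes "\<not> rot z" "odd_act z"
  shows "Lb \<subseteq> La \<longleftrightarrow> (\<forall>s r s' r'. (s, r, s', r') \<in> joint_acts \<longrightarrow> s = s')"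
proof
  assume sub: "Lb \<subseteq> La"
  show "\<forall>s r s' r'. (s, r, s', r') \<in> joint_acts \<longrightarrow> s = s'"
  proof (rule ccontr)
    assume "\<not> ?thesis"
    then obtain r r' where g: "(1, r, -1, r') \<in> joint_acts" using even_odd_exists[OF _ _ assms(2)] by blast
    \<comment> \<open>The cube of \<open>g\<close> keeps the reflection of z and kills the
      translation of x.\<close>
    have "(1, 0, -1, r') \<in> joint_acts" using joint_acts_comp[OF joint_acts_comp[OF g g] g] three_cases[of r] by auto
    then show False using sub unfolding Lb_subset by force
  qed
next
  assume D: "\<forall>s r s' r'. (s, r, s', r') \<in> joint_acts \<longrightarrow> s = s'"
  show "Lb \<subseteq> La" unfolding Lb_subset
  proof (intro allI impI)
    fix s' r' assume g: "(1, 0, s', r') \<in> joint_acts"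
    then have "s' = 1" using D by metis
    moreover from this g have "(1, r') \<in> acts z" unfolding acts_z by blast
    ultimately show "s' = 1 \<and> r' = 0" using assms(1) rotI by blast
  qed
qed

lemma not_odd_x: "\<not> odd_act x \<Longrightarrow> (s, r, s', r') \<in> joint_acts \<Longrightarrow> s = 1"
  using joint_acts_sign acts_x unfolding odd_act_def by blast

lemma not_odd_z: "\<not> odd_act z \<Longrightarrow> (s, r, s', r') \<in> joint_acts \<Longrightarrow> s' = 1"
  using joint_acts_sign acts_z unfolding odd_act_def by blast

lemma parity_differs:
  assumes "odd_act x \<noteq> odd_act z"
  obtains s r s' r' where "(s, r, s', r') \<in> joint_acts" "s \<noteq> s'"
proof (cases "odd_act x")
  case True
  then obtain r s' r' where "(-1, r, s', r') \<in> joint_acts" unfolding odd_act_def acts_x by blast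
  then show ?thesis using that not_odd_z[of "-1" r s' r'] assms True by force
next
  case False
  then obtain r s r' where "(s, r, -1, r') \<in> joint_acts" using assms unfolding odd_act_def acts_z by blast
  then show ?thesis using that not_odd_x[of s r "-1" r'] False by force
qed

end

section \<open>The table of factor degrees and the criterion for equal splitting fields\<close>

theorem theorem4p10:
  fixes \<iota> :: "'k::field \<Rightarrow> 'm::field" and a b :: 'm
  assumes "\<iota> \<in> ring_hom ring_of_type_algebra ring_of_type_algebra"
    and "CHAR('k) \<noteq> 3"
    and "infinite (UNIV :: 'm set)"
    and "a \<noteq> b"
    and "a * (4 * a + 27) \<noteq> 0"
    and "b * (4 * b + 27) \<noteq> 0"
  shows "let La = spl (cubic a); Lb = spl (cubic b); Ga = gal La; Gb = gal Lb;
             S3 = sym_group 3; C3 = integer_mod_group 3; C2 = integer_mod_group 2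
         in
      (Factorial_Ring.irreducible (cubic a) \<and> Coset.order Ga \<ge> Coset.order Gb \<longrightarrow>
        (Ga \<cong> S3 \<or> Ga \<cong> C3) \<and>
        (Ga \<cong> S3 \<longrightarrow>
          (Gb \<cong> S3 \<or> Gb \<cong> C3 \<or> Gb \<cong> C2 \<or> trivial_group Gb) \<and>
          (Gb \<cong> S3 \<longrightarrow>
            (La \<inter> Lb = base \<or> ring.dimension ring_of_type_algebra 2 base (La \<inter> Lb) \<or> La = Lb) \<and>
            (La \<inter> Lb = base \<longrightarrow> factor_degrees (H a b) {#6#}) \<and>
            (ring.dimension ring_of_type_algebra 2 base (La \<inter> Lb) \<longrightarrow>
              factor_degrees (H a b) {#3, 3#}) \<and>
            (La = Lb \<longrightarrow> factor_degrees (H a b) {#1, 2, 3#})) \<and>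
          (Gb \<cong> C3 \<longrightarrow> La \<inter> Lb = base \<and> factor_degrees (H a b) {#6#}) \<and>
          (Gb \<cong> C2 \<longrightarrow>
            (\<not> Lb \<subseteq> La \<longrightarrow> factor_degrees (H a b) {#6#}) \<and>
            (Lb \<subseteq> La \<longrightarrow> factor_degrees (H a b) {#3, 3#})) \<and>
          (trivial_group Gb \<longrightarrow> factor_degrees (H a b) {#6#})) \<and>
        (Ga \<cong> C3 \<longrightarrow>
          (Gb \<cong> C3 \<or> Gb \<cong> C2 \<or> trivial_group Gb) \<and>
          (Gb \<cong> C3 \<longrightarrow>
            (La \<noteq> Lb \<longrightarrow> factor_degrees (H a b) {#3, 3#}) \<and>
            (La = Lb \<longrightarrow> factor_degrees (H a b) {#1, 1, 1, 3#})) \<and>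
          (Gb \<cong> C2 \<longrightarrow> La \<inter> Lb = base \<and> factor_degrees (H a b) {#6#}) \<and>
          (trivial_group Gb \<longrightarrow> factor_degrees (H a b) {#3, 3#}))) \<and>
      (La = Lb \<longleftrightarrow>
        (\<exists>u :: 'm. u ^ 3 - 2 * a * u ^ 2 - 9 * a * u - 2 * a ^ 2 - 27 * a \<noteq> 0 \<and>
          b = a * (u ^ 2 + 9 * u - 3 * a) ^ 3 /
              (u ^ 3 - 2 * a * u ^ 2 - 9 * a * u - 2 * a ^ 2 - 27 * a) ^ 2))"
proof -
  have b0: "b \<noteq> 0" using assms(6) by auto
  obtain x where x: "enumerates x (cubic a)" using cubic_enumerate[OF assms(5)] by blast
  obtain z where z: "enumerates z (cubic b)" using cubic_enumerate[OF assms(6)] by blast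
  interpret two_cubics a b x z by unfold_locales (fact x z assms(4) b0)+
  note ta = gal_types[OF x] and tb = gal_types[OF z]
  have A: "(gal La \<cong> sym_group 3 \<or> gal La \<cong> integer_mod_group 3) \<and>
        (gal La \<cong> sym_group 3 \<longrightarrow>
          (gal Lb \<cong> sym_group 3 \<or> gal Lb \<cong> integer_mod_group 3 \<or> gal Lb \<cong> integer_mod_group 2 \<or> trivial_group (gal Lb)) \<and>
          (gal Lb \<cong> sym_group 3 \<longrightarrow>
            (La \<inter> Lb = base \<or> ring.dimension ring_of_type_algebra 2 base (La \<inter> Lb) \<or> La = Lb) \<and>
            (La \<inter> Lb = base \<longrightarrow> factor_degrees (H a b) {#6#}) \<and>
            (ring.dimension ring_of_type_algebra 2 base (La \<inter> Lb) \<longrightarrow>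
              factor_degrees (H a b) {#3, 3#}) \<and>
            (La = Lb \<longrightarrow> factor_degrees (H a b) {#1, 2, 3#})) \<and>
          (gal Lb \<cong> integer_mod_group 3 \<longrightarrow> La \<inter> Lb = base \<and> factor_degrees (H a b) {#6#}) \<and>
          (gal Lb \<cong> integer_mod_group 2 \<longrightarrow>
            (\<not> Lb \<subseteq> La \<longrightarrow> factor_degrees (H a b) {#6#}) \<and>
            (Lb \<subseteq> La \<longrightarrow> factor_degrees (H a b) {#3, 3#})) \<and>
          (trivial_group (gal Lb) \<longrightarrow> factor_degrees (H a b) {#6#})) \<and>
        (gal La \<cong> integer_mod_group 3 \<longrightarrow>
          (gal Lb \<cong> integer_mod_group 3 \<or> gal Lb \<cong> integer_mod_group 2 \<or> trivial_group (gal Lb)) \<and>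
          (gal Lb \<cong> integer_mod_group 3 \<longrightarrow>
            (La \<noteq> Lb \<longrightarrow> factor_degrees (H a b) {#3, 3#}) \<and>
            (La = Lb \<longrightarrow> factor_degrees (H a b) {#1, 1, 1, 3#})) \<and>
          (gal Lb \<cong> integer_mod_group 2 \<longrightarrow> La \<inter> Lb = base \<and> factor_degrees (H a b) {#6#}) \<and>
          (trivial_group (gal Lb) \<longrightarrow> factor_degrees (H a b) {#3, 3#}))"
    if irr: "Factorial_Ring.irreducible (cubic a)" and ord: "Coset.order (gal La) \<ge> Coset.order (gal Lb)"
  proof -
    have rx: "rot x" using irreducible_rot[OF x irr] .
    \<comment> \<open>As \<open>rot x\<close> holds, comparing the orders excludes exactly C_3 for
      the first group with S_3 for the second.\<close>
    have oab: "odd_act x \<or> \<not> (rot z \<and> odd_act z)"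
      using ord rx unfolding order_gal[OF x] order_gal[OF z] card_acts by (auto split: if_splits)
    have eqE: "La = Lb \<longleftrightarrow> (1, 1, 1, 0) \<notin> joint_acts" by (rule eq_iff_not_E[OF rx])
    \<comment> \<open>Equal fields have the same Galois group, and its isomorphism type recovers
      \<open>rot\<close> and \<open>odd_act\<close>.\<close>
    have same: "rot x = rot z \<and> odd_act x = odd_act z" if "La = Lb"
      using ta tb unfolding that by blast
    have f6: "factor_degrees (H a b) {#6#}" if "La \<noteq> Lb" "odd_act x \<noteq> odd_act z"
      using parity_differs[OF that(2)] factor_6 that(1) eqE by metis
    have f6': "factor_degrees (H a b) {#6#}"
      if "La \<noteq> Lb" "\<not> (\<forall>s r s' r'. (s, r, s', r') \<in> joint_acts \<longrightarrow> s = s')"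
      using factor_6 that eqE by blast
    have f33: "factor_degrees (H a b) {#3, 3#}"
      if "La \<noteq> Lb" "\<forall>s r s' r'. (s, r, s', r') \<in> joint_acts \<longrightarrow> s = s'"
      using factor_33 that eqE by blast
    have base': "La \<inter> Lb = base" if "La \<noteq> Lb" "odd_act x \<longrightarrow> \<not> (\<forall>s r s' r'. (s, r, s', r') \<in> joint_acts \<longrightarrow> s = s')"
      using inter_eq_base odd_even_exists that eqE by metis
    have dim: "ring.dimension ring_of_type_algebra 2 base (La \<inter> Lb)"
      if "La \<noteq> Lb" "odd_act x" "\<forall>s r s' r'. (s, r, s', r') \<in> joint_acts \<longrightarrow> s = s'"
      using inter_dimension that eqE by blast
    \<comment> \<open>Equality of the fields excludes the other two alternatives for the
      intersection, so their implications hold vacuously in that case.\<close>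
    have ndim: "\<not> ring.dimension ring_of_type_algebra 2 base (La \<inter> Lb)" if "La = Lb"
      using rot_dimension_ne_2[OF x rx] that by simp
    have nbase: "La \<inter> Lb \<noteq> base" if "La = Lb"
    proof
      assume "La \<inter> Lb = base"
      then have "base = La" using that by simp
      moreover obtain \<sigma> where \<sigma>: "aut base \<sigma>" "act x \<sigma> 1 1" using rx by (auto simp: rot_def acts_def)
      ultimately have "\<sigma> (x 0) = x 0" using enumerates_in_spl[OF x, of 0] by (auto simp: aut_def)
      then have "x 1 = x 0" using \<sigma>(2) by (simp add: act_def)
      then show False using enumerates_distinct(1)[OF x] by simp
    qed
    show ?thesis
    proof (cases "odd_act x")
      case True
      have s3: "(La \<inter> Lb = base \<or> ring.dimension ring_of_type_algebra 2 base (La \<inter> Lb) \<or> La = Lb) \<and>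
            (La \<inter> Lb = base \<longrightarrow> factor_degrees (H a b) {#6#}) \<and>
            (ring.dimension ring_of_type_algebra 2 base (La \<inter> Lb) \<longrightarrow> factor_degrees (H a b) {#3, 3#}) \<and>
            (La = Lb \<longrightarrow> factor_degrees (H a b) {#1, 2, 3#})"
      proof (cases "La = Lb")
        case eq: True
        then show ?thesis using ndim nbase factor_equi(1)[OF rx eq True] by blast
      next
        case ne: False
        show ?thesis
        proof (cases "\<forall>s r s' r'. (s, r, s', r') \<in> joint_acts \<longrightarrow> s = s'")
          case D: True
          have "La \<inter> Lb \<noteq> base" using dim[OF ne True D] base_dimension_ne_2 by metis
          then show ?thesis using dim[OF ne True D] f33[OF ne D] ne by blast
        next
          case D: False
          have "La \<inter> Lb = base" using base'[OF ne] D by blast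
          then show ?thesis using f6'[OF ne D] base_dimension_ne_2 ne by metis
        qed
      qed
      have c3: "La \<inter> Lb = base \<and> factor_degrees (H a b) {#6#}" if "\<not> odd_act z"
      proof -
        have "La \<noteq> Lb" using same that True by blast
        moreover have "\<not> (\<forall>s r s' r'. (s, r, s', r') \<in> joint_acts \<longrightarrow> s = s')"
          using parity_differs that True by metis
        ultimately show ?thesis using base' f6' by blast
      qed
      have c2: "(\<not> Lb \<subseteq> La \<longrightarrow> factor_degrees (H a b) {#6#}) \<and> (Lb \<subseteq> La \<longrightarrow> factor_degrees (H a b) {#3, 3#})"
        if "\<not> rot z" "odd_act z"
      proof -
        have "La \<noteq> Lb" using same that rx by blast
        then show ?thesis using Lb_subset_iff[OF that] f6' f33 by blast
      qed
      show ?thesis unfolding ta tb using rx True s3 c3 c2 by blast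
    next
      case False
      have c3: "La \<noteq> Lb \<longrightarrow> factor_degrees (H a b) {#3, 3#}" if "\<not> odd_act z"
        using f33 not_odd_x[OF False] not_odd_z[OF that] by blast
      have c3': "La = Lb \<longrightarrow> factor_degrees (H a b) {#1, 1, 1, 3#}"
        using factor_equi(2)[OF rx _ False] by blast
      have c2: "La \<inter> Lb = base \<and> factor_degrees (H a b) {#6#}" if "odd_act z"
        using that same False f6 base' by blast
      have c1: "factor_degrees (H a b) {#3, 3#}" if "\<not> rot z" "\<not> odd_act z"
        using c3[OF that(2)] same that(1) rx by blast
      show ?thesis unfolding ta tb using rx False oab c3 c3' c2 c1 by blast
    qed
  qed
  have B: "La = Lb \<longleftrightarrow>
        (\<exists>u :: 'm. u ^ 3 - 2 * a * u ^ 2 - 9 * a * u - 2 * a ^ 2 - 27 * a \<noteq> 0 \<and>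
          b = a * (u ^ 2 + 9 * u - 3 * a) ^ 3 /
              (u ^ 3 - 2 * a * u ^ 2 - 9 * a * u - 2 * a ^ 2 - 27 * a) ^ 2)"
    using eq_iff_param unfolding H_num_def H_den_def .
  show ?thesis unfolding Let_def
    by (rule conjI, rule impI, erule conjE, rule A, assumption+, rule B)
qed

end
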